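(* Let $k\ge2$, and let $z_k(n)=\operatorname{zcl}_k(P^n)$ for $n\ge0$. Then $z_k(0)=0$, and for all integers $n=2^e+d$ with $e\ge0$ and $0\le d<2^e$, $$z_k(n)=\min\bigl(z_k(d)+k2^e,\ (k-1)(2^{e+1}-1)\bigr).$$ Equivalently, if $g_k(n)=kn-\operatorname{zcl}_k(P^n)$, then $g_k(0)=0$ and, for all $n=2^e+d$ with $e\ge0$ and $0\le d<2^e$, $$g_k(n)=\max\bigl(g_k(d),\ kn-(k-1)(2^{e+1}-1)\bigr).$$
   Context: $P^n$ denotes $n$-dimensional real projective space, and all cohomology is with coefficients in $\mathbb{Z}_2=\mathbb{Z}/2$. For a space $X$, $\operatorname{zcl}_k(X)$ is the maximal number of (not necessarily distinct) elements of $\ker(\Delta^*:H^*(X)^{\otimes k}\to H^*(X))$ having nonzero product, where $\Delta^*$ is induced by the diagonal $X\to X^k$ (i.e. it is the iterated cup product). For $X=P^n$ it is known that $$\operatorname{zcl}_k(P^n)=\max\{a_1+\cdots+a_{k-1}:(x_1+x_k)^{a_1}\cdots(x_{k-1}+x_k)^{a_{k-1}}\ne 0\},$$ where $a_1,\dots,a_{k-1}$ are nonnegative integers and the product is taken in $\mathbb{Z}_2[x_1,\ldots,x_k]/(x_1^{n+1},\ldots,x_k^{n+1})$. *)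

theory Defs
  imports "HOL-Homology.Homology" "HOL-Algebra.QuotRing" "HOL-Library.Z2"
    "HOL-Library.Extended_Nat" "HOL-Library.Poly_Mapping"
begin

section \<open>Real projective space\<close>

definition antipodal_class :: "(nat \<Rightarrow> real) \<Rightarrow> (nat \<Rightarrow> real) set" where
  "antipodal_class x = {x, \<lambda>i. - x i}"

text \<open>The quotient topology on the set of antipodal pairs of points of the sphere.\<close>

definition projective_space :: "nat \<Rightarrow> (nat \<Rightarrow> real) set topology" where
  "projective_space n = topology (\<lambda>U. U \<subseteq> antipodal_class ` topspace (nsphere n) \<and>
     openin (nsphere n) {x \<in> topspace (nsphere n). antipodal_class x \<in> U})"

lemma openin_projective_space:
  "openin (projective_space n) U \<longleftrightarrow> U \<subseteq> antipodal_class ` topspace (nsphere n) \<and>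
     openin (nsphere n) {x \<in> topspace (nsphere n). antipodal_class x \<in> U}"
proof -
  let ?P = "\<lambda>U. {x \<in> topspace (nsphere n). antipodal_class x \<in> U}"
  have "?P (S \<inter> T) = ?P S \<inter> ?P T" for S T
    by auto
  moreover have "?P (\<Union>\<K>) = \<Union>(?P ` \<K>)" for \<K>
    by auto
  ultimately have "istopology (\<lambda>U. U \<subseteq> antipodal_class ` topspace (nsphere n) \<and>
                                   openin (nsphere n) (?P U))"
    unfolding istopology_def by (auto simp del: mem_Collect_eq)
  then show ?thesis
    by (simp add: projective_space_def topology_inverse')
qed

lemma quotient_map_antipodal_class:
  "quotient_map (nsphere n) (projective_space n) antipodal_class"
proof -
  let ?S = "antipodal_class ` topspace (nsphere n)"
  have "{x \<in> topspace (nsphere n). antipodal_class x \<in> ?S} = topspace (nsphere n)"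
    by auto
  then have "openin (projective_space n) ?S"
    by (simp add: openin_projective_space)
  moreover have "U \<subseteq> ?S" if "openin (projective_space n) U" for U
    using that by (simp add: openin_projective_space)
  ultimately have "topspace (projective_space n) = ?S"
    by (metis openin_subset openin_topspace subset_antisym)
  then show ?thesis
    by (auto simp: quotient_map_def openin_projective_space)
qed


section \<open>The mod 2 singular cohomology ring\<close>

text \<open>
  An element of the total cochain group, the direct sum of the groups \<open>C\<^sup>p(X; \<int>\<^sub>2)\<close>, is a
  function \<open>c\<close> of a degree \<open>p\<close> and a singular \<open>p\<close>-simplex; it is extended by 0 outside the singular
  simplices of \<open>X\<close>.
\<close>

type_synonym 'a cochain = "nat \<Rightarrow> ((nat \<Rightarrow> real) \<Rightarrow> 'a) \<Rightarrow> bit"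

definition cochains :: "'a topology \<Rightarrow> 'a cochain set" where
  "cochains X = {c. (\<forall>p \<sigma>. c p \<sigma> \<noteq> 0 \<longrightarrow> singular_simplex p X \<sigma>) \<and>
                    finite {p. \<exists>\<sigma>. c p \<sigma> \<noteq> 0}}"

definition coboundary :: "'a topology \<Rightarrow> 'a cochain \<Rightarrow> 'a cochain" where
  "coboundary X c = (\<lambda>p \<sigma>. if 0 < p \<and> singular_simplex p X \<sigma>
                             then \<Sum>i\<le>p. c (p - 1) (singular_face p i \<sigma>) else 0)"

text \<open>
  The restrictions of a singular \<open>(p+q)\<close>-simplex to the face spanned by the vertices
  \<open>0, \<dots>, p\<close> and to the face spanned by the vertices \<open>p, \<dots>, p+q\<close>.
\<close>

definition front_face :: "nat \<Rightarrow> ((nat \<Rightarrow> real) \<Rightarrow> 'a) \<Rightarrow> (nat \<Rightarrow> real) \<Rightarrow> 'a" where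
  "front_face p \<sigma> = restrict \<sigma> (standard_simplex p)"

definition back_face :: "nat \<Rightarrow> nat \<Rightarrow> ((nat \<Rightarrow> real) \<Rightarrow> 'a) \<Rightarrow> (nat \<Rightarrow> real) \<Rightarrow> 'a" where
  "back_face p q \<sigma> =
     restrict (\<lambda>x. \<sigma> (\<lambda>i. if i < p then 0 else x (i - p))) (standard_simplex q)"

definition cup :: "'a topology \<Rightarrow> 'a cochain \<Rightarrow> 'a cochain \<Rightarrow> 'a cochain" where
  "cup X a b = (\<lambda>n \<sigma>. if singular_simplex n X \<sigma>
                        then \<Sum>p\<le>n. a p (front_face p \<sigma>) * b (n - p) (back_face p (n - p) \<sigma>)
                        else 0)"

definition unit_cochain :: "'a topology \<Rightarrow> 'a cochain" where
  "unit_cochain X = (\<lambda>p \<sigma>. if p = 0 \<and> singular_simplex 0 X \<sigma> then 1 else 0)"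

definition cocycle_ring :: "'a topology \<Rightarrow> 'a cochain ring" where
  "cocycle_ring X = \<lparr>carrier = {c \<in> cochains X. coboundary X c = (\<lambda>p \<sigma>. 0)},
     monoid.mult = cup X, one = unit_cochain X,
     zero = (\<lambda>p \<sigma>. 0), add = (\<lambda>a b p \<sigma>. a p \<sigma> + b p \<sigma>)\<rparr>"

definition cohomology_ring :: "'a topology \<Rightarrow> 'a cochain set ring" where
  "cohomology_ring X = cocycle_ring X Quot (coboundary X ` cochains X)"


section \<open>Tensor powers over \<open>\<int>\<^sub>2\<close>\<close>

text \<open>
  For a ring \<open>R\<close> with \<open>2 = 0\<close>, the algebra over \<open>\<int>\<^sub>2\<close> with basis the \<open>k\<close>-tuples of elements of \<open>R\<close>,
  which are multiplied componentwise.
\<close>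

definition free_tensor_ring ::
    "nat \<Rightarrow> ('a, 'm) ring_scheme \<Rightarrow> ((nat \<Rightarrow> 'a) \<Rightarrow>\<^sub>0 bit) ring" where
  "free_tensor_ring k R =
     \<lparr>carrier = {f. Poly_Mapping.keys f \<subseteq> {..<k} \<rightarrow>\<^sub>E carrier R},
      monoid.mult = (\<lambda>f g. \<Sum>s\<in>Poly_Mapping.keys f. \<Sum>t\<in>Poly_Mapping.keys g.
        Poly_Mapping.single (\<lambda>i\<in>{..<k}. s i \<otimes>\<^bsub>R\<^esub> t i)
          (Poly_Mapping.lookup f s * Poly_Mapping.lookup g t)),
      one = Poly_Mapping.single (\<lambda>i\<in>{..<k}. \<one>\<^bsub>R\<^esub>) 1, zero = 0, add = (+)\<rparr>"

text \<open>
  Additivity in each argument; over \<open>\<int>\<^sub>2\<close> this is the same as multilinearity.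
\<close>

definition multilinear_relations ::
    "nat \<Rightarrow> ('a, 'm) ring_scheme \<Rightarrow> ((nat \<Rightarrow> 'a) \<Rightarrow>\<^sub>0 bit) set" where
  "multilinear_relations k R =
     {Poly_Mapping.single (t(i := a \<oplus>\<^bsub>R\<^esub> b)) 1 - Poly_Mapping.single (t(i := a)) 1
        - Poly_Mapping.single (t(i := b)) 1
      | t i a b. t \<in> {..<k} \<rightarrow>\<^sub>E carrier R \<and> i < k \<and> a \<in> carrier R \<and> b \<in> carrier R}"

definition tensor_ideal :: "nat \<Rightarrow> ('a, 'm) ring_scheme \<Rightarrow> ((nat \<Rightarrow> 'a) \<Rightarrow>\<^sub>0 bit) set" where
  "tensor_ideal k R = Idl\<^bsub>free_tensor_ring k R\<^esub> (multilinear_relations k R)"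

definition tensor_power ::
    "nat \<Rightarrow> ('a, 'm) ring_scheme \<Rightarrow> ((nat \<Rightarrow> 'a) \<Rightarrow>\<^sub>0 bit) set ring" where
  "tensor_power k R = free_tensor_ring k R Quot tensor_ideal k R"

definition ring_list_prod :: "('a, 'm) ring_scheme \<Rightarrow> 'a list \<Rightarrow> 'a" where
  "ring_list_prod R xs = foldr (\<otimes>\<^bsub>R\<^esub>) xs \<one>\<^bsub>R\<^esub>"

text \<open>
  The iterated multiplication \<open>a\<^sub>0 \<otimes> \<dots> \<otimes> a\<^bsub>k-1\<^esub> \<mapsto> a\<^sub>0 \<cdots> a\<^bsub>k-1\<^esub>\<close>, first on
  representatives (all nonzero coefficients are 1) and then on the tensor power, where
  \<open>the_elem\<close> selects the common value on a coset.
\<close>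

definition free_iterated_mult ::
    "nat \<Rightarrow> ('a, 'm) ring_scheme \<Rightarrow> ((nat \<Rightarrow> 'a) \<Rightarrow>\<^sub>0 bit) \<Rightarrow> 'a" where
  "free_iterated_mult k R f =
     (\<Oplus>\<^bsub>R\<^esub>t\<in>Poly_Mapping.keys f. ring_list_prod R (map t [0..<k]))"

definition iterated_mult ::
    "nat \<Rightarrow> ('a, 'm) ring_scheme \<Rightarrow> ((nat \<Rightarrow> 'a) \<Rightarrow>\<^sub>0 bit) set \<Rightarrow> 'a" where
  "iterated_mult k R u = the_elem (free_iterated_mult k R ` u)"


section \<open>Zero-divisor cup length\<close>

text \<open>
  The value is \<open>\<infinity>\<close> if there are arbitrarily long nonzero
  products.
\<close>

definition zcl :: "nat \<Rightarrow> 'a topology \<Rightarrow> enat" where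
  "zcl k X =
     (let H = cohomology_ring X; T = tensor_power k H
      in Sup {enat (length us) | us.
           set us \<subseteq> a_kernel T H (iterated_mult k H) \<and> ring_list_prod T us \<noteq> \<zero>\<^bsub>T\<^esub>})"

definition zcl_gap :: "nat \<Rightarrow> nat \<Rightarrow> int" where
  "zcl_gap k n = int (k * n) - int (the_enat (zcl k (projective_space n)))"

end

theory Submission
  imports Defs "HOL-Computational_Algebra.Polynomial"
    "HOL-Computational_Algebra.Formal_Power_Series" "HOL-Library.Nat_Bijection"
begin

text \<open>
  Cochains of \<open>P\<^sup>n\<close> modulo 2 are the antipode-invariant cochains of \<open>S\<^sup>n\<close>, since every simplex of
  \<open>P\<^sup>n\<close> has exactly two lifts. The resulting transfer exact sequence has as connecting map the cup
  product with the class \<open>w\<close> of the coboundary of the cochain on \<open>S\<^sup>n\<close> that records the sign of a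
  coordinate. As \<open>S\<^sup>n\<close> has no cohomology in degrees strictly between \<open>0\<close> and \<open>n\<close>, the powers of \<open>w\<close>
  up to \<open>w\<^sup>n\<close> span the cohomology of \<open>P\<^sup>n\<close>, and they do not vanish. Finally \<open>w\<^bsup>n+1\<^esup> = 0\<close>: the
  sign of the coordinate \<open>x\<^sub>i\<close> gives a representative of \<open>w\<close> that vanishes on simplices inside
  \<open>x\<^sub>i \<noteq> 0\<close>, and these \<open>n + 1\<close> open sets cover \<open>P\<^sup>n\<close>.

  Hence the tensor power is \<open>\<int>\<^sub>2[x\<^sub>1, \<dots>, x\<^sub>k]/(x\<^sub>i\<^bsup>n+1\<^esup>)\<close>, the kernel of the iterated multiplication
  is generated by the \<open>x\<^sub>i + x\<^sub>k\<close>, and the zero-divisor cup length is the largest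
  \<open>a\<^sub>1 + \<dots> + a\<^bsub>k-1\<^esub>\<close> with \<open>\<Prod>(x\<^sub>i + x\<^sub>k)\<^bsup>a\<^sub>i\<^esup> \<noteq> 0\<close>. By Lucas's theorem a nonzero coefficient of
  this product amounts to a splitting of the binary digits of the \<open>a\<^sub>i\<close> between \<open>x\<^sub>i\<close> and \<open>x\<^sub>k\<close>,
  and the recursion comes from adding or removing the digit \<open>2\<^sup>e\<close>.
\<close>

section \<open>Simplicial operators and the cup product\<close>

text \<open>Everything about spheres comes from their integral homology. Two facts carry it over to
  cochains modulo 2: over a field, a functional that kills all cycles factors through the boundary;
  and since the homology of a sphere has no 2-torsion, a cycle modulo 2 is an integral cycle plus
  twice a chain. Commutativity, which fails for cup products of cochains, comes for free: sending
  \<open>x\<close> to one fixed 1-cocycle is multiplicative already on cochains, so a commutative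
  polynomial ring maps onto the cohomology. Multiplication by \<open>w\<close> is injective outside
  degree \<open>n\<close>, because its kernel consists of transfers from the sphere; this gives both
  the nonvanishing of the low powers and, with \<open>w^(n+1) = 0\<close>, the vanishing of the
  cohomology above \<open>n\<close>. The tensor power is a quotient by a generated ideal, in which
  nothing is visibly nonzero; nonzero elements are detected by functionals that are additive in
  every slot and hence vanish on that ideal. The recursion rests on one fact about powers of 2: if
  all are at most \<open>2^e\<close> and their sum is at least \<open>2^e\<close>, some of them sum
  to exactly \<open>2^e\<close>.\<close>

definition affine_push :: "nat \<Rightarrow> (nat \<Rightarrow> nat) \<Rightarrow> (nat \<Rightarrow> real) \<Rightarrow> nat \<Rightarrow> real" where
  "affine_push p \<theta> x = (\<lambda>j. \<Sum>i | i \<in> {..p} \<and> \<theta> i = j. x i)"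

text \<open>\<open>affine_push\<close> is the affine map of simplices induced by a map of vertices.
  Front faces, back faces and \<open>singular_face\<close> are all restrictions along such maps, so
  by \<open>simplex_op_simplex_op\<close> identities between iterated faces reduce to identities
  between functions on \<open>nat\<close>.\<close>

definition simplex_op ::
    "nat \<Rightarrow> (nat \<Rightarrow> nat) \<Rightarrow> ((nat \<Rightarrow> real) \<Rightarrow> 'a) \<Rightarrow> (nat \<Rightarrow> real) \<Rightarrow> 'a" where
  "simplex_op p \<theta> \<sigma> = restrict (\<lambda>x. \<sigma> (affine_push p \<theta> x)) (standard_simplex p)"

definition skip :: "nat \<Rightarrow> nat \<Rightarrow> nat" where
  "skip k i = (if i < k then i else Suc i)"

text \<open>Sums and products of bits stay in ring notation, so that distributivity and the rules
  for finite sums keep applying.\<close>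

declare add_bit_eq_xor [simp del] mult_bit_eq_and [simp del]

lemma bit_add_same [simp]: "(x::bit) + x = 0"
  by (cases x) auto

lemma affine_push_in_standard_simplex:
  assumes "\<theta> \<in> {..p} \<rightarrow> {..q}" "x \<in> standard_simplex p"
  shows "affine_push p \<theta> x \<in> standard_simplex q"
proof -
  have x: "\<And>i. 0 \<le> x i" "sum x {..p} = 1"
    using assms(2) by (auto simp: standard_simplex_def)
  have "(\<Sum>i | i \<in> {..p} \<and> \<theta> i = j. x i) \<le> 1" for j
    using sum_mono2[of "{..p}" "{i. i \<in> {..p} \<and> \<theta> i = j}" x] x by auto
  moreover have "(\<Sum>i | i \<in> {..p} \<and> \<theta> i = j. x i) = 0" if "j > q" for j
  proof -
    have "{i. i \<in> {..p} \<and> \<theta> i = j} = {}"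
      using that funcset_mem[OF assms(1)] by (auto simp flip: not_le)
    then show ?thesis by (simp only: sum.empty)
  qed
  moreover have "(\<Sum>j\<le>q. \<Sum>i | i \<in> {..p} \<and> \<theta> i = j. x i) = 1"
    using sum.group[of "{..p}" "{..q}" \<theta> x] assms(1) x by auto
  ultimately show ?thesis
    using x(1) by (auto simp: standard_simplex_def affine_push_def intro: sum_nonneg)
qed

text \<open>The coordinates in the fibre of the composite over \<open>l\<close> are grouped by their
  value under \<open>\<theta>\<close>; as \<open>\<theta>\<close> lands in \<open>{..q}\<close>, no
  coordinate is lost.\<close>

lemma affine_push_affine_push:
  assumes "\<theta> \<in> {..p} \<rightarrow> {..q}"
  shows "affine_push q \<theta>' (affine_push p \<theta> x) = affine_push p (\<lambda>i. \<theta>' (\<theta> i)) x"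
proof
  fix l
  have eq: "{i \<in> {i. i \<in> {..p} \<and> \<theta>' (\<theta> i) = l}. \<theta> i = y} = {i. i \<in> {..p} \<and> \<theta> i = y}"
    if "y \<in> {j. j \<in> {..q} \<and> \<theta>' j = l}" for y
    using that by auto
  have "sum x {i. i \<in> {..p} \<and> \<theta>' (\<theta> i) = l} =
        (\<Sum>y | y \<in> {..q} \<and> \<theta>' y = l. sum x {i \<in> {i. i \<in> {..p} \<and> \<theta>' (\<theta> i) = l}. \<theta> i = y})"
    using assms by (intro sum.group[symmetric]) auto
  also have "\<dots> = (\<Sum>y | y \<in> {..q} \<and> \<theta>' y = l. sum x {i. i \<in> {..p} \<and> \<theta> i = y})"
    by (rule sum.cong[OF refl]) (simp only: eq)
  finally show "affine_push q \<theta>' (affine_push p \<theta> x) l = affine_push p (\<lambda>i. \<theta>' (\<theta> i)) x l"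
    unfolding affine_push_def by simp
qed

lemma affine_push_shift:
  assumes "x \<in> standard_simplex q"
  shows "affine_push q (\<lambda>i. i + p) x = (\<lambda>i. if i < p then 0 else x (i - p))"
proof
  fix j
  have "{i. i \<in> {..q} \<and> i + p = j} = (if p \<le> j \<and> j - p \<le> q then {j - p} else {})"
    by auto
  then show "affine_push q (\<lambda>i. i + p) x j = (if j < p then 0 else x (j - p))"
    using assms by (auto simp: affine_push_def standard_simplex_def)
qed

lemma affine_push_skip:
  assumes "x \<in> standard_simplex q"
  shows "affine_push q (skip k) x = simplical_face k x"
proof
  fix j
  have "{i. i \<in> {..q} \<and> skip k i = j} =
        (if j < k then (if j \<le> q then {j} else {}) else if j = k then {}
         else if j - 1 \<le> q then {j - 1} else {})"
    by (auto simp: skip_def split: if_splits)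
  then show "affine_push q (skip k) x j = simplical_face k x j"
    using assms by (auto simp: affine_push_def standard_simplex_def simplical_face_def)
qed

lemma continuous_map_affine_push:
  "continuous_map (powertop_real UNIV) (powertop_real UNIV) (affine_push p \<theta>)"
  unfolding affine_push_def continuous_map_componentwise_UNIV
  by (intro allI continuous_map_sum) (auto intro: continuous_map_product_projection)

lemma singular_simplex_simplex_op:
  assumes "singular_simplex q X \<sigma>" "\<theta> \<in> {..p} \<rightarrow> {..q}"
  shows "singular_simplex p X (simplex_op p \<theta> \<sigma>)"
proof -
  have "continuous_map (subtopology (powertop_real UNIV) (standard_simplex p))
          (subtopology (powertop_real UNIV) (standard_simplex q)) (affine_push p \<theta>)"
    using affine_push_in_standard_simplex[OF assms(2)] continuous_map_affine_push
    by (auto simp: continuous_map_in_subtopology intro: continuous_map_from_subtopology)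
  moreover have "continuous_map (subtopology (powertop_real UNIV) (standard_simplex q)) X \<sigma>"
    using assms(1) by (simp add: singular_simplex_def)
  ultimately have "continuous_map (subtopology (powertop_real UNIV) (standard_simplex p)) X
                     (\<sigma> \<circ> affine_push p \<theta>)"
    by (rule continuous_map_compose)
  then show ?thesis
    unfolding singular_simplex_def simplex_op_def
    by (auto intro: continuous_map_eq)
qed

lemma simplex_op_simplex_op:
  assumes "\<theta> \<in> {..p} \<rightarrow> {..q}"
  shows "simplex_op p \<theta> (simplex_op q \<theta>' \<sigma>) = simplex_op p (\<lambda>i. \<theta>' (\<theta> i)) \<sigma>"
  using assms unfolding simplex_op_def
  by (auto simp: affine_push_in_standard_simplex affine_push_affine_push)

lemma simplex_op_cong:
  assumes "\<And>i. i \<le> p \<Longrightarrow> \<theta> i = \<theta>' i"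
  shows "simplex_op p \<theta> \<sigma> = simplex_op p \<theta>' \<sigma>"
proof -
  have "{i. i \<in> {..p} \<and> \<theta> i = j} = {i. i \<in> {..p} \<and> \<theta>' i = j}" for j
    using assms by auto
  then show ?thesis
    by (simp add: simplex_op_def affine_push_def)
qed

lemma affine_push_id:
  assumes "x \<in> standard_simplex p"
  shows "affine_push p (\<lambda>i. i) x = x"
  using affine_push_shift[OF assms, of 0] by simp

lemma simplex_op_id:
  assumes "singular_simplex p X \<sigma>"
  shows "simplex_op p (\<lambda>i. i) \<sigma> = \<sigma>"
  using assms unfolding simplex_op_def singular_simplex_def
  by (metis (mono_tags, lifting) affine_push_id extensional_restrict restrict_ext)

lemma front_face_eq: "front_face p \<sigma> = simplex_op p (\<lambda>i. i) \<sigma>"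
  by (auto simp: front_face_def simplex_op_def affine_push_id)

lemma back_face_eq: "back_face p q \<sigma> = simplex_op q (\<lambda>i. i + p) \<sigma>"
  by (auto simp: back_face_def simplex_op_def affine_push_shift)

lemma singular_face_eq: "singular_face p k \<sigma> = simplex_op (p - 1) (skip k) \<sigma>"
  by (auto simp: singular_face_def simplex_op_def affine_push_skip)

lemma simplex_op_simplex_map:
  assumes "\<theta> \<in> {..p} \<rightarrow> {..q}"
  shows "simplex_op p \<theta> (simplex_map q g \<sigma>) = simplex_map p g (simplex_op p \<theta> \<sigma>)"
  using affine_push_in_standard_simplex[OF assms]
  by (auto simp: simplex_op_def simplex_map_def)

lemma cup_eq:
  assumes "singular_simplex n X \<sigma>"
  shows "cup X a b n \<sigma> = (\<Sum>p\<le>n. a p (simplex_op p (\<lambda>i. i) \<sigma>) *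
                                   b (n - p) (simplex_op (n - p) (\<lambda>i. i + p) \<sigma>))"
  using assms by (simp add: cup_def front_face_eq back_face_eq)

lemma coboundary_0 [simp]: "coboundary X c 0 \<sigma> = 0"
  by (simp add: coboundary_def)

lemma coboundary_Suc:
  assumes "singular_simplex (Suc p) X \<sigma>"
  shows "coboundary X c (Suc p) \<sigma> = (\<Sum>i\<le>Suc p. c p (simplex_op p (skip i) \<sigma>))"
  using assms by (simp add: coboundary_def singular_face_eq)

lemma coboundary_not_simplex: "\<not> singular_simplex p X \<sigma> \<Longrightarrow> coboundary X c p \<sigma> = 0"
  by (simp add: coboundary_def)

lemma cup_not_simplex: "\<not> singular_simplex p X \<sigma> \<Longrightarrow> cup X a b p \<sigma> = 0"
  by (simp add: cup_def)

lemma cochain_eqI: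
  fixes a b :: "'a cochain"
  assumes "\<And>p \<sigma>. \<not> singular_simplex p X \<sigma> \<Longrightarrow> a p \<sigma> = b p \<sigma>"
    and "\<And>p \<sigma>. singular_simplex p X \<sigma> \<Longrightarrow> a p \<sigma> = b p \<sigma>"
  shows "a = b"
  using assms by blast

lemma cup_assoc: "cup X (cup X a b) c = cup X a (cup X b c)"
proof (rule cochain_eqI)
  fix n and \<sigma> :: "(nat \<Rightarrow> real) \<Rightarrow> 'a"
  assume \<sigma>: "singular_simplex n X \<sigma>"
  define F where "F r s t = a r (simplex_op r (\<lambda>i. i) \<sigma>) * b s (simplex_op s (\<lambda>i. i + r) \<sigma>) *
                            c t (simplex_op t (\<lambda>i. i + (r + s)) \<sigma>)" for r s t
  have L: "cup X (cup X a b) c n \<sigma> = (\<Sum>p\<le>n. \<Sum>r\<le>p. F r (p - r) (n - p))"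
  proof -
    have "cup X a b p (simplex_op p (\<lambda>i. i) \<sigma>) =
          (\<Sum>r\<le>p. a r (simplex_op r (\<lambda>i. i) \<sigma>) * b (p - r) (simplex_op (p - r) (\<lambda>i. i + r) \<sigma>))"
      if "p \<le> n" for p
    proof -
      have "singular_simplex p X (simplex_op p (\<lambda>i. i) \<sigma>)"
        using \<sigma> that by (intro singular_simplex_simplex_op[OF \<sigma>]) auto
      moreover have "simplex_op r (\<lambda>i. i) (simplex_op p (\<lambda>i. i) \<sigma>) = simplex_op r (\<lambda>i. i) \<sigma>"
        "simplex_op (p - r) (\<lambda>i. i + r) (simplex_op p (\<lambda>i. i) \<sigma>) =
         simplex_op (p - r) (\<lambda>i. i + r) \<sigma>" if "r \<le> p" for r
        using that by (subst simplex_op_simplex_op[where q = p]; auto)+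
      ultimately show ?thesis
        by (simp add: cup_eq)
    qed
    then show ?thesis
      unfolding F_def using \<sigma> by (simp add: cup_eq sum_distrib_right)
  qed
  have R: "cup X a (cup X b c) n \<sigma> = (\<Sum>r\<le>n. \<Sum>s\<le>n - r. F r s (n - r - s))"
  proof -
    have "cup X b c (n - r) (simplex_op (n - r) (\<lambda>i. i + r) \<sigma>) =
          (\<Sum>s\<le>n - r. b s (simplex_op s (\<lambda>i. i + r) \<sigma>) *
             c (n - r - s) (simplex_op (n - r - s) (\<lambda>i. i + (r + s)) \<sigma>))"
      if "r \<le> n" for r
    proof -
      have "singular_simplex (n - r) X (simplex_op (n - r) (\<lambda>i. i + r) \<sigma>)"
        using \<sigma> that by (intro singular_simplex_simplex_op[OF \<sigma>]) auto
      moreover have "simplex_op s (\<lambda>i. i) (simplex_op (n - r) (\<lambda>i. i + r) \<sigma>) =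
                       simplex_op s (\<lambda>i. i + r) \<sigma>"
        "simplex_op (n - r - s) (\<lambda>i. i + s) (simplex_op (n - r) (\<lambda>i. i + r) \<sigma>) =
         simplex_op (n - r - s) (\<lambda>i. i + (r + s)) \<sigma>" if "s \<le> n - r" for s
        using that by (subst simplex_op_simplex_op[where q = "n - r"]; auto simp: ac_simps)+
      ultimately show ?thesis
        by (simp add: cup_eq)
    qed
    then show ?thesis
      unfolding F_def using \<sigma> by (simp add: cup_eq sum_distrib_left mult.assoc)
  qed
  \<comment> \<open>Both sides sum \<open>F r s t\<close> over \<open>r + s + t = n\<close>; the
    reindexing is the one behind associativity of the product of formal power series.\<close>
  show "cup X (cup X a b) c n \<sigma> = cup X a (cup X b c) n \<sigma>"
    unfolding L R using fps_mult_assoc_lemma[of F n n] by (simp add: atLeast0AtMost)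
qed (simp add: cup_not_simplex)

lemma cup_add_left: "cup X (\<lambda>p \<sigma>. a p \<sigma> + b p \<sigma>) c = (\<lambda>p \<sigma>. cup X a c p \<sigma> + cup X b c p \<sigma>)"
  by (auto simp: cup_def fun_eq_iff distrib_right sum.distrib)

lemma cup_add_right: "cup X c (\<lambda>p \<sigma>. a p \<sigma> + b p \<sigma>) = (\<lambda>p \<sigma>. cup X c a p \<sigma> + cup X c b p \<sigma>)"
  by (auto simp: cup_def fun_eq_iff distrib_left sum.distrib)

lemma coboundary_add:
  "coboundary X (\<lambda>p \<sigma>. a p \<sigma> + b p \<sigma>) = (\<lambda>p \<sigma>. coboundary X a p \<sigma> + coboundary X b p \<sigma>)"
  by (auto simp: coboundary_def fun_eq_iff sum.distrib)

lemma coboundary_zero: "coboundary X (\<lambda>p \<sigma>. 0) = (\<lambda>p \<sigma>. 0)"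
  by (auto simp: coboundary_def fun_eq_iff)

lemma cup_zero: "cup X (\<lambda>p \<sigma>. 0) a = (\<lambda>p \<sigma>. 0)" "cup X a (\<lambda>p \<sigma>. 0) = (\<lambda>p \<sigma>. 0)"
  by (auto simp: cup_def fun_eq_iff)

lemma simplex_op_skip_singular:
  assumes "singular_simplex (Suc p) X \<sigma>" "i \<le> Suc p"
  shows "singular_simplex p X (simplex_op p (skip i) \<sigma>)"
  by (rule singular_simplex_simplex_op[OF assms(1)]) (auto simp: skip_def)

lemma coboundary_coboundary: "coboundary X (coboundary X c) = (\<lambda>p \<sigma>. 0)"
proof (rule cochain_eqI)
  fix n and \<sigma> :: "(nat \<Rightarrow> real) \<Rightarrow> 'a"
  assume \<sigma>: "singular_simplex n X \<sigma>"
  show "coboundary X (coboundary X c) n \<sigma> = 0"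
  proof (cases "n < 2")
    case True
    then have "n = 0 \<or> n = 1" by auto
    then show ?thesis by (auto simp: coboundary_def)
  next
    case False
    then obtain m where n: "n = Suc (Suc m)"
      by (metis Suc_diff_Suc less_2_cases_iff not_less_eq numeral_2_eq_2 old.nat.exhaust)
    define G where "G i j = c m (simplex_op m (\<lambda>l. skip i (skip j l)) \<sigma>)" for i j
    have "coboundary X (coboundary X c) n \<sigma> = (\<Sum>i\<le>n. \<Sum>j\<le>Suc m. G i j)"
    proof -
      have "coboundary X c (Suc m) (simplex_op (Suc m) (skip i) \<sigma>) = (\<Sum>j\<le>Suc m. G i j)"
        if "i \<le> n" for i
      proof -
        have "singular_simplex (Suc m) X (simplex_op (Suc m) (skip i) \<sigma>)"
          using simplex_op_skip_singular[of "Suc m"] \<sigma> n that by auto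
        moreover have "simplex_op m (skip j) (simplex_op (Suc m) (skip i) \<sigma>) =
                       simplex_op m (\<lambda>l. skip i (skip j l)) \<sigma>" for j
          by (rule simplex_op_simplex_op) (auto simp: skip_def)
        ultimately show ?thesis
          by (simp add: coboundary_Suc G_def)
      qed
      then show ?thesis
        using \<sigma> unfolding n by (simp add: coboundary_Suc del: sum.atMost_Suc)
    qed
    also have "\<dots> = (\<Sum>(i,j)\<in>{..n} \<times> {..Suc m}. G i j)"
      by (simp add: sum.cartesian_product del: sum.atMost_Suc)
    \<comment> \<open>The coface identity for \<open>j < i\<close> carries the pair
      \<open>(i, j)\<close> to \<open>(j, i - 1)\<close> and so exchanges the two halves; modulo 2
      they cancel without signs.\<close>
    also have "{..n} \<times> {..Suc m} = {(i,j). j < i \<and> i \<le> n} \<union> {(i,j). i \<le> j \<and> j \<le> Suc m}"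
      unfolding n by auto
    also have "(\<Sum>(i,j)\<in>\<dots>. G i j) =
        (\<Sum>(i,j)\<in>{(i,j). j < i \<and> i \<le> n}. G i j) + (\<Sum>(i,j)\<in>{(i,j). i \<le> j \<and> j \<le> Suc m}. G i j)"
    proof (rule sum.union_disjoint)
      show "finite {(i,j). j < i \<and> i \<le> n}"
        by (rule finite_subset[of _ "{..n} \<times> {..n}"]) auto
      show "finite {(i,j). i \<le> j \<and> j \<le> Suc m}"
        by (rule finite_subset[of _ "{..Suc m} \<times> {..Suc m}"]) auto
    qed auto
    also have "(\<Sum>(i,j)\<in>{(i,j). j < i \<and> i \<le> n}. G i j) = (\<Sum>(i,j)\<in>{(i,j). i \<le> j \<and> j \<le> Suc m}. G i j)"
    proof (rule sum.reindex_bij_witness[of _ "\<lambda>(i,j). (Suc j, i)" "\<lambda>(i,j). (j, i - 1)"])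
      fix x assume "x \<in> {(i,j). j < i \<and> i \<le> n}"
      then obtain i j where x: "x = (i,j)" "j < i" "i \<le> n" by auto
      have "(\<lambda>l. skip j (skip (i - 1) l)) = (\<lambda>l. skip i (skip j l))"
        using x by (auto simp: skip_def fun_eq_iff)
      then show "(case case x of (i, j) \<Rightarrow> (j, i - 1) of (i, j) \<Rightarrow> G i j) = (case x of (i, j) \<Rightarrow> G i j)"
        by (simp add: x G_def)
    qed (auto simp: n)
    finally show ?thesis by simp
  qed
qed (simp add: coboundary_not_simplex)

text \<open>A face \<open>i \<le> p\<close> only affects the front factor of the \<open>p\<close>-th
  summand of the product, a face \<open>i > p\<close> only the back factor; the signs of the Leibniz
  rule disappear modulo 2.\<close>

lemma coboundary_cup:
  "coboundary X (cup X a b) =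
   (\<lambda>p \<sigma>. cup X (coboundary X a) b p \<sigma> + cup X a (coboundary X b) p \<sigma>)"
proof (rule cochain_eqI)
  fix N and \<sigma> :: "(nat \<Rightarrow> real) \<Rightarrow> 'a"
  assume \<sigma>: "singular_simplex N X \<sigma>"
  show "coboundary X (cup X a b) N \<sigma> =
        cup X (coboundary X a) b N \<sigma> + cup X a (coboundary X b) N \<sigma>"
  proof (cases N)
    case 0
    then show ?thesis using \<sigma> by (simp add: cup_eq)
  next
    case (Suc n)
    define A where "A p \<theta> = a p (simplex_op p \<theta> \<sigma>)" for p \<theta>
    define B where "B p \<theta> = b p (simplex_op p \<theta> \<sigma>)" for p \<theta>
    have Acong: "A p \<theta> = A p \<theta>'" if "\<And>i. i \<le> p \<Longrightarrow> \<theta> i = \<theta>' i" for p \<theta> \<theta>'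
      unfolding A_def by (rule arg_cong[where f = "a p"], rule simplex_op_cong) (rule that)
    have L: "coboundary X (cup X a b) N \<sigma> =
        (\<Sum>i\<le>Suc n. \<Sum>p\<le>n. A p (skip i) * B (n - p) (\<lambda>j. skip i (j + p)))"
    proof -
      have "cup X a b n (simplex_op n (skip i) \<sigma>) =
            (\<Sum>p\<le>n. A p (skip i) * B (n - p) (\<lambda>j. skip i (j + p)))" if "i \<le> Suc n" for i
      proof -
        have "singular_simplex n X (simplex_op n (skip i) \<sigma>)"
          using simplex_op_skip_singular \<sigma> Suc that by blast
        moreover have "simplex_op p (\<lambda>i. i) (simplex_op n (skip i) \<sigma>) = simplex_op p (skip i) \<sigma>"
          "simplex_op (n - p) (\<lambda>i. i + p) (simplex_op n (skip i) \<sigma>) =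
           simplex_op (n - p) (\<lambda>j. skip i (j + p)) \<sigma>" if "p \<le> n" for p
          using that by (subst simplex_op_simplex_op[where q = n]; auto)+
        ultimately show ?thesis
          by (simp add: cup_eq A_def B_def)
      qed
      then show ?thesis
        using \<sigma> Suc by (simp add: coboundary_Suc del: sum.atMost_Suc)
    qed
    have R1: "cup X (coboundary X a) b N \<sigma> =
        (\<Sum>p\<le>n. (\<Sum>i\<le>Suc p. A p (skip i)) * B (n - p) (\<lambda>j. j + Suc p))"
    proof -
      have "coboundary X a (Suc p) (simplex_op (Suc p) (\<lambda>i. i) \<sigma>) = (\<Sum>i\<le>Suc p. A p (skip i))"
        if "p \<le> n" for p
      proof -
        have "singular_simplex (Suc p) X (simplex_op (Suc p) (\<lambda>i. i) \<sigma>)"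
          by (rule singular_simplex_simplex_op[OF \<sigma>]) (use that Suc in auto)
        moreover have "simplex_op p (skip i) (simplex_op (Suc p) (\<lambda>i. i) \<sigma>) = simplex_op p (skip i) \<sigma>"
          if "i \<le> Suc p" for i
          by (subst simplex_op_simplex_op[where q = "Suc p"]) (auto simp: skip_def)
        ultimately show ?thesis
          by (simp add: coboundary_Suc A_def del: sum.atMost_Suc)
      qed
      then show ?thesis
        using \<sigma> unfolding Suc
        by (simp add: cup_eq sum.atMost_Suc_shift B_def del: sum.atMost_Suc)
    qed
    have R2: "cup X a (coboundary X b) N \<sigma> =
        (\<Sum>p\<le>n. A p (\<lambda>i. i) * (\<Sum>i\<le>Suc n - p. B (n - p) (\<lambda>j. skip i j + p)))"
    proof -
      have "coboundary X b (Suc n - p) (simplex_op (Suc n - p) (\<lambda>i. i + p) \<sigma>) =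
            (\<Sum>i\<le>Suc n - p. B (n - p) (\<lambda>j. skip i j + p))"
        if "p \<le> n" for p
      proof -
        have [simp]: "Suc n - p = Suc (n - p)" using that by auto
        have "singular_simplex (Suc (n - p)) X (simplex_op (Suc (n - p)) (\<lambda>i. i + p) \<sigma>)"
          by (rule singular_simplex_simplex_op[OF \<sigma>]) (use that Suc in auto)
        moreover have "simplex_op (n - p) (skip i) (simplex_op (Suc (n - p)) (\<lambda>i. i + p) \<sigma>) =
                       simplex_op (n - p) (\<lambda>j. skip i j + p) \<sigma>" if "i \<le> Suc (n - p)" for i
          by (subst simplex_op_simplex_op[where q = "Suc (n - p)"]) (auto simp: skip_def)
        ultimately show ?thesis
          by (simp add: coboundary_Suc B_def del: sum.atMost_Suc)
      qed
      then show ?thesis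
        using \<sigma> unfolding Suc by (simp add: cup_eq A_def)
    qed
    have "(\<Sum>i\<le>Suc n. A p (skip i) * B (n - p) (\<lambda>j. skip i (j + p))) =
          (\<Sum>i\<le>Suc p. A p (skip i)) * B (n - p) (\<lambda>j. j + Suc p) +
          A p (\<lambda>i. i) * (\<Sum>i\<le>Suc n - p. B (n - p) (\<lambda>j. skip i j + p))" if p: "p \<le> n" for p
    proof -
      have split: "(\<Sum>i\<le>Suc n. g i) = (\<Sum>i\<le>p. g i) + (\<Sum>i=Suc p..Suc n. g i)" for g :: "nat \<Rightarrow> bit"
      proof -
        have "{..Suc n} = {..p} \<union> {Suc p..Suc n}" using p by auto
        moreover have "sum g ({..p} \<union> {Suc p..Suc n}) = sum g {..p} + sum g {Suc p..Suc n}"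
          by (rule sum.union_disjoint) auto
        ultimately show ?thesis by (rule ssubst)
      qed
      have s1: "(\<Sum>i\<le>p. A p (skip i) * B (n - p) (\<lambda>j. skip i (j + p))) =
          (\<Sum>i\<le>p. A p (skip i)) * B (n - p) (\<lambda>j. j + Suc p)"
        unfolding sum_distrib_right by (rule sum.cong) (auto simp: skip_def)
      have s2: "(\<Sum>i=Suc p..Suc n. A p (skip i) * B (n - p) (\<lambda>j. skip i (j + p))) =
          (\<Sum>i=1..Suc n - p. A p (\<lambda>i. i) * B (n - p) (\<lambda>j. skip i j + p))"
      proof (rule sum.reindex_bij_witness[of _ "\<lambda>i. i + p" "\<lambda>i. i - p"])
        fix i assume i: "i \<in> {Suc p..Suc n}"
        have "A p (\<lambda>i. i) = A p (skip i)"
          by (rule Acong) (use i in \<open>auto simp: skip_def\<close>)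
        moreover have "(\<lambda>j. skip (i - p) j + p) = (\<lambda>j. skip i (j + p))"
          using i by (auto simp: skip_def fun_eq_iff)
        ultimately show "A p (\<lambda>i. i) * B (n - p) (\<lambda>j. skip (i - p) j + p) =
              A p (skip i) * B (n - p) (\<lambda>j. skip i (j + p))"
          by simp
      qed (use p in auto)
      have "A p (skip (Suc p)) = A p (\<lambda>i. i)"
        by (rule Acong) (auto simp: skip_def)
      then have s3: "(\<Sum>i\<le>Suc p. A p (skip i)) = (\<Sum>i\<le>p. A p (skip i)) + A p (\<lambda>i. i)"
        by simp
      have s4: "(\<Sum>i\<le>Suc n - p. B (n - p) (\<lambda>j. skip i j + p)) =
          B (n - p) (\<lambda>j. j + Suc p) + (\<Sum>i=1..Suc n - p. B (n - p) (\<lambda>j. skip i j + p))"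
      proof -
        have "{..Suc n - p} = insert 0 {1..Suc n - p}" by auto
        then show ?thesis by (simp add: skip_def)
      qed
      \<comment> \<open>The surplus product \<open>v * x\<close> occurs twice on the right: once
        from the last face of the front part, once from the zeroth face of the back part.\<close>
      have cancel: "u * x + v * y = (u + v) * x + v * (x + y)" for u v x y :: bit
        by (cases u; cases v; cases x; cases y) auto
      show ?thesis
        unfolding split s1 s2 s3 s4 sum_distrib_left[symmetric] by (rule cancel)
    qed
    note pointwise = this
    have "(\<Sum>i\<le>Suc n. \<Sum>p\<le>n. A p (skip i) * B (n - p) (\<lambda>j. skip i (j + p))) =
        (\<Sum>p\<le>n. \<Sum>i\<le>Suc n. A p (skip i) * B (n - p) (\<lambda>j. skip i (j + p)))"
      by (rule sum.swap)
    also have "\<dots> = (\<Sum>p\<le>n. (\<Sum>i\<le>Suc p. A p (skip i)) * B (n - p) (\<lambda>j. j + Suc p) +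
          A p (\<lambda>i. i) * (\<Sum>i\<le>Suc n - p. B (n - p) (\<lambda>j. skip i j + p)))"
      by (rule sum.cong[OF refl], rule pointwise) simp
    finally show ?thesis
      unfolding L R1 R2 by (simp only: sum.distrib)
  qed
qed (simp add: coboundary_not_simplex cup_not_simplex)

section \<open>The ring of cocycles and its ideal of coboundaries\<close>

lemma cochainsD: "c \<in> cochains X \<Longrightarrow> c p \<sigma> \<noteq> 0 \<Longrightarrow> singular_simplex p X \<sigma>"
  by (auto simp: cochains_def)

lemma cochains_zero [simp]: "(\<lambda>p \<sigma>. 0) \<in> cochains X"
  by (simp add: cochains_def)

lemma cochains_bounded:
  assumes "c \<in> cochains X"
  obtains N where "\<And>p \<sigma>. N < p \<Longrightarrow> c p \<sigma> = 0"
proof -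
  have "finite {p. \<exists>\<sigma>. c p \<sigma> \<noteq> 0}"
    using assms by (simp add: cochains_def)
  then obtain N where "\<forall>p\<in>{p. \<exists>\<sigma>. c p \<sigma> \<noteq> 0}. p \<le> N"
    using finite_nat_set_iff_bounded_le by blast
  then show thesis
    using that by (metis (mono_tags, lifting) leD mem_Collect_eq)
qed

lemma cochainsI:
  assumes "\<And>p \<sigma>. c p \<sigma> \<noteq> 0 \<Longrightarrow> singular_simplex p X \<sigma>" "\<And>p \<sigma>. N < p \<Longrightarrow> c p \<sigma> = 0"
  shows "c \<in> cochains X"
proof -
  have "{p. \<exists>\<sigma>. c p \<sigma> \<noteq> 0} \<subseteq> {..N}"
    using assms(2) by (auto simp flip: not_less)
  then have "finite {p. \<exists>\<sigma>. c p \<sigma> \<noteq> 0}"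
    by (rule finite_subset) simp
  then show ?thesis
    using assms(1) by (auto simp: cochains_def)
qed

lemma cochains_add:
  assumes "a \<in> cochains X" "b \<in> cochains X"
  shows "(\<lambda>p \<sigma>. a p \<sigma> + b p \<sigma>) \<in> cochains X"
proof -
  obtain M N where M: "\<And>p \<sigma>. M < p \<Longrightarrow> a p \<sigma> = 0" and N: "\<And>p \<sigma>. N < p \<Longrightarrow> b p \<sigma> = 0"
    using assms cochains_bounded by metis
  show ?thesis
  proof (rule cochainsI)
    show "singular_simplex p X \<sigma>" if "a p \<sigma> + b p \<sigma> \<noteq> 0" for p \<sigma>
      using that assms cochainsD by (metis add_0)
    show "a p \<sigma> + b p \<sigma> = 0" if "max M N < p" for p \<sigma>
      using that M N by auto
  qed
qed

lemma cochains_cup: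
  assumes "a \<in> cochains X" "b \<in> cochains X"
  shows "cup X a b \<in> cochains X"
proof -
  obtain M N where M: "\<And>p \<sigma>. M < p \<Longrightarrow> a p \<sigma> = 0" and N: "\<And>p \<sigma>. N < p \<Longrightarrow> b p \<sigma> = 0"
    using assms cochains_bounded by metis
  show ?thesis
  proof (rule cochainsI)
    show "singular_simplex p X \<sigma>" if "cup X a b p \<sigma> \<noteq> 0" for p \<sigma>
      using that cup_not_simplex by metis
    fix n and \<sigma> :: "(nat \<Rightarrow> real) \<Rightarrow> 'a" assume n: "M + N < n"
    have "a p \<tau> = 0 \<or> b (n - p) \<tau>' = 0" if "p \<le> n" for p \<tau> \<tau>'
      using n M[of p] N[of "n - p"] that by (cases "M < p") auto
    then show "cup X a b n \<sigma> = 0"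
      unfolding cup_def by (auto intro!: sum.neutral)
  qed
qed

lemma cochains_coboundary:
  assumes "a \<in> cochains X"
  shows "coboundary X a \<in> cochains X"
proof -
  obtain M where M: "\<And>p \<sigma>. M < p \<Longrightarrow> a p \<sigma> = 0"
    using assms cochains_bounded by metis
  show ?thesis
  proof (rule cochainsI)
    show "singular_simplex p X \<sigma>" if "coboundary X a p \<sigma> \<noteq> 0" for p \<sigma>
      using that coboundary_not_simplex by metis
    show "coboundary X a n \<sigma> = 0" if "Suc M < n" for n \<sigma>
      using M that by (auto simp: coboundary_def intro!: sum.neutral)
  qed
qed

lemma cochains_unit: "unit_cochain X \<in> cochains X"
  by (rule cochainsI[where N = 0]) (auto simp: unit_cochain_def split: if_splits)

lemma coboundary_unit: "coboundary X (unit_cochain X) = (\<lambda>p \<sigma>. 0)"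
proof (rule cochain_eqI)
  fix p and \<sigma> :: "(nat \<Rightarrow> real) \<Rightarrow> 'a"
  assume \<sigma>: "singular_simplex p X \<sigma>"
  show "coboundary X (unit_cochain X) p \<sigma> = 0"
  proof (cases p)
    case (Suc m)
    then show ?thesis
      using \<sigma> simplex_op_skip_singular[of 0 X \<sigma> 0] simplex_op_skip_singular[of 0 X \<sigma> 1]
      by (cases m) (auto simp: coboundary_Suc unit_cochain_def)
  qed simp
qed (simp add: coboundary_not_simplex)

lemma cup_unit_left:
  assumes "a \<in> cochains X"
  shows "cup X (unit_cochain X) a = a"
proof (rule cochain_eqI)
  fix n and \<sigma> :: "(nat \<Rightarrow> real) \<Rightarrow> 'a"
  assume \<sigma>: "singular_simplex n X \<sigma>"
  have "singular_simplex 0 X (simplex_op 0 (\<lambda>i. i) \<sigma>)"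
    by (rule singular_simplex_simplex_op[OF \<sigma>]) auto
  moreover have "cup X (unit_cochain X) a n \<sigma> =
      (\<Sum>p\<in>{0}. unit_cochain X p (simplex_op p (\<lambda>i. i) \<sigma>) *
                a (n - p) (simplex_op (n - p) (\<lambda>i. i + p) \<sigma>))"
    unfolding cup_eq[OF \<sigma>] by (rule sum.mono_neutral_right) (auto simp: unit_cochain_def)
  ultimately show "cup X (unit_cochain X) a n \<sigma> = a n \<sigma>"
    by (simp add: unit_cochain_def simplex_op_id[OF \<sigma>])
qed (metis assms cochainsD cup_not_simplex)

lemma cup_unit_right:
  assumes "a \<in> cochains X"
  shows "cup X a (unit_cochain X) = a"
proof (rule cochain_eqI)
  fix n and \<sigma> :: "(nat \<Rightarrow> real) \<Rightarrow> 'a"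
  assume \<sigma>: "singular_simplex n X \<sigma>"
  have "singular_simplex 0 X (simplex_op 0 (\<lambda>i. i + n) \<sigma>)"
    by (rule singular_simplex_simplex_op[OF \<sigma>]) auto
  moreover have "cup X a (unit_cochain X) n \<sigma> =
      (\<Sum>p\<in>{n}. a p (simplex_op p (\<lambda>i. i) \<sigma>) *
                unit_cochain X (n - p) (simplex_op (n - p) (\<lambda>i. i + p) \<sigma>))"
    unfolding cup_eq[OF \<sigma>] by (rule sum.mono_neutral_right) (auto simp: unit_cochain_def)
  ultimately show "cup X a (unit_cochain X) n \<sigma> = a n \<sigma>"
    by (simp add: unit_cochain_def simplex_op_id[OF \<sigma>])
qed (metis assms cochainsD cup_not_simplex)

lemma ring_cocycle_ring: "ring (cocycle_ring X)"
proof (intro ringI abelian_groupI monoidI)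
  fix x assume x: "x \<in> carrier (cocycle_ring X)"
  then show "\<exists>y\<in>carrier (cocycle_ring X). y \<oplus>\<^bsub>cocycle_ring X\<^esub> x = \<zero>\<^bsub>cocycle_ring X\<^esub>"
    by (intro bexI[of _ x]) (simp_all add: cocycle_ring_def)
qed (auto simp: cocycle_ring_def cochains_add coboundary_add coboundary_cup cochains_cup
       cup_zero cup_assoc cup_unit_left cup_unit_right cochains_unit coboundary_unit
       cup_add_left cup_add_right coboundary_zero ac_simps)

lemma coboundary_in_cocycle_ring:
  "c \<in> cochains X \<Longrightarrow> coboundary X c \<in> carrier (cocycle_ring X)"
  by (simp add: cocycle_ring_def cochains_coboundary coboundary_coboundary)

text \<open>By the Leibniz rule the product of a cocycle \<open>x\<close> with
  \<open>coboundary X c\<close> is the coboundary of the product of \<open>x\<close> with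
  \<open>c\<close>, on either side.\<close>

lemma ideal_coboundaries: "ideal (coboundary X ` cochains X) (cocycle_ring X)"
proof -
  interpret ring "cocycle_ring X" by (rule ring_cocycle_ring)
  have neg: "a_inv (cocycle_ring X) x = x" if "x \<in> carrier (cocycle_ring X)" for x
    by (rule minus_equality) (use that in \<open>auto simp: cocycle_ring_def\<close>)
  show ?thesis
  proof (rule idealI[OF ring_cocycle_ring])
    show "subgroup (coboundary X ` cochains X) (add_monoid (cocycle_ring X))"
    proof (rule add.subgroupI)
      show "coboundary X ` cochains X \<subseteq> carrier (cocycle_ring X)"
        using coboundary_in_cocycle_ring by blast
      show "coboundary X ` cochains X \<noteq> {}"
        using cochains_zero by blast
      show "\<ominus>\<^bsub>cocycle_ring X\<^esub> a \<in> coboundary X ` cochains X" if "a \<in> coboundary X ` cochains X" for a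
        using that neg coboundary_in_cocycle_ring by (metis imageE)
      show "a \<oplus>\<^bsub>cocycle_ring X\<^esub> b \<in> coboundary X ` cochains X"
        if ab: "a \<in> coboundary X ` cochains X" "b \<in> coboundary X ` cochains X" for a b
      proof -
        obtain c d where "a = coboundary X c" "b = coboundary X d" "c \<in> cochains X" "d \<in> cochains X"
          using ab by blast
        then have "a \<oplus>\<^bsub>cocycle_ring X\<^esub> b = coboundary X (\<lambda>p \<sigma>. c p \<sigma> + d p \<sigma>)"
          "(\<lambda>p \<sigma>. c p \<sigma> + d p \<sigma>) \<in> cochains X"
          by (simp_all add: coboundary_add cocycle_ring_def cochains_add)
        then show ?thesis by blast
      qed
    qed
    fix a x assume "a \<in> coboundary X ` cochains X" and x: "x \<in> carrier (cocycle_ring X)"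
    then obtain c where c: "a = coboundary X c" "c \<in> cochains X" by blast
    have "cup X x a = coboundary X (cup X x c)" "cup X a x = coboundary X (cup X c x)"
      using x c by (simp_all add: coboundary_cup cocycle_ring_def cup_zero)
    moreover have "cup X x c \<in> cochains X" "cup X c x \<in> cochains X"
      using x c by (simp_all add: cochains_cup cocycle_ring_def)
    ultimately show "x \<otimes>\<^bsub>cocycle_ring X\<^esub> a \<in> coboundary X ` cochains X"
      "a \<otimes>\<^bsub>cocycle_ring X\<^esub> x \<in> coboundary X ` cochains X"
      by (simp_all add: cocycle_ring_def)
  qed
qed

section \<open>Chains modulo 2\<close>

text \<open>Linear extension from a basis: every nonzero bit is 1, so no scalars appear and the
  target is only a commutative monoid. Additivity then comes from
  \<open>\<phi> x + \<phi> x = 0\<close>.\<close>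

definition lin_ext :: "('s \<Rightarrow> 'm::comm_monoid_add) \<Rightarrow> ('s \<Rightarrow>\<^sub>0 bit) \<Rightarrow> 'm" where
  "lin_ext \<phi> v = (\<Sum>x\<in>Poly_Mapping.keys v. \<phi> x)"

lemma lin_ext_add:
  assumes "\<And>x. \<phi> x + \<phi> x = 0"
  shows "lin_ext \<phi> (u + v) = lin_ext \<phi> u + lin_ext \<phi> v"
proof -
  have superset: "lin_ext \<phi> w = (\<Sum>x\<in>S. if Poly_Mapping.lookup w x = 1 then \<phi> x else 0)"
    if "finite S" "Poly_Mapping.keys w \<subseteq> S" for w S
  proof -
    have "lin_ext \<phi> w = (\<Sum>x\<in>Poly_Mapping.keys w. if Poly_Mapping.lookup w x = 1 then \<phi> x else 0)"
      unfolding lin_ext_def by (rule sum.cong) (auto simp: in_keys_iff)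
    also have "\<dots> = (\<Sum>x\<in>S. if Poly_Mapping.lookup w x = 1 then \<phi> x else 0)"
      using that by (intro sum.mono_neutral_left) (auto simp: in_keys_iff)
    finally show ?thesis .
  qed
  let ?S = "Poly_Mapping.keys u \<union> Poly_Mapping.keys v"
  have "(if Poly_Mapping.lookup (u + v) x = 1 then \<phi> x else 0) =
    (if Poly_Mapping.lookup u x = 1 then \<phi> x else 0) + (if Poly_Mapping.lookup v x = 1 then \<phi> x else 0)" for x
    by (cases "Poly_Mapping.lookup u x"; cases "Poly_Mapping.lookup v x") (auto simp: lookup_add assms)
  moreover have "Poly_Mapping.keys (u + v) \<subseteq> ?S" by (rule keys_add)
  ultimately show ?thesis
    by (simp add: superset[of ?S] sum.distrib)
qed

lemma lin_ext_zero [simp]: "lin_ext \<phi> 0 = 0"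
  by (simp add: lin_ext_def)

lemma lin_ext_single [simp]: "lin_ext \<phi> (Poly_Mapping.single x 1) = \<phi> x"
  by (simp add: lin_ext_def)

lemma bit_poly_mapping_eq_sum: "(f :: 's \<Rightarrow>\<^sub>0 bit) = lin_ext (\<lambda>t. Poly_Mapping.single t 1) f"
proof (rule poly_mapping_eqI)
  fix x
  have "Poly_Mapping.lookup (lin_ext (\<lambda>t. Poly_Mapping.single t (1::bit)) f) x =
      (\<Sum>t\<in>Poly_Mapping.keys f. if t = x then 1 else 0)"
    by (simp add: lin_ext_def lookup_sum lookup_single when_def)
  also have "\<dots> = Poly_Mapping.lookup f x"
    by (subst sum.delta) (auto simp: in_keys_iff)
  finally show "Poly_Mapping.lookup f x = Poly_Mapping.lookup (lin_ext (\<lambda>t. Poly_Mapping.single t 1) f) x" ..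
qed

lemma bit_poly_mapping_induct [consumes 1, case_names zero single add]:
  assumes "Poly_Mapping.keys f \<subseteq> F" "P 0" "\<And>t. t \<in> F \<Longrightarrow> P (Poly_Mapping.single t (1::bit))"
    "\<And>f g. P f \<Longrightarrow> P g \<Longrightarrow> P (f + g)"
  shows "P f"
proof -
  have "P (\<Sum>t\<in>A. Poly_Mapping.single t 1)" if "finite A" "A \<subseteq> F" for A
    using that by (induction A rule: finite_induct) (auto intro: assms)
  then have "P (lin_ext (\<lambda>t. Poly_Mapping.single t 1) f)"
    using assms(1) by (simp add: lin_ext_def)
  then show ?thesis
    using bit_poly_mapping_eq_sum[of f] by simp
qed

lemma bit_poly_mapping_add_same [simp]: "(v :: 's \<Rightarrow>\<^sub>0 bit) + v = 0"
  by (rule poly_mapping_eqI) (simp add: lookup_add)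

lemma bit_poly_mapping_diff: "(u :: 's \<Rightarrow>\<^sub>0 bit) - v = u + v"
  by (rule poly_mapping_eqI) (simp add: lookup_add lookup_minus)

lemma lin_ext_add_bit: "lin_ext (\<phi> :: 's \<Rightarrow> bit) (u + v) = lin_ext \<phi> u + lin_ext \<phi> v"
  by (rule lin_ext_add) simp

lemma lin_ext_sum_bit: "lin_ext (\<phi> :: 's \<Rightarrow> bit) (sum f A) = (\<Sum>x\<in>A. lin_ext \<phi> (f x))"
  by (induction A rule: infinite_finite_induct) (simp_all add: lin_ext_add_bit)

definition mod2 :: "('s \<Rightarrow>\<^sub>0 int) \<Rightarrow> ('s \<Rightarrow>\<^sub>0 bit)" where
  "mod2 = Poly_Mapping.map of_int"

text \<open>The Kronecker pairing of a cochain modulo 2 with an integral chain.\<close>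

definition ceval :: "('s \<Rightarrow> bit) \<Rightarrow> ('s \<Rightarrow>\<^sub>0 int) \<Rightarrow> bit" where
  "ceval \<phi> c = lin_ext \<phi> (mod2 c)"

lemma lookup_mod2: "Poly_Mapping.lookup (mod2 c) x = of_int (Poly_Mapping.lookup c x)"
  by (simp add: mod2_def map.rep_eq when_def)

lemma mod2_add: "mod2 (a + b) = mod2 a + mod2 b"
  by (rule poly_mapping_eqI) (simp add: lookup_mod2 lookup_add)

lemma mod2_diff: "mod2 (a - b) = mod2 a - mod2 b"
  by (rule poly_mapping_eqI) (simp add: lookup_mod2 lookup_minus)

lemma mod2_zero [simp]: "mod2 0 = 0"
  by (rule poly_mapping_eqI) (simp add: lookup_mod2)

lemma mod2_cmul: "mod2 (frag_cmul k c) = (if even k then 0 else mod2 c)"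
  by (rule poly_mapping_eqI) (auto simp: lookup_mod2 elim: oddE evenE)

lemma mod2_of: "mod2 (frag_of x) = Poly_Mapping.single x 1"
  by (rule poly_mapping_eqI) (simp add: lookup_mod2 lookup_single when_def)

lemma mod2_sum: "mod2 (sum f I) = (\<Sum>i\<in>I. mod2 (f i))"
  by (induction I rule: infinite_finite_induct) (auto simp: mod2_add)

lemma ceval_zero [simp]: "ceval \<phi> 0 = 0"
  by (simp add: ceval_def)

lemma ceval_add: "ceval \<phi> (a + b) = ceval \<phi> a + ceval \<phi> b"
  by (simp add: ceval_def mod2_add lin_ext_add_bit)

lemma ceval_diff: "ceval \<phi> (a - b) = ceval \<phi> a + ceval \<phi> b"
  by (simp add: ceval_def mod2_diff lin_ext_add_bit bit_poly_mapping_diff)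

lemma ceval_cmul: "ceval \<phi> (frag_cmul k c) = (if even k then 0 else ceval \<phi> c)"
  by (simp add: ceval_def mod2_cmul)

lemma ceval_of [simp]: "ceval \<phi> (frag_of x) = \<phi> x"
  by (simp add: ceval_def mod2_of)

lemma ceval_fun_add: "ceval (\<lambda>x. \<phi> x + \<psi> x) c = ceval \<phi> c + ceval \<psi> c"
  by (simp add: ceval_def lin_ext_def sum.distrib)

lemma ceval_eq_0:
  assumes "\<And>x. x \<in> Poly_Mapping.keys c \<Longrightarrow> \<phi> x = 0"
  shows "ceval \<phi> c = 0"
proof -
  have "\<phi> x = 0" if "x \<in> Poly_Mapping.keys (mod2 c)" for x
    by (rule assms) (use that in \<open>auto simp: in_keys_iff lookup_mod2\<close>)
  then show ?thesis
    by (simp add: ceval_def lin_ext_def)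
qed

text \<open>The index is the dimension of the target: \<open>bdry2 p\<close> takes chains of
  dimension \<open>p + 1\<close> to chains of dimension \<open>p\<close>.\<close>

definition bdry2 :: "nat \<Rightarrow> (((nat \<Rightarrow> real) \<Rightarrow> 'a) \<Rightarrow>\<^sub>0 bit) \<Rightarrow> ((nat \<Rightarrow> real) \<Rightarrow> 'a) \<Rightarrow>\<^sub>0 bit" where
  "bdry2 p = lin_ext (\<lambda>\<sigma>. \<Sum>i\<le>Suc p. Poly_Mapping.single (singular_face (Suc p) i \<sigma>) 1)"

lemma bdry2_add: "bdry2 p (u + v) = bdry2 p u + bdry2 p v"
  unfolding bdry2_def by (rule lin_ext_add) (rule bit_poly_mapping_add_same)

lemma bdry2_zero [simp]: "bdry2 p 0 = 0"
  by (simp add: bdry2_def)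

lemma bdry2_single: "bdry2 p (Poly_Mapping.single \<sigma> 1) =
    (\<Sum>i\<le>Suc p. Poly_Mapping.single (singular_face (Suc p) i \<sigma>) 1)"
  by (simp add: bdry2_def)

lemma mod2_chain_boundary: "mod2 (chain_boundary (Suc p) c) = bdry2 p (mod2 c)"
proof -
  have "Poly_Mapping.keys c \<subseteq> UNIV" by simp
  then show ?thesis
  proof (induction c rule: frag_induction)
    case zero
    then show ?case by simp
  next
    case (one x)
    then show ?case
      by (simp add: chain_boundary_of mod2_sum mod2_cmul mod2_of bdry2_single del: sum.atMost_Suc)
  next
    case (diff a b)
    then show ?case
      by (simp add: chain_boundary_diff mod2_diff bit_poly_mapping_diff bdry2_add)
  qed
qed

lemma lin_ext_bdry2:
  "lin_ext (\<psi> :: _ \<Rightarrow> bit) (bdry2 p v) = lin_ext (\<lambda>\<sigma>. \<Sum>i\<le>Suc p. \<psi> (singular_face (Suc p) i \<sigma>)) v"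
  unfolding bdry2_def lin_ext_def[of _ v] by (simp only: lin_ext_sum_bit lin_ext_single)

lemma ceval_boundary_eq_0:
  assumes "coboundary X c (Suc q) = (\<lambda>\<sigma>. 0)" "singular_chain (Suc q) X d"
  shows "ceval (c q) (chain_boundary (Suc q) d) = 0"
proof -
  have "ceval (c q) (chain_boundary (Suc q) d) =
        ceval (\<lambda>\<sigma>. \<Sum>i\<le>Suc q. c q (singular_face (Suc q) i \<sigma>)) d"
    by (simp only: ceval_def mod2_chain_boundary lin_ext_bdry2)
  also have "\<dots> = 0"
  proof (rule ceval_eq_0)
    fix \<sigma> assume "\<sigma> \<in> Poly_Mapping.keys d"
    then have "singular_simplex (Suc q) X \<sigma>"
      using assms(2) by (auto simp: singular_chain_def)
    then show "(\<Sum>i\<le>Suc q. c q (singular_face (Suc q) i \<sigma>)) = 0"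
      using fun_cong[OF assms(1), of \<sigma>] by (simp add: coboundary_def)
  qed
  finally show ?thesis .
qed

text \<open>Scalar action of the field with two elements, which makes the theory of vector spaces,
  and with it the existence of linear sections, available.\<close>

definition bscale :: "bit \<Rightarrow> ('s \<Rightarrow>\<^sub>0 bit) \<Rightarrow> 's \<Rightarrow>\<^sub>0 bit" where
  "bscale b v = (if b = 1 then v else 0)"

lemma vector_space_bscale: "vector_space bscale"
proof
  show "bscale a (x + y) = bscale a x + bscale a y" for a and x y :: "'s \<Rightarrow>\<^sub>0 bit"
    by (simp add: bscale_def)
  show "bscale (a + b) x = bscale a x + bscale b x" for a b and x :: "'s \<Rightarrow>\<^sub>0 bit"
    by (cases a; cases b) (auto simp: bscale_def)
  show "bscale a (bscale b x) = bscale (a * b) x" for a b and x :: "'s \<Rightarrow>\<^sub>0 bit"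
    by (cases a; cases b) (auto simp: bscale_def)
qed (simp add: bscale_def)

text \<open>
  Cycles modulo 2 are represented by integral chains with even boundary, so that the results of
  \<open>HOL-Homology\<close> on integral chains apply.
\<close>

lemma functional_factors_through_boundary:
  fixes X :: "'a topology"
  assumes "\<And>c. singular_chain (Suc p) X c \<Longrightarrow> mod2 (chain_boundary (Suc p) c) = 0 \<Longrightarrow> ceval \<phi> c = 0"
  obtains \<psi> where "\<And>\<sigma>. singular_simplex (Suc p) X \<sigma> \<Longrightarrow>
                     \<phi> \<sigma> = (\<Sum>i\<le>Suc p. \<psi> (singular_face (Suc p) i \<sigma>))"
proof -
  interpret vsp: vector_space_pair
    "bscale :: bit \<Rightarrow> (((nat \<Rightarrow> real) \<Rightarrow> 'a) \<Rightarrow>\<^sub>0 bit) \<Rightarrow> _"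
    "bscale :: bit \<Rightarrow> (((nat \<Rightarrow> real) \<Rightarrow> 'a) \<Rightarrow>\<^sub>0 bit) \<Rightarrow> _"
    by (simp add: vector_space_pair_def vector_space_bscale)
  define V where "V = {v :: ((nat \<Rightarrow> real) \<Rightarrow> 'a) \<Rightarrow>\<^sub>0 bit. Poly_Mapping.keys v \<subseteq> singular_simplex_set (Suc p) X}"
  have lin: "Vector_Spaces.linear bscale bscale (bdry2 p :: (((nat \<Rightarrow> real) \<Rightarrow> 'a) \<Rightarrow>\<^sub>0 bit) \<Rightarrow> _)"
    by (simp add: Vector_Spaces.linear_iff vector_space_bscale bdry2_add bscale_def)
  have "vsp.vs1.subspace V"
    unfolding V_def by (rule vsp.vs1.subspaceI) (auto simp: bscale_def dest!: subsetD[OF keys_add])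
  \<comment> \<open>A linear section of the boundary on its image, with values in chains of
    \<open>X\<close>. For a simplex \<open>s\<close> the chain \<open>g (bdry2 p s) + s\<close> is a
    cycle, so \<open>\<phi>\<close> takes the same value on \<open>s\<close> and on
    \<open>g (bdry2 p s)\<close>; hence \<open>\<psi>\<close> can be \<open>\<phi>\<close> after
    \<open>g\<close>.\<close>
  then obtain g where g: "range g \<subseteq> V" "Vector_Spaces.linear bscale bscale g" "\<And>v. v \<in> V \<Longrightarrow> bdry2 p (g (bdry2 p v)) = bdry2 p v"
    using vsp.linear_exists_right_inverse_on[OF lin] by blast
  have gsum: "g (sum f I) = (\<Sum>i\<in>I. g (f i))" for f :: "nat \<Rightarrow> _" and I
    by (rule module_hom.sum[OF module_hom_iff_linear[THEN iffD2, OF g(2)]])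
  have zero: "lin_ext \<phi> u = 0" if u: "u \<in> V" "bdry2 p u = 0" for u
  proof -
    define c :: "'a chain" where "c = Poly_Mapping.map (\<lambda>b. of_bool (b = 1)) u"
    have look: "Poly_Mapping.lookup c x = of_bool (Poly_Mapping.lookup u x = 1)" for x
      by (simp add: c_def map.rep_eq when_def)
    have "mod2 c = u"
      by (rule poly_mapping_eqI) (auto simp: lookup_mod2 look)
    moreover have "singular_chain (Suc p) X c"
      using u(1) by (auto simp: singular_chain_def V_def in_keys_iff look subset_iff)
    ultimately show ?thesis
      using assms[of c] u(2) by (simp add: ceval_def mod2_chain_boundary)
  qed
  show thesis
  proof (rule that)
    fix \<sigma> assume \<sigma>: "singular_simplex (Suc p) X \<sigma>"
    let ?s = "Poly_Mapping.single \<sigma> (1::bit)"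
    have s: "?s \<in> V" using \<sigma> by (simp add: V_def)
    have "g (bdry2 p ?s) + ?s \<in> V"
      using g(1) s unfolding V_def by (auto dest!: subsetD[OF keys_add])
    moreover have "bdry2 p (g (bdry2 p ?s) + ?s) = 0"
      using g(3)[OF s] by (simp add: bdry2_add)
    ultimately have "lin_ext \<phi> (g (bdry2 p ?s)) + \<phi> \<sigma> = 0"
      using zero by (metis lin_ext_add_bit lin_ext_single)
    then have "\<phi> \<sigma> = lin_ext \<phi> (g (bdry2 p ?s))"
      by (cases "\<phi> \<sigma>"; cases "lin_ext \<phi> (g (bdry2 p ?s))") auto
    also have "\<dots> = (\<Sum>i\<le>Suc p. lin_ext \<phi> (g (Poly_Mapping.single (singular_face (Suc p) i \<sigma>) 1)))"
      by (simp only: bdry2_single gsum lin_ext_sum_bit)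
    finally show "\<phi> \<sigma> = (\<Sum>i\<le>Suc p. lin_ext \<phi> (g (Poly_Mapping.single (singular_face (Suc p) i \<sigma>) 1)))" .
  qed
qed

section \<open>Homogeneous cochains and criteria for being a coboundary\<close>

definition homog :: "'a topology \<Rightarrow> nat \<Rightarrow> 'a cochain set" where
  "homog X q = {c. (\<forall>p \<sigma>. c p \<sigma> \<noteq> 0 \<longrightarrow> p = q \<and> singular_simplex p X \<sigma>)}"

lemma homog_cochains: "c \<in> homog X q \<Longrightarrow> c \<in> cochains X"
  by (rule cochainsI[where N = q]) (auto simp: homog_def simp del: bit_not_zero_iff)

lemma homog_eq_0: "c \<in> homog X q \<Longrightarrow> p \<noteq> q \<Longrightarrow> c p \<sigma> = 0"
  unfolding homog_def by blast

text \<open>Over a field, cohomology is dual to homology: a cochain that kills all cycles modulo 2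
  factors through the boundary, and the factor, cut down to singular simplices of \<open>X\<close>,
  is the primitive.\<close>

lemma homog_cobounds:
  assumes "c \<in> homog X (Suc p)"
    and "\<And>d. singular_chain (Suc p) X d \<Longrightarrow> mod2 (chain_boundary (Suc p) d) = 0 \<Longrightarrow> ceval (c (Suc p)) d = 0"
  obtains b where "b \<in> homog X p" "c = coboundary X b"
proof -
  obtain \<psi> where \<psi>: "\<And>\<sigma>. singular_simplex (Suc p) X \<sigma> \<Longrightarrow>
                     c (Suc p) \<sigma> = (\<Sum>i\<le>Suc p. \<psi> (singular_face (Suc p) i \<sigma>))"
    using functional_factors_through_boundary assms(2) by metis
  define b :: "'a cochain" where "b = (\<lambda>q \<tau>. if q = p \<and> singular_simplex p X \<tau> then \<psi> \<tau> else 0)"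
  have b: "b \<in> homog X p"
    by (auto simp: homog_def b_def split: if_splits)
  have "c = coboundary X b"
  proof (rule cochain_eqI)
    fix q and \<sigma> :: "(nat \<Rightarrow> real) \<Rightarrow> 'a" assume \<sigma>: "singular_simplex q X \<sigma>"
    show "c q \<sigma> = coboundary X b q \<sigma>"
    proof (cases "q = Suc p")
      case True
      have "singular_simplex p X (singular_face (Suc p) i \<sigma>)" if "i \<le> Suc p" for i
        using singular_simplex_singular_face[of "Suc p" X \<sigma> i] \<sigma> that True by simp
      then show ?thesis
        using \<sigma> \<psi> True by (simp add: coboundary_def b_def del: sum.atMost_Suc)
    next
      case False
      then show ?thesis
        using homog_eq_0[OF assms(1)] by (auto simp: coboundary_def b_def intro!: sum.neutral)
    qed
  next
    fix q and \<sigma> :: "(nat \<Rightarrow> real) \<Rightarrow> 'a" assume "\<not> singular_simplex q X \<sigma>"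
    then show "c q \<sigma> = coboundary X b q \<sigma>"
      using cochainsD[OF homog_cochains[OF assms(1)]] by (metis coboundary_not_simplex)
  qed
  with b show thesis by (rule that)
qed

lemma mod2_eq_0_obtain:
  assumes "mod2 c = 0"
  obtains e where "c = e + e" "Poly_Mapping.keys e \<subseteq> Poly_Mapping.keys c"
proof -
  have "(of_int (Poly_Mapping.lookup c x) :: bit) = 0" for x
    using arg_cong[OF assms, of "\<lambda>v. Poly_Mapping.lookup v x"] by (simp add: lookup_mod2)
  then have ev: "even (Poly_Mapping.lookup c x)" for x
    by (metis even_of_int_iff even_zero)
  define e where "e = Poly_Mapping.map (\<lambda>k. k div 2) c"
  have look: "Poly_Mapping.lookup e x = Poly_Mapping.lookup c x div 2" for x
    by (simp add: e_def map.rep_eq when_def)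
  show thesis
  proof (rule that)
    show "c = e + e"
      using ev by (intro poly_mapping_eqI) (auto simp: lookup_add look elim: evenE)
    show "Poly_Mapping.keys e \<subseteq> Poly_Mapping.keys c"
      by (auto simp: in_keys_iff look)
  qed
qed

text \<open>Iterated subdivision makes every simplex of a cycle small for the cover, where the
  cocycle vanishes, and it is chain homotopic to the identity, so the cocycle already vanished on
  the original cycle.\<close>

lemma small_cocycle_cobounds:
  fixes X :: "'a topology"
  assumes c: "c \<in> homog X (Suc p)" "coboundary X c = (\<lambda>q \<sigma>. 0)"
    and cover: "\<And>U. U \<in> \<C> \<Longrightarrow> openin X U" "topspace X \<subseteq> \<Union>\<C>"
    and small: "\<And>U \<sigma>. U \<in> \<C> \<Longrightarrow> \<sigma> \<in> standard_simplex (Suc p) \<rightarrow> U \<Longrightarrow> c (Suc p) \<sigma> = 0"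
  obtains b where "b \<in> homog X p" "c = coboundary X b"
proof (rule homog_cobounds[OF c(1)])
  fix d assume d: "singular_chain (Suc p) X d" "mod2 (chain_boundary (Suc p) d) = 0"
  obtain m where m: "\<And>f. f \<in> Poly_Mapping.keys ((singular_subdivision (Suc p) ^^ m) d)
              \<Longrightarrow> \<exists>V\<in>\<C>. f \<in> standard_simplex (Suc p) \<rightarrow> V"
    using sufficient_iterated_singular_subdivision_exists[OF cover d(1)] order_refl by metis
  obtain h where h0: "\<And>p. h p 0 = (0 :: 'a chain)"
    and hdiff: "\<And>p (c1 :: 'a chain) c2. h p (c1 - c2) = h p c1 - h p c2"
    and hchain: "\<And>p X (c :: 'a chain). singular_chain p X c \<Longrightarrow> singular_chain (Suc p) X (h p c)"
    and hbdry: "\<And>p X (c :: 'a chain). singular_chain p X c \<Longrightarrow>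
           chain_boundary (Suc p) (h p c) + h (p - Suc 0) (chain_boundary p c) =
           (singular_subdivision p ^^ m) c - c"
    by (rule chain_homotopic_iterated_singular_subdivision[of m]) (rule that, assumption+)
  obtain e where e: "chain_boundary (Suc p) d = e + e"
    using mod2_eq_0_obtain[OF d(2)] by blast
  \<comment> \<open>The cycle is closed only modulo 2, so the homotopy formula keeps the term
    \<open>h p (e + e)\<close>; it is even and therefore invisible to \<open>ceval\<close>.
    Additivity of \<open>h\<close> is derived from its compatibility with differences.\<close>
  have "h p (e + e) = h p e + h p e"
    using hdiff[of p e "- e"] hdiff[of p 0 e] h0 by simp
  then have "(singular_subdivision (Suc p) ^^ m) d = d + chain_boundary (Suc (Suc p)) (h (Suc p) d) + (h p e + h p e)"
    using hbdry[OF d(1)] e by (simp add: algebra_simps)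
  moreover have "ceval (c (Suc p)) ((singular_subdivision (Suc p) ^^ m) d) = 0"
    using m small by (intro ceval_eq_0) blast
  moreover have "ceval (c (Suc p)) (chain_boundary (Suc (Suc p)) (h (Suc p) d)) = 0"
    by (rule ceval_boundary_eq_0[OF _ hchain[OF d(1)]]) (simp add: c(2))
  ultimately show "ceval (c (Suc p)) d = 0"
    by (simp add: ceval_add)
qed (rule that)

section \<open>Cohomology of spheres\<close>

lemma homology_group_mult:
  assumes "singular_relcycle q X {} a" "singular_relcycle q X {} b"
  shows "homologous_rel_set q X {} a \<otimes>\<^bsub>homology_group (int q) X\<^esub> homologous_rel_set q X {} b =
         homologous_rel_set q X {} (a + b)"
proof -
  have "homology_group (int q) X = relcycle_group q X {} Mod singular_relboundary_set q X {}"
    by (simp add: relative_homology_group_def)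
  moreover have "a \<in> carrier (relcycle_group q X {})" "b \<in> carrier (relcycle_group q X {})"
    using assms by simp_all
  ultimately show ?thesis
    using normal.rcos_sum[OF normal_subgroup_singular_relboundary_relcycle, of a q X "{}" b]
    by (simp only: FactGroup_def right_coset_singular_relboundary mult_relcycle_group monoid.simps)
qed

lemma homologous_rel_set_in_homology_group:
  "singular_relcycle q X {} a \<Longrightarrow> homologous_rel_set q X {} a \<in> carrier (homology_group (int q) X)"
  by (simp add: carrier_relative_homology_group)

section \<open>Absence of 2-torsion and integral lifts of cycles\<close>

definition no_2_torsion :: "('a, 'm) monoid_scheme \<Rightarrow> bool" where
  "no_2_torsion G \<longleftrightarrow> (\<forall>x\<in>carrier G. x \<otimes>\<^bsub>G\<^esub> x = \<one>\<^bsub>G\<^esub> \<longrightarrow> x = \<one>\<^bsub>G\<^esub>)"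

lemma no_2_torsion_iso:
  assumes "G \<cong> K" "group G" "group K" "no_2_torsion K"
  shows "no_2_torsion G"
proof -
  obtain h where h: "h \<in> hom G K" "bij_betw h (carrier G) (carrier K)"
    using assms(1) by (auto simp: is_iso_def iso_def)
  interpret group_hom G K h
    using assms(2,3) h(1) by (simp add: group_hom_def group_hom_axioms_def)
  show ?thesis
    unfolding no_2_torsion_def
  proof (intro ballI impI)
    fix x assume x: "x \<in> carrier G" "x \<otimes>\<^bsub>G\<^esub> x = \<one>\<^bsub>G\<^esub>"
    then have "h x \<otimes>\<^bsub>K\<^esub> h x = \<one>\<^bsub>K\<^esub>"
      by (metis hom_mult hom_one)
    moreover have "h x \<in> carrier K"
      using x(1) by (rule hom_closed)
    ultimately have "h x = \<one>\<^bsub>K\<^esub>"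
      using assms(4) unfolding no_2_torsion_def by blast
    then have "h x = h \<one>\<^bsub>G\<^esub>"
      by (simp only: hom_one)
    then show "x = \<one>\<^bsub>G\<^esub>"
      using inj_onD[OF bij_betw_imp_inj_on[OF h(2)]] x(1) by simp
  qed
qed

lemma poly_mapping_int_add_same_eq_0: "(c :: 's \<Rightarrow>\<^sub>0 int) + c = 0 \<Longrightarrow> c = 0"
proof (rule poly_mapping_eqI)
  fix x assume "c + c = 0"
  then have "Poly_Mapping.lookup (c + c) x = 0" by (simp only: lookup_zero)
  then show "Poly_Mapping.lookup c x = Poly_Mapping.lookup 0 x" by (simp add: lookup_add)
qed

text \<open>Each group is free abelian: on the path components in degree 0, infinite cyclic in a
  positive degree \<open>n\<close>, trivial otherwise.\<close>

lemma no_2_torsion_homology_nsphere: "no_2_torsion (homology_group (int q) (nsphere n))"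
proof (cases "q = 0")
  case True
  have "homology_group 0 (nsphere n) \<cong> free_Abelian_group (path_components_of (nsphere n))"
    by (rule zeroth_homology_group)
  moreover have "no_2_torsion (free_Abelian_group (path_components_of (nsphere n)))"
    unfolding no_2_torsion_def free_Abelian_group_def
    using poly_mapping_int_add_same_eq_0 by auto
  ultimately show ?thesis
    unfolding True of_nat_0 by (intro no_2_torsion_iso[of "homology_group 0 (nsphere n)"]) simp_all
next
  case False
  then have eq: "homology_group (int q) (nsphere n) = reduced_homology_group (int q) (nsphere n)"
    by (simp add: un_reduced_homology_group)
  show ?thesis
  proof (cases "q = n")
    case True
    have "no_2_torsion integer_group"
      by (simp add: no_2_torsion_def integer_group_def)
    then show ?thesis
      unfolding eq unfolding True using reduced_homology_group_nsphere(1)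
      by (intro no_2_torsion_iso[of "reduced_homology_group (int n) (nsphere n)"]) simp_all
  next
    case False
    then have "trivial_group (homology_group (int q) (nsphere n))"
      unfolding eq by (simp add: reduced_homology_group_nsphere(2))
    then show ?thesis
      by (auto simp: trivial_group_def no_2_torsion_def)
  qed
qed

lemma nsphere_half_boundary:
  assumes "singular_relcycle q (nsphere n) {} e" "singular_relboundary q (nsphere n) {} (e + e)"
  shows "singular_relboundary q (nsphere n) {} e"
proof -
  let ?G = "homology_group (int q) (nsphere n)"
  let ?x = "homologous_rel_set q (nsphere n) {} e"
  have "?x \<otimes>\<^bsub>?G\<^esub> ?x = \<one>\<^bsub>?G\<^esub>"
    using assms by (simp add: homology_group_mult homologous_rel_set_eq_relboundary)
  then have "?x = \<one>\<^bsub>?G\<^esub>"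
    using no_2_torsion_homology_nsphere[of q n] homologous_rel_set_in_homology_group[OF assms(1)]
    by (simp add: no_2_torsion_def)
  then show ?thesis
    by (simp add: homologous_rel_set_eq_relboundary)
qed

text \<open>If the boundary of \<open>d\<close> is \<open>b + b\<close>, then \<open>b\<close> is a
  cycle whose double bounds. Without 2-torsion \<open>b\<close> itself bounds some \<open>e\<close>,
  and subtracting \<open>e + e\<close> makes \<open>d\<close> an integral cycle.\<close>

lemma nsphere_mod2_cycle:
  assumes "singular_chain (Suc p) (nsphere n) d" "mod2 (chain_boundary (Suc p) d) = 0"
  obtains z e where "singular_relcycle (Suc p) (nsphere n) {} z" "d = z + (e + e)"
proof -
  obtain b where b: "chain_boundary (Suc p) d = b + b"
    "Poly_Mapping.keys b \<subseteq> Poly_Mapping.keys (chain_boundary (Suc p) d)"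
    using mod2_eq_0_obtain[OF assms(2)] by blast
  have dchain: "singular_chain p (nsphere n) (chain_boundary (Suc p) d)"
    using singular_chain_boundary[OF assms(1)] by simp
  then have bchain: "singular_chain p (nsphere n) b"
    using b(2) by (auto simp: singular_chain_def)
  have "chain_boundary p (b + b) = 0"
    using chain_boundary_boundary_alt[OF assms(1)] b(1) by simp
  then have "chain_boundary p b = 0"
    unfolding chain_boundary_add by (rule poly_mapping_int_add_same_eq_0)
  then have "singular_relcycle p (nsphere n) {} b"
    by (simp add: singular_cycle bchain)
  moreover have "singular_relboundary p (nsphere n) {} (b + b)"
    unfolding singular_boundary using assms(1) b(1) by metis
  ultimately have "singular_relboundary p (nsphere n) {} b"
    by (rule nsphere_half_boundary)
  then obtain e where e: "singular_chain (Suc p) (nsphere n) e" "chain_boundary (Suc p) e = b"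
    unfolding singular_boundary by metis
  show thesis
  proof (rule that[of "d - (e + e)" e])
    show "singular_relcycle (Suc p) (nsphere n) {} (d - (e + e))"
      using assms(1) e b(1)
      by (simp add: singular_cycle singular_chain_diff singular_chain_add chain_boundary_diff
            chain_boundary_add)
  qed simp
qed

lemma ceval_relboundary:
  assumes "coboundary X c = (\<lambda>p \<sigma>. 0)" "singular_relboundary q X {} z"
  shows "ceval (c q) z = 0"
proof -
  obtain d where d: "singular_chain (Suc q) X d" "chain_boundary (Suc q) d = z"
    using assms(2) unfolding singular_boundary by metis
  show ?thesis
    unfolding d(2)[symmetric] by (rule ceval_boundary_eq_0[OF _ d(1)]) (simp only: assms(1))
qed

lemma nsphere_cocycle_cobounds:
  assumes c: "c \<in> homog (nsphere n) (Suc p)" "coboundary (nsphere n) c = (\<lambda>p \<sigma>. 0)"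
    and "\<And>z. singular_relcycle (Suc p) (nsphere n) {} z \<Longrightarrow> ceval (c (Suc p)) z = 0"
  obtains b where "b \<in> homog (nsphere n) p" "c = coboundary (nsphere n) b"
proof (rule homog_cobounds[OF c(1)])
  fix d assume "singular_chain (Suc p) (nsphere n) d" "mod2 (chain_boundary (Suc p) d) = 0"
  then obtain z e where "singular_relcycle (Suc p) (nsphere n) {} z" "d = z + (e + e)"
    by (rule nsphere_mod2_cycle)
  then show "ceval (c (Suc p)) d = 0"
    by (simp add: ceval_add assms(3))
qed (rule that)

text \<open>In a positive degree other than \<open>n\<close> every integral cycle of the sphere
  bounds, so a cocycle vanishes on it.\<close>

lemma nsphere_cocycle_cobounds_off_top:
  assumes c: "c \<in> homog (nsphere n) (Suc p)" "coboundary (nsphere n) c = (\<lambda>p \<sigma>. 0)"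
    and "Suc p \<noteq> n"
  obtains b where "b \<in> homog (nsphere n) p" "c = coboundary (nsphere n) b"
proof (rule nsphere_cocycle_cobounds[OF c])
  fix z assume z: "singular_relcycle (Suc p) (nsphere n) {} z"
  have "trivial_group (homology_group (int (Suc p)) (nsphere n))"
  proof -
    have "int (Suc p) \<noteq> 0" by simp
    then show ?thesis
      unfolding un_reduced_homology_group[OF \<open>int (Suc p) \<noteq> 0\<close>, symmetric]
      by (intro reduced_homology_group_nsphere(2)) (use assms(3) in simp)
  qed
  then have "singular_relboundary (Suc p) (nsphere n) {} z"
    using homologous_rel_set_in_homology_group[OF z]
    by (simp add: trivial_group_def homologous_rel_set_eq_relboundary del: of_nat_Suc)
  then show "ceval (c (Suc p)) z = 0"
    by (rule ceval_relboundary[OF c(2)])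
qed (rule that)

text \<open>The cycle \<open>g\<close> represents a generator of the infinite cyclic top homology.
  Every cycle differs from a multiple of \<open>g\<close> by a boundary, so the single bit
  \<open>ceval (c n) g\<close> decides whether a top cocycle bounds.\<close>

lemma nsphere_fundamental_cycle:
  assumes n: "n = Suc p"
  obtains g where "\<And>c. \<lbrakk>c \<in> homog (nsphere n) n; coboundary (nsphere n) c = (\<lambda>p \<sigma>. 0); ceval (c n) g = 0\<rbrakk>
                  \<Longrightarrow> \<exists>b. b \<in> homog (nsphere n) p \<and> c = coboundary (nsphere n) b"
proof -
  let ?G = "homology_group (int n) (nsphere n)"
  have "?G \<cong> integer_group"
  proof -
    have "int n \<noteq> 0" using n by simp
    then show ?thesis
      unfolding un_reduced_homology_group[OF \<open>int n \<noteq> 0\<close>, symmetric]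
      by (intro reduced_homology_group_nsphere(1))
  qed
  then obtain h where h: "h \<in> hom ?G integer_group" "bij_betw h (carrier ?G) UNIV"
    by (auto simp: is_iso_def iso_def)
  define deg where "deg z = h (homologous_rel_set n (nsphere n) {} z)" for z
  let ?cyc = "singular_relcycle n (nsphere n) {}"
  have deg_add: "deg (a + b) = deg a + deg b" if "?cyc a" "?cyc b" for a b
    using hom_mult[OF h(1) homologous_rel_set_in_homology_group[OF that(1)]
        homologous_rel_set_in_homology_group[OF that(2)]] homology_group_mult[OF that]
    by (simp add: deg_def)
  have deg_diff: "deg (a - b) = deg a - deg b" if "?cyc a" "?cyc b" for a b
    using deg_add[OF singular_relcycle_diff[OF that] that(2)] by simp
  have deg_0: "deg 0 = 0"
    using deg_add[of 0 0] by simp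
  have "1 \<in> h ` carrier ?G"
    using h(2) by (simp add: bij_betw_def)
  then obtain g where g: "?cyc g" "deg g = 1"
    unfolding carrier_relative_homology_group deg_def by auto
  \<comment> \<open>Only additivity of \<open>deg\<close> on cycles is known, so the multiples of
    \<open>g\<close> are reached by induction in both directions.\<close>
  have deg_cmul: "deg (frag_cmul k g) = k" for k
  proof (induction k rule: int_induct[of _ 0])
    case base
    then show ?case by (simp add: deg_0)
  next
    case (step1 i)
    then show ?case
      using deg_add[OF singular_relcycle_cmul[OF g(1)] g(1), of i] g(2)
      by (simp add: frag_cmul_distrib)
  next
    case (step2 i)
    then show ?case
      using deg_diff[OF singular_relcycle_cmul[OF g(1)] g(1), of i] g(2)
      by (simp add: frag_cmul_diff_distrib)
  qed
  have deg_eq_0: "singular_relboundary n (nsphere n) {} z" if z: "?cyc z" "deg z = 0" for z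
  proof -
    have "homologous_rel_set n (nsphere n) {} z = homologous_rel_set n (nsphere n) {} 0"
    proof (rule inj_onD[of h "carrier ?G"])
      show "inj_on h (carrier ?G)"
        using h(2) by (rule bij_betw_imp_inj_on)
      show "h (homologous_rel_set n (nsphere n) {} z) = h (homologous_rel_set n (nsphere n) {} 0)"
        using z(2) deg_0 by (simp add: deg_def)
    qed (use z(1) in \<open>auto intro!: homologous_rel_set_in_homology_group\<close>)
    then have "homologous_rel n (nsphere n) {} z 0"
      by (simp add: homologous_rel_set_eq)
    then show ?thesis
      by (simp add: homologous_rel_def)
  qed
  show thesis
  proof (rule that)
    fix c assume c: "c \<in> homog (nsphere n) n" "coboundary (nsphere n) c = (\<lambda>p \<sigma>. 0)" "ceval (c n) g = 0"
    have "ceval (c n) z = 0" if z: "?cyc z" for z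
    proof -
      let ?w = "frag_cmul (deg z) g"
      have "?cyc ?w" by (rule singular_relcycle_cmul[OF g(1)])
      then have "singular_relboundary n (nsphere n) {} (z - ?w)"
        using z by (intro deg_eq_0) (auto simp: deg_diff deg_cmul intro: singular_relcycle_diff)
      then have "ceval (c n) (z - ?w) = 0"
        by (rule ceval_relboundary[OF c(2)])
      then show ?thesis
        by (simp add: ceval_diff ceval_cmul c(3) split: if_splits)
    qed
    then show "\<exists>b. b \<in> homog (nsphere n) p \<and> c = coboundary (nsphere n) b"
      using nsphere_cocycle_cobounds[of c n p] c n by metis
  qed
qed

section \<open>Lifting simplices to the sphere\<close>

definition pull :: "'a topology \<Rightarrow> ('a \<Rightarrow> 'b) \<Rightarrow> 'b cochain \<Rightarrow> 'a cochain" where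
  "pull X g c = (\<lambda>p \<sigma>. if singular_simplex p X \<sigma> then c p (simplex_map p g \<sigma>) else 0)"

lemma pull_cup:
  assumes "continuous_map X Y g"
  shows "pull X g (cup Y a b) = cup X (pull X g a) (pull X g b)"
proof (rule cochain_eqI)
  fix n and \<sigma> :: "(nat \<Rightarrow> real) \<Rightarrow> 'a"
  assume \<sigma>: "singular_simplex n X \<sigma>"
  have "singular_simplex p X (simplex_op p (\<lambda>i. i) \<sigma>)"
    "singular_simplex (n - p) X (simplex_op (n - p) (\<lambda>i. i + p) \<sigma>)"
    "simplex_op p (\<lambda>i. i) (simplex_map n g \<sigma>) = simplex_map p g (simplex_op p (\<lambda>i. i) \<sigma>)"
    "simplex_op (n - p) (\<lambda>i. i + p) (simplex_map n g \<sigma>) =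
     simplex_map (n - p) g (simplex_op (n - p) (\<lambda>i. i + p) \<sigma>)" if "p \<le> n" for p
    using that by (auto intro!: singular_simplex_simplex_op[OF \<sigma>] simplex_op_simplex_map)
  then show "pull X g (cup Y a b) n \<sigma> = cup X (pull X g a) (pull X g b) n \<sigma>"
    using \<sigma> assms by (simp add: pull_def cup_eq singular_simplex_simplex_map)
qed (simp add: pull_def cup_not_simplex)

lemma pull_coboundary:
  assumes "continuous_map X Y g"
  shows "pull X g (coboundary Y a) = coboundary X (pull X g a)"
proof (rule cochain_eqI)
  fix n and \<sigma> :: "(nat \<Rightarrow> real) \<Rightarrow> 'a"
  assume \<sigma>: "singular_simplex n X \<sigma>"
  show "pull X g (coboundary Y a) n \<sigma> = coboundary X (pull X g a) n \<sigma>"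
  proof (cases n)
    case 0
    then show ?thesis by (simp add: pull_def)
  next
    case (Suc m)
    have "singular_simplex m X (simplex_op m (skip i) \<sigma>)"
      "simplex_op m (skip i) (simplex_map n g \<sigma>) = simplex_map m g (simplex_op m (skip i) \<sigma>)"
      if "i \<le> Suc m" for i
      using that \<sigma> unfolding Suc
      by (auto intro!: simplex_op_skip_singular simplex_op_simplex_map simp: skip_def)
    then show ?thesis
      using \<sigma> assms unfolding Suc
      by (simp add: pull_def coboundary_Suc singular_simplex_simplex_map del: sum.atMost_Suc)
  qed
qed (simp add: pull_def coboundary_not_simplex)

lemma pull_add: "pull X g (\<lambda>p \<sigma>. a p \<sigma> + b p \<sigma>) = (\<lambda>p \<sigma>. pull X g a p \<sigma> + pull X g b p \<sigma>)"
  by (auto simp: pull_def fun_eq_iff)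

lemma pull_zero [simp]: "pull X g (\<lambda>p \<sigma>. 0) = (\<lambda>p \<sigma>. 0)"
  by (auto simp: pull_def fun_eq_iff)

lemma pull_unit:
  assumes "continuous_map X Y g"
  shows "pull X g (unit_cochain Y) = unit_cochain X"
  using assms by (auto simp: pull_def unit_cochain_def fun_eq_iff singular_simplex_simplex_map)

lemma pull_cochains:
  assumes "c \<in> cochains Y"
  shows "pull X g c \<in> cochains X"
proof -
  obtain M where M: "\<And>p \<sigma>. M < p \<Longrightarrow> c p \<sigma> = 0"
    using assms cochains_bounded by metis
  show ?thesis
    by (rule cochainsI[where N = M]) (auto simp: pull_def M split: if_splits)
qed

section \<open>The antipodal map and the double covering of projective space\<close>

definition antipode :: "(nat \<Rightarrow> real) \<Rightarrow> nat \<Rightarrow> real" where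
  "antipode x = (\<lambda>i. - x i)"

lemma topspace_nsphere: "x \<in> topspace (nsphere n) \<longleftrightarrow> (\<Sum>i\<le>n. (x i)\<^sup>2) = 1 \<and> (\<forall>i>n. x i = 0)"
  by (simp add: nsphere)

lemma antipode_antipode [simp]: "antipode (antipode x) = x"
  by (simp add: antipode_def)

lemma antipode_in_nsphere: "x \<in> topspace (nsphere n) \<Longrightarrow> antipode x \<in> topspace (nsphere n)"
  by (simp add: topspace_nsphere antipode_def)

lemma continuous_map_antipode: "continuous_map (nsphere n) (nsphere n) antipode"
proof -
  have "continuous_map (powertop_real UNIV) (powertop_real UNIV) antipode"
    unfolding antipode_def continuous_map_componentwise_UNIV
    by (auto intro!: continuous_intros continuous_map_product_projection)
  then show ?thesis
    by (auto simp: nsphere continuous_map_in_subtopology antipode_def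
        intro: continuous_map_from_subtopology)
qed

lemma antipodal_class_antipode: "antipodal_class (antipode x) = antipodal_class x"
  by (auto simp: antipodal_class_def antipode_def)

lemma antipodal_class_eq_iff: "antipodal_class x = antipodal_class y \<longleftrightarrow> x = y \<or> x = antipode y"
  by (auto simp: antipodal_class_def antipode_def doubleton_eq_iff)

lemma continuous_map_antipodal_class:
  "continuous_map (nsphere n) (projective_space n) antipodal_class"
  by (rule quotient_imp_continuous_map[OF quotient_map_antipodal_class])

lemma topspace_projective_space:
  "topspace (projective_space n) = antipodal_class ` topspace (nsphere n)"
  using quotient_map_antipodal_class[of n] by (simp add: quotient_map_def)

text \<open>The product of two coordinates is unchanged by the antipode, so the choice of
  representative does not matter. These functions supply the matrix used for lifting and, for
  \<open>i = j\<close>, the open sets where a coordinate is nonzero.\<close>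

definition coord_prod :: "nat \<Rightarrow> nat \<Rightarrow> (nat \<Rightarrow> real) set \<Rightarrow> real" where
  "coord_prod i j C = (SOME x. x \<in> C) i * (SOME x. x \<in> C) j"

lemma coord_prod_antipodal_class: "coord_prod i j (antipodal_class x) = x i * x j"
proof -
  have "(SOME y. y \<in> antipodal_class x) \<in> antipodal_class x"
    by (rule someI[of _ x]) (simp add: antipodal_class_def)
  then show ?thesis
    by (auto simp: coord_prod_def antipodal_class_def)
qed

lemma continuous_map_coord_prod:
  "continuous_map (projective_space n) euclideanreal (coord_prod i j)"
proof -
  have "continuous_map (nsphere n) euclideanreal (\<lambda>x. x i * x j)"
    by (intro continuous_map_real_mult continuous_map_nsphere_projection)
  moreover have "coord_prod i j \<circ> antipodal_class = (\<lambda>x. x i * x j)"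
    by (simp add: fun_eq_iff coord_prod_antipodal_class)
  ultimately show ?thesis
    using continuous_compose_quotient_map_eq[OF quotient_map_antipodal_class] by metis
qed

lemma continuous_on_singular_simplex_real:
  assumes "singular_simplex p X \<sigma>" "continuous_map X euclideanreal f"
  shows "continuous_on (standard_simplex p) (\<lambda>t. f (\<sigma> t))"
proof -
  have "continuous_map (subtopology (powertop_real UNIV) (standard_simplex p)) euclideanreal (f \<circ> \<sigma>)"
    using assms unfolding singular_simplex_def by (blast intro: continuous_map_compose)
  then show ?thesis
    by (simp add: euclidean_product_topology o_def)
qed

lemma connected_standard_simplex: "connected (standard_simplex p)"
  using connectedin_standard_simplex[of p] by (simp add: euclidean_product_topology)

lemma compact_standard_simplex: "compact (standard_simplex p)"
  using compactin_standard_simplex[of p] by (simp add: euclidean_product_topology)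

lemma singular_simplex_in_topspace:
  "singular_simplex p X \<sigma> \<Longrightarrow> t \<in> standard_simplex p \<Longrightarrow> \<sigma> t \<in> topspace X"
  by (auto simp: singular_simplex_def continuous_map_def Pi_iff)

text \<open>The inner product of two lifts is continuous with values 1 and -1, hence constant on the
  connected simplex; its value tells which of the two cases holds everywhere.\<close>

lemma simplex_lift_unique:
  assumes \<tau>: "singular_simplex p (nsphere n) \<tau>" and \<tau>': "singular_simplex p (nsphere n) \<tau>'"
    and eq: "simplex_map p antipodal_class \<tau> = simplex_map p antipodal_class \<tau>'"
  shows "\<tau> = \<tau>' \<or> \<tau> = simplex_map p antipode \<tau>'"
proof -
  define u where "u t = (\<Sum>i\<le>n. \<tau> t i * \<tau>' t i)" for t
  have cont: "continuous_on (standard_simplex p) u"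
    unfolding u_def
    by (intro continuous_on_sum continuous_on_mult)
       (auto intro!: continuous_on_singular_simplex_real[OF \<tau>]
          continuous_on_singular_simplex_real[OF \<tau>'] continuous_map_nsphere_projection)
  have cases: "\<tau> t = \<tau>' t \<or> \<tau> t = antipode (\<tau>' t)" if "t \<in> standard_simplex p" for t
    using fun_cong[OF eq, of t] that by (simp add: simplex_map_def antipodal_class_eq_iff)
  have norm: "(\<Sum>i\<le>n. \<tau>' t i * \<tau>' t i) = 1" if "t \<in> standard_simplex p" for t
    using singular_simplex_in_topspace[OF \<tau>' that] by (simp add: topspace_nsphere power2_eq_square)
  have u1: "u t = 1" if "t \<in> standard_simplex p" "\<tau> t = \<tau>' t" for t
    using that norm by (simp add: u_def)
  have u2: "u t = -1" if "t \<in> standard_simplex p" "\<tau> t = antipode (\<tau>' t)" for t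
    using that norm by (simp add: u_def antipode_def sum_negf)
  have "connected (u ` standard_simplex p)"
    using connected_continuous_image[OF cont connected_standard_simplex] .
  moreover have sub: "u ` standard_simplex p \<subseteq> {1, -1}"
    using cases u1 u2 by blast
  then have "finite (u ` standard_simplex p)"
    by (rule finite_subset) simp
  ultimately obtain a where a: "u ` standard_simplex p = {a}"
    using connected_finite_iff_sing nonempty_standard_simplex by (metis image_is_empty)
  have ext: "\<tau> \<in> extensional (standard_simplex p)" "\<tau>' \<in> extensional (standard_simplex p)"
    using \<tau> \<tau>' by (auto simp: singular_simplex_def)
  have "a = 1 \<or> a = -1" using sub a by auto
  then show ?thesis
  proof
    assume "a = 1"
    then have "\<tau> t = \<tau>' t" if "t \<in> standard_simplex p" for t
      using that cases[OF that] u2[OF that] a by (metis imageI one_neq_neg_one singletonD)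
    then have "\<tau> = \<tau>'"
      using ext by (meson extensionalityI)
    then show ?thesis ..
  next
    assume "a = -1"
    then have "\<tau> t = antipode (\<tau>' t)" if "t \<in> standard_simplex p" for t
      using that cases[OF that] u1[OF that] a by (metis imageI one_neq_neg_one singletonD)
    then have "\<tau> = simplex_map p antipode \<tau>'"
      using ext by (intro extensionalityI[of _ "standard_simplex p"]) (auto simp: simplex_map_def)
    then show ?thesis ..
  qed
qed

text \<open>
  The class of \<open>x\<close> is determined by the matrix \<open>x x\<^sup>T\<close>, which depends continuously on the class;
  applying this matrix to a nearby unit vector and normalizing yields \<open>x\<close> or its antipode. A
  simplex is lifted by doing this successively along the segments from a fixed vertex.
\<close>

lemma simplex_lift_exists:
  assumes \<sigma>: "singular_simplex p (projective_space n) \<sigma>"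
  obtains \<tau> where "singular_simplex p (nsphere n) \<tau>" "simplex_map p antipodal_class \<tau> = \<sigma>"
proof -
  let ?D = "standard_simplex p"
  let ?K = "{0..1} \<times> {0..1} \<times> ?D :: (real \<times> real \<times> (nat \<Rightarrow> real)) set"
  define v :: "nat \<Rightarrow> real" where "v = (\<lambda>j. if j = 0 then 1 else 0)"
  have v: "v \<in> ?D" by (simp add: v_def)
  define h where "h s t = (\<lambda>i. (1 - s) * v i + s * t i)" for s :: real and t :: "nat \<Rightarrow> real"
  have h: "h s t \<in> ?D" if "s \<in> {0..1}" "t \<in> ?D" for s t
    unfolding h_def using that v by (intro convex_standard_simplex) auto
  define m where "m i j t = coord_prod i j (\<sigma> t)" for i j t
  have m_cont: "continuous_on ?D (m i j)" for i j
    unfolding m_def by (rule continuous_on_singular_simplex_real[OF \<sigma> continuous_map_coord_prod])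
  have rep: "\<exists>y\<in>topspace (nsphere n). \<sigma> t = antipodal_class y" if "t \<in> ?D" for t
    using singular_simplex_in_topspace[OF \<sigma> that] by (auto simp: topspace_projective_space)
  have m_eq: "m i j t = y i * y j" if "\<sigma> t = antipodal_class y" for i j t y
    by (simp add: m_def that coord_prod_antipodal_class)
  \<comment> \<open>The squared inner product of representatives of two points on the segment,
    written through functions on projective space so that its continuity is known before any lift is
    chosen.\<close>
  define F where "F s s' t = (\<Sum>i\<le>n. \<Sum>j\<le>n. m i j (h s t) * m i j (h s' t))" for s s' t
  have F_eq: "F s s' t = (\<Sum>i\<le>n. x i * y i)\<^sup>2"
    if "\<sigma> (h s t) = antipodal_class x" "\<sigma> (h s' t) = antipodal_class y" for s s' t x y
    unfolding F_def m_eq[OF that(1)] m_eq[OF that(2)]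
    by (simp add: power2_eq_square sum_product algebra_simps)
  have F_cont: "continuous_on ?K (\<lambda>(s, s', t). F s s' t)"
  proof -
    have hc: "continuous_on T (\<lambda>z. h (f z) (g z))"
      if "continuous_on T f" "continuous_on T g" for T :: "(real \<times> real \<times> (nat \<Rightarrow> real)) set" and f g
      unfolding h_def
      by (rule continuous_on_coordinatewise_then_product)
         (intro continuous_on_add continuous_on_mult continuous_on_diff continuous_on_const that(1)
            continuous_on_product_then_coordinatewise[OF that(2)])
    have snd_cont: "continuous_on T (\<lambda>z. snd (snd z))" for T :: "(real \<times> real \<times> (nat \<Rightarrow> real)) set"
      by (intro continuous_on_snd continuous_on_id)
    have "continuous_on ?K (\<lambda>z. m i j (h (f z) (snd (snd z))))"
      if "continuous_on ?K f" "f \<in> ?K \<rightarrow> {0..1}"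
      for i j and f :: "real \<times> real \<times> (nat \<Rightarrow> real) \<Rightarrow> real"
      by (rule continuous_on_compose2[OF m_cont hc[OF that(1) snd_cont]])
         (use that(2) h in \<open>auto simp: Pi_iff\<close>)
    note mh = this
    have mh1: "continuous_on ?K (\<lambda>z. m i j (h (fst z) (snd (snd z))))" for i j
      by (rule mh[of fst]) (auto intro: continuous_on_fst continuous_on_id)
    have mh2: "continuous_on ?K (\<lambda>z. m i j (h (fst (snd z)) (snd (snd z))))" for i j
      by (rule mh[of "\<lambda>z. fst (snd z)"], intro continuous_on_fst continuous_on_snd continuous_on_id) auto
    have "continuous_on ?K
        (\<lambda>z. F (fst z) (fst (snd z)) (snd (snd z)))"
      unfolding F_def
      by (intro continuous_on_sum continuous_on_mult mh1 mh2)
    then show ?thesis by (simp add: case_prod_unfold)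
  qed
  \<comment> \<open>As \<open>F s s t = 1\<close>, uniform continuity gives one step length
    \<open>1 / N\<close>, valid for all \<open>s\<close> and \<open>t\<close> at once, for which
    consecutive points have representatives that are not orthogonal.\<close>
  have "uniformly_continuous_on ?K (\<lambda>(s, s', t). F s s' t)"
    by (rule compact_uniformly_continuous[OF F_cont])
       (intro compact_Times compact_standard_simplex compact_Icc)
  then obtain \<delta> where \<delta>: "\<delta> > 0" "\<And>z z'. \<lbrakk>z \<in> ?K; z' \<in> ?K;
      dist z' z < \<delta>\<rbrakk> \<Longrightarrow> dist ((\<lambda>(s, s', t). F s s' t) z') ((\<lambda>(s, s', t). F s s' t) z) < 1"
    unfolding uniformly_continuous_on_def by (metis zero_less_one)
  obtain N :: nat where N: "N > 0" "1 / real N < \<delta>"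
    using reals_Archimedean[OF \<delta>(1)] by (metis inverse_eq_divide zero_less_Suc)
  have F_pos: "F s s' t > 0" if st: "s \<in> {0..1}" "s' \<in> {0..1}" "\<bar>s' - s\<bar> < \<delta>" "t \<in> ?D" for s s' t
  proof -
    have "dist (s, s', t) (s, s, t) < \<delta>"
      using that by (simp add: dist_Pair_Pair dist_real_def)
    then have "dist (F s s' t) (F s s t) < 1"
      using \<delta>(2)[of "(s, s, t)" "(s, s', t)"] that by auto
    moreover have "F s s t = 1"
    proof -
      obtain y where "y \<in> topspace (nsphere n)" "\<sigma> (h s t) = antipodal_class y"
        using rep[OF h[OF st(1) st(4)]] by blast
      then show ?thesis
        using F_eq[of s t y s y] by (simp add: topspace_nsphere power2_eq_square)
    qed
    ultimately show ?thesis
      by (simp add: dist_real_def)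
  qed
  have "\<exists>X. continuous_on ?D X \<and>
      (\<forall>t\<in>?D. X t \<in> topspace (nsphere n) \<and> antipodal_class (X t) = \<sigma> (h (real k / real N) t))"
    if "k \<le> N" for k
    using that
  proof (induction k)
    case 0
    obtain y where "y \<in> topspace (nsphere n)" "\<sigma> v = antipodal_class y"
      using rep[OF v] by blast
    moreover have "h 0 t = v" for t
      by (simp add: h_def)
    ultimately show ?case
      by (intro exI[of _ "\<lambda>t. y"]) auto
  next
    case (Suc k)
    then obtain X where X: "continuous_on ?D X" "\<And>t. t \<in> ?D \<Longrightarrow> X t \<in> topspace (nsphere n)"
      "\<And>t. t \<in> ?D \<Longrightarrow> \<sigma> (h (real k / real N) t) = antipodal_class (X t)"
      by (metis Suc_leD)
    let ?s = "real k / real N" and ?s' = "real (Suc k) / real N"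
    have s: "?s \<in> {0..1}" "?s' \<in> {0..1}" "\<bar>?s' - ?s\<bar> < \<delta>"
      using Suc.prems N by (auto simp: field_simps simp flip: diff_divide_distrib)
    have pos: "F ?s ?s' t > 0" if "t \<in> ?D" for t
      using F_pos[OF s that] .
    \<comment> \<open>If \<open>y\<close> represents the new point, the numerator is
      \<open>y i\<close> times the inner product of \<open>y\<close> and \<open>X t\<close>, and the
      denominator is the absolute value of that inner product. So \<open>Y t\<close> is
      \<open>y\<close> or its antipode, with the sign dictated by \<open>X t\<close>.\<close>
    define Y where "Y t = (\<lambda>i. (\<Sum>j\<le>n. m i j (h ?s' t) * X t j) / sqrt (F ?s ?s' t))" for t
    have "continuous_on ?D (\<lambda>t. m i j (h r t))" if "r \<in> {0..1}" for i j r
    proof (rule continuous_on_compose2[OF m_cont])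
      show "continuous_on ?D (h r)"
        unfolding h_def
        by (rule continuous_on_coordinatewise_then_product)
           (intro continuous_on_add continuous_on_mult continuous_on_const
            continuous_on_product_then_coordinatewise[OF continuous_on_id])
    qed (use h that in auto)
    note mh = this[OF s(1)] this[OF s(2)]
    have "continuous_on ?D Y"
      unfolding Y_def
    proof (rule continuous_on_coordinatewise_then_product, intro continuous_on_divide
        continuous_on_sum continuous_on_mult mh continuous_on_product_then_coordinatewise[OF X(1)]
        continuous_on_real_sqrt)
      show "continuous_on ?D (F ?s ?s')"
        unfolding F_def by (intro continuous_on_sum continuous_on_mult mh)
      show "\<forall>t\<in>?D. sqrt (F ?s ?s' t) \<noteq> 0"
        using pos by fastforce
    qed
    moreover have "Y t \<in> topspace (nsphere n) \<and> antipodal_class (Y t) = \<sigma> (h ?s' t)"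
      if t: "t \<in> ?D" for t
    proof -
      obtain y where y: "y \<in> topspace (nsphere n)" "\<sigma> (h ?s' t) = antipodal_class y"
        using rep[OF h[OF s(2) t]] by blast
      define a where "a = (\<Sum>i\<le>n. X t i * y i)"
      have Fa: "F ?s ?s' t = a\<^sup>2"
        unfolding a_def by (rule F_eq[OF X(3)[OF t] y(2)])
      then have "a \<noteq> 0" using pos[OF t] by auto
      have "Y t i = y i * (a / \<bar>a\<bar>)" for i
        unfolding Y_def Fa m_eq[OF y(2)] real_sqrt_abs
        by (simp add: a_def sum_distrib_left sum_divide_distrib algebra_simps)
      then have "Y t = y \<or> Y t = antipode y"
        using \<open>a \<noteq> 0\<close> by (cases "a > 0") (auto simp: antipode_def fun_eq_iff)
      then show ?thesis
        using y antipode_in_nsphere[OF y(1)] antipodal_class_antipode[of y] by metis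
    qed
    ultimately show ?case by blast
  qed
  from this[of N] obtain X where X: "continuous_on ?D X" "\<And>t. t \<in> ?D \<Longrightarrow> X t \<in> topspace (nsphere n)"
      "\<And>t. t \<in> ?D \<Longrightarrow> antipodal_class (X t) = \<sigma> (h 1 t)"
    using N(1) by auto
  have h1: "h 1 t = t" for t
    by (simp add: h_def)
  show thesis
  proof
    have "continuous_map (subtopology (powertop_real UNIV) ?D) (powertop_real UNIV) (restrict X ?D)"
    proof (rule continuous_map_eq)
      show "continuous_map (subtopology (powertop_real UNIV) ?D) (powertop_real UNIV) X"
        using X(1) by (simp add: euclidean_product_topology)
    qed auto
    then show "singular_simplex p (nsphere n) (restrict X ?D)"
      using X(2) unfolding singular_simplex_def nsphere
      by (auto simp: continuous_map_in_subtopology topspace_nsphere)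
    show "simplex_map p antipodal_class (restrict X ?D) = \<sigma>"
    proof (rule extensionalityI[of _ ?D])
      show "\<sigma> \<in> extensional ?D" using \<sigma> by (simp add: singular_simplex_def)
    qed (auto simp: simplex_map_def X h1)
  qed
qed

section \<open>The transfer sequence\<close>

abbreviation cochain_add :: "'a cochain \<Rightarrow> 'a cochain \<Rightarrow> 'a cochain" (infixl "\<boxplus>" 65) where
  "a \<boxplus> b \<equiv> \<lambda>p \<sigma>. a p \<sigma> + b p \<sigma>"

abbreviation zero_cochain :: "'a cochain" where
  "zero_cochain \<equiv> \<lambda>p \<sigma>. 0"

lemma cochain_add_same [simp]: "a \<boxplus> a = zero_cochain"
  by simp

lemma bit_add_cancel: "(x::bit) + c + (y + c) = x + y"
  by (cases c) auto

lemma bit_add_eq_0_iff: "(x::bit) + y = 0 \<longleftrightarrow> x = y"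
  by (cases x; cases y) auto

lemma cochain_add_eq_0_iff: "a \<boxplus> b = zero_cochain \<longleftrightarrow> a = b"
  by (auto simp: fun_eq_iff bit_add_eq_0_iff)

lemma cochains_eq_0: "c \<in> cochains X \<Longrightarrow> \<not> singular_simplex p X \<sigma> \<Longrightarrow> c p \<sigma> = 0"
  unfolding cochains_def by blast

lemma homogI:
  assumes "\<And>p \<sigma>. p \<noteq> q \<Longrightarrow> c p \<sigma> = 0" "\<And>p \<sigma>. \<not> singular_simplex p X \<sigma> \<Longrightarrow> c p \<sigma> = 0"
  shows "c \<in> homog X q"
  using assms unfolding homog_def by blast

lemma homog_add: "a \<in> homog X q \<Longrightarrow> b \<in> homog X q \<Longrightarrow> a \<boxplus> b \<in> homog X q"
  by (rule homogI) (auto simp: homog_eq_0 cochains_eq_0[OF homog_cochains])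

lemma homog_coboundary: "a \<in> homog X q \<Longrightarrow> coboundary X a \<in> homog X (Suc q)"
  by (rule homogI) (auto simp: coboundary_def intro!: sum.neutral intro: homog_eq_0)

lemma homog_cup:
  assumes "a \<in> homog X p" "b \<in> homog X q"
  shows "cup X a b \<in> homog X (p + q)"
proof -
  have "cup X a b n \<sigma> = 0" if "n \<noteq> p + q" for n \<sigma>
  proof -
    have "a r (front_face r \<sigma>) = 0 \<or> b (n - r) (back_face r (n - r) \<sigma>) = 0" if "r \<le> n" for r
      using homog_eq_0[OF assms(1), of r] homog_eq_0[OF assms(2), of "n - r"] that \<open>n \<noteq> p + q\<close>
      by (cases "r = p") auto
    then show ?thesis
      unfolding cup_def by (auto intro!: sum.neutral)
  qed
  moreover have "singular_simplex n X \<sigma>" if "cup X a b n \<sigma> \<noteq> 0" for n \<sigma>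
    using that cup_not_simplex by metis
  ultimately show ?thesis
    unfolding homog_def by blast
qed

lemma homog_unit: "unit_cochain X \<in> homog X 0"
  by (auto simp: homog_def unit_cochain_def split: if_splits)

lemma homog_pull: "c \<in> homog Y q \<Longrightarrow> pull X g c \<in> homog X q"
  unfolding homog_def pull_def by (auto split: if_splits)

definition component :: "nat \<Rightarrow> 'a cochain \<Rightarrow> 'a cochain" where
  "component q c = (\<lambda>p \<sigma>. if p = q then c p \<sigma> else 0)"

lemma homog_component: "c \<in> cochains X \<Longrightarrow> component q c \<in> homog X q"
  using cochainsD by (fastforce simp: homog_def component_def split: if_splits)

lemma component_homog: "c \<in> homog X q \<Longrightarrow> component q c = c"
  by (auto simp: component_def fun_eq_iff homog_eq_0)

lemma component_add: "component q (a \<boxplus> b) = component q a \<boxplus> component q b"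
  by (auto simp: component_def fun_eq_iff)

lemma component_pull: "component q (pull X g c) = pull X g (component q c)"
  by (auto simp: component_def pull_def fun_eq_iff)

lemma component_coboundary: "coboundary X (component q c) = component (Suc q) (coboundary X c)"
  by (auto simp: component_def coboundary_def fun_eq_iff intro!: sum.neutral)

lemma component_zero [simp]: "component q zero_cochain = zero_cochain"
  by (simp add: component_def)

section \<open>Pullback to the sphere and descent of invariant cochains\<close>

abbreviation pullback :: "nat \<Rightarrow> (nat \<Rightarrow> real) set cochain \<Rightarrow> (nat \<Rightarrow> real) cochain" where
  "pullback n \<equiv> pull (nsphere n) antipodal_class"

abbreviation flip :: "nat \<Rightarrow> (nat \<Rightarrow> real) cochain \<Rightarrow> (nat \<Rightarrow> real) cochain" where
  "flip n \<equiv> pull (nsphere n) antipode"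

lemmas pullback_cup = pull_cup[OF continuous_map_antipodal_class]
lemmas pullback_coboundary = pull_coboundary[OF continuous_map_antipodal_class]
lemmas flip_cup = pull_cup[OF continuous_map_antipode]
lemmas flip_coboundary = pull_coboundary[OF continuous_map_antipode]

text \<open>Every simplex of projective space lifts, so the pullback retains all values of a
  cochain. Equations between cochains can therefore be checked on the sphere.\<close>

lemma pullback_inj:
  assumes "a \<in> cochains (projective_space n)" "b \<in> cochains (projective_space n)"
    and eq: "pullback n a = pullback n b"
  shows "a = b"
proof (rule cochain_eqI)
  fix p \<sigma> assume "singular_simplex p (projective_space n) \<sigma>"
  then obtain \<tau> where "singular_simplex p (nsphere n) \<tau>" "simplex_map p antipodal_class \<tau> = \<sigma>"
    by (rule simplex_lift_exists)
  then show "a p \<sigma> = b p \<sigma>"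
    using fun_cong[OF fun_cong[OF eq, of p], of \<tau>] by (simp add: pull_def)
next
  fix p \<sigma> assume "\<not> singular_simplex p (projective_space n) \<sigma>"
  then show "a p \<sigma> = b p \<sigma>"
    using assms(1,2) cochainsD by metis
qed

lemma simplex_map_antipodal_class_antipode:
  "simplex_map p antipodal_class (simplex_map p antipode \<tau>) = simplex_map p antipodal_class \<tau>"
  by (rule ext) (simp add: simplex_map_def restrict_def antipodal_class_antipode)

lemma simplex_map_antipode_antipode:
  "singular_simplex p X \<tau> \<Longrightarrow> simplex_map p antipode (simplex_map p antipode \<tau>) = \<tau>"
  unfolding singular_simplex_def
  by (intro extensionalityI[of _ "standard_simplex p"]) (auto simp: simplex_map_def)

lemma singular_simplex_antipode:
  "singular_simplex p (nsphere n) \<tau> \<Longrightarrow> singular_simplex p (nsphere n) (simplex_map p antipode \<tau>)"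
  by (rule singular_simplex_simplex_map[OF _ continuous_map_antipode])

lemma flip_pullback [simp]: "flip n (pullback n a) = pullback n a"
  by (auto simp: pull_def fun_eq_iff singular_simplex_antipode simplex_map_antipodal_class_antipode)

lemma flip_flip:
  assumes "c \<in> cochains (nsphere n)"
  shows "flip n (flip n c) = c"
proof (rule cochain_eqI)
  fix p \<sigma> assume "singular_simplex p (nsphere n) \<sigma>"
  then show "flip n (flip n c) p \<sigma> = c p \<sigma>"
    by (simp add: pull_def singular_simplex_antipode simplex_map_antipode_antipode)
next
  fix p \<sigma> assume "\<not> singular_simplex p (nsphere n) \<sigma>"
  then show "flip n (flip n c) p \<sigma> = c p \<sigma>"
    by (simp add: pull_def cochains_eq_0[OF assms])
qed

text \<open>The two lifts of a simplex differ by the antipode, so an invariant cochain takes the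
  same value on both and the arbitrary choice of \<open>lift\<close> is harmless.\<close>

lemma invariant_cochain_descends:
  assumes c: "c \<in> cochains (nsphere n)" "flip n c = c"
  obtains b where "b \<in> cochains (projective_space n)" "pullback n b = c"
    "\<And>q. c \<in> homog (nsphere n) q \<Longrightarrow> b \<in> homog (projective_space n) q"
proof -
  define lift where "lift p \<sigma> = (SOME \<tau>. singular_simplex p (nsphere n) \<tau> \<and>
      simplex_map p antipodal_class \<tau> = \<sigma>)" for p \<sigma>
  have lift: "singular_simplex p (nsphere n) (lift p \<sigma>)"
    "simplex_map p antipodal_class (lift p \<sigma>) = \<sigma>"
    if "singular_simplex p (projective_space n) \<sigma>" for p \<sigma>
    using someI_ex[of "\<lambda>\<tau>. singular_simplex p (nsphere n) \<tau> \<and> simplex_map p antipodal_class \<tau> = \<sigma>"]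
      simplex_lift_exists[OF that] unfolding lift_def by blast+
  define b where "b = (\<lambda>p \<sigma>. if singular_simplex p (projective_space n) \<sigma> then c p (lift p \<sigma>) else 0)"
  obtain M where M: "\<And>p \<sigma>. M < p \<Longrightarrow> c p \<sigma> = 0"
    using c(1) cochains_bounded by metis
  show thesis
  proof
    show "b \<in> cochains (projective_space n)"
      by (rule cochainsI[where N = M]) (auto simp: b_def M split: if_splits)
    show "pullback n b = c"
    proof (rule cochain_eqI)
      fix p \<tau> assume \<tau>: "singular_simplex p (nsphere n) \<tau>"
      let ?\<sigma> = "simplex_map p antipodal_class \<tau>"
      have \<sigma>: "singular_simplex p (projective_space n) ?\<sigma>"
        by (rule singular_simplex_simplex_map[OF \<tau> continuous_map_antipodal_class])
      have "lift p ?\<sigma> = \<tau> \<or> lift p ?\<sigma> = simplex_map p antipode \<tau>"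
        using simplex_lift_unique[OF lift(1)[OF \<sigma>] \<tau>] lift(2)[OF \<sigma>] by simp
      moreover have "c p (simplex_map p antipode \<tau>) = c p \<tau>"
        using fun_cong[OF fun_cong[OF c(2), of p], of \<tau>] \<tau> by (simp add: pull_def)
      ultimately have "c p (lift p ?\<sigma>) = c p \<tau>" by metis
      then show "pullback n b p \<tau> = c p \<tau>"
        using \<tau> \<sigma> by (simp add: pull_def b_def)
    next
      fix p \<tau> assume "\<not> singular_simplex p (nsphere n) \<tau>"
      then show "pullback n b p \<tau> = c p \<tau>"
        by (simp add: pull_def cochains_eq_0[OF c(1)])
    qed
    show "b \<in> homog (projective_space n) q" if "c \<in> homog (nsphere n) q" for q
      using that unfolding homog_def b_def by (auto split: if_splits)
  qed
qed

text \<open>The transfer of \<open>c\<close>: its value on a simplex is the sum of the values of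
  \<open>c\<close> on the two lifts.\<close>

lemma transfer_descends:
  assumes c: "c \<in> cochains (nsphere n)"
  obtains b where "b \<in> cochains (projective_space n)" "pullback n b = c \<boxplus> flip n c"
    "\<And>q. c \<in> homog (nsphere n) q \<Longrightarrow> b \<in> homog (projective_space n) q"
proof -
  have inv: "c \<boxplus> flip n c \<in> cochains (nsphere n)" "flip n (c \<boxplus> flip n c) = c \<boxplus> flip n c"
    by (simp_all add: cochains_add c pull_cochains[OF c] pull_add flip_flip[OF c] add.commute)
  obtain b where b: "b \<in> cochains (projective_space n)" "pullback n b = c \<boxplus> flip n c"
    "\<And>q. c \<boxplus> flip n c \<in> homog (nsphere n) q \<Longrightarrow> b \<in> homog (projective_space n) q"
    by (rule invariant_cochain_descends[OF inv]) (rule that, assumption+)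
  have "b \<in> homog (projective_space n) q" if "c \<in> homog (nsphere n) q" for q
    by (intro b(3) homog_add homog_pull[OF that] that)
  with b(1,2) show thesis by (rule that)
qed

text \<open>
  If \<open>x\<^sub>i = 0\<close>, the sign of the first nonzero coordinate is taken instead, so that exactly one of two
  antipodal points is negative.
\<close>

definition neg_coord :: "nat \<Rightarrow> (nat \<Rightarrow> real) \<Rightarrow> bool" where
  "neg_coord i x \<longleftrightarrow> x i < 0 \<or> x i = 0 \<and> x (LEAST j. x j \<noteq> 0) < 0"

definition sign_cochain :: "nat \<Rightarrow> nat \<Rightarrow> (nat \<Rightarrow> real) cochain" where
  "sign_cochain n i = (\<lambda>p \<tau>. if p = 0 \<and> singular_simplex 0 (nsphere n) \<tau> \<and>
      neg_coord i (\<tau> (\<lambda>j. if j = 0 then 1 else 0)) then 1 else 0)"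

lemma neg_coord_antipode:
  assumes "x \<in> topspace (nsphere n)"
  shows "neg_coord i (antipode x) \<longleftrightarrow> \<not> neg_coord i x"
proof -
  have "\<exists>j. x j \<noteq> 0"
  proof (rule ccontr)
    assume "\<nexists>j. x j \<noteq> 0"
    then have "(\<Sum>i\<le>n. (x i)\<^sup>2) = 0" by simp
    then show False using assms by (simp add: topspace_nsphere)
  qed
  then have "x (LEAST j. x j \<noteq> 0) \<noteq> 0"
    by (rule LeastI_ex)
  then show ?thesis
    by (auto simp: neg_coord_def antipode_def)
qed

lemma sign_cochain_homog: "sign_cochain n i \<in> homog (nsphere n) 0"
  by (auto simp: homog_def sign_cochain_def split: if_splits)

text \<open>Exactly one of two antipodal points counts as negative. This identity drives the
  transfer sequence: multiplying it by a pulled back cochain writes that cochain as a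
  transfer.\<close>

lemma sign_cochain_flip: "sign_cochain n i \<boxplus> flip n (sign_cochain n i) = unit_cochain (nsphere n)"
proof (rule cochain_eqI)
  fix p \<tau> assume \<tau>: "singular_simplex p (nsphere n) \<tau>"
  show "sign_cochain n i p \<tau> + flip n (sign_cochain n i) p \<tau> = unit_cochain (nsphere n) p \<tau>"
  proof (cases "p = 0")
    case True
    let ?v = "\<lambda>j::nat. if j = 0 then 1 else 0 :: real"
    have v: "?v \<in> standard_simplex 0" by simp
    have "neg_coord i (antipode (\<tau> ?v)) \<longleftrightarrow> \<not> neg_coord i (\<tau> ?v)"
      by (rule neg_coord_antipode) (use singular_simplex_in_topspace[OF \<tau>] True v in blast)
    moreover have "simplex_map 0 antipode \<tau> ?v = antipode (\<tau> ?v)"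
      using v by (simp only: simplex_map_def restrict_apply' o_def)
    ultimately show ?thesis
      using \<tau> True singular_simplex_antipode[of 0 n \<tau>]
      by (auto simp: sign_cochain_def pull_def unit_cochain_def)
  qed (auto simp: sign_cochain_def pull_def unit_cochain_def)
next
  fix p \<tau> assume "\<not> singular_simplex p (nsphere n) \<tau>"
  then show "sign_cochain n i p \<tau> + flip n (sign_cochain n i) p \<tau> = unit_cochain (nsphere n) p \<tau>"
    by (auto simp: sign_cochain_def pull_def unit_cochain_def)
qed

lemma pullback_zero_imp:
  "a \<in> cochains (projective_space n) \<Longrightarrow> pullback n a = zero_cochain \<Longrightarrow> a = zero_cochain"
  by (rule pullback_inj[of a n]) simp_all

lemma cocycle_if_pullback_cocycle:
  assumes "a \<in> cochains (projective_space n)" "coboundary (nsphere n) (pullback n a) = zero_cochain"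
  shows "coboundary (projective_space n) a = zero_cochain"
  by (rule pullback_zero_imp[of _ n], rule cochains_coboundary[OF assms(1)])
     (simp only: assms(2) pullback_coboundary)

lemma add_eq_unit_imp: "(x::bit) + y = u \<Longrightarrow> y = x + u"
  by (cases x; cases y) auto

text \<open>The antipode changes the sign cochain only by the unit, which is a cocycle, so the
  coboundary of the sign cochain is invariant although the sign cochain is not.\<close>

lemma ex_char_cocycle:
  "\<exists>w. w \<in> homog (projective_space n) 1 \<and>
       pullback n w = coboundary (nsphere n) (sign_cochain n i)"
proof -
  let ?S = "nsphere n" and ?f = "sign_cochain n i"
  have f: "?f \<in> cochains ?S"
    by (rule homog_cochains[OF sign_cochain_homog])
  have "flip n ?f = ?f \<boxplus> unit_cochain ?S"
  proof (intro ext)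
    show "flip n ?f p \<sigma> = ?f p \<sigma> + unit_cochain ?S p \<sigma>" for p \<sigma>
      using fun_cong[OF fun_cong[OF sign_cochain_flip[of n i], of p], of \<sigma>] by (rule add_eq_unit_imp)
  qed
  then have "flip n (coboundary ?S ?f) = coboundary ?S ?f"
    by (simp add: flip_coboundary coboundary_add coboundary_unit)
  then obtain b where "b \<in> cochains (projective_space n)" "pullback n b = coboundary ?S ?f"
    "\<And>q. coboundary ?S ?f \<in> homog ?S q \<Longrightarrow> b \<in> homog (projective_space n) q"
    using invariant_cochain_descends[OF cochains_coboundary[OF f]] by metis
  moreover have "coboundary ?S ?f \<in> homog ?S 1"
    using homog_coboundary[OF sign_cochain_homog] by simp
  ultimately show ?thesis by blast
qed

text \<open>A representative of the first Stiefel-Whitney class of the double covering: on a path it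
  records whether the ends of a lift differ in sign. By \<open>pullback_inj\<close> there is only
  one such cochain.\<close>

definition char_cocycle :: "nat \<Rightarrow> nat \<Rightarrow> (nat \<Rightarrow> real) set cochain" where
  "char_cocycle n i = (SOME w. w \<in> homog (projective_space n) 1 \<and>
       pullback n w = coboundary (nsphere n) (sign_cochain n i))"

lemma char_cocycle:
  "char_cocycle n i \<in> homog (projective_space n) 1"
  "pullback n (char_cocycle n i) = coboundary (nsphere n) (sign_cochain n i)"
  using someI_ex[OF ex_char_cocycle[of n i]] unfolding char_cocycle_def by blast+

lemma char_cocycle_cochains: "char_cocycle n i \<in> cochains (projective_space n)"
  by (rule homog_cochains[OF char_cocycle(1)])

lemma coboundary_char_cocycle: "coboundary (projective_space n) (char_cocycle n i) = zero_cochain"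
  by (rule cocycle_if_pullback_cocycle[OF char_cocycle_cochains])
     (simp only: char_cocycle(2) coboundary_coboundary)

text \<open>
  Exactness of the transfer sequence of the double covering, whose connecting homomorphism is the
  cup product with the characteristic cocycle.
\<close>

lemma char_cup_cobounds_imp_transfer:
  assumes a: "a \<in> homog (projective_space n) q" "coboundary (projective_space n) a = zero_cochain"
    and b: "b \<in> cochains (projective_space n)"
      "cup (projective_space n) (char_cocycle n i) a = coboundary (projective_space n) b"
  obtains z where "z \<in> homog (nsphere n) q" "coboundary (nsphere n) z = zero_cochain"
    "z \<boxplus> flip n z = pullback n a"
proof -
  let ?S = "nsphere n" and ?f = "sign_cochain n i"
  \<comment> \<open>The two summands have the same coboundary by the choice of \<open>b\<close>, so
    \<open>z\<close> is a cocycle; in the transfer the second summand cancels and the first leaves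
    the unit times the pullback of \<open>a\<close>.\<close>
  define z where "z = cup ?S ?f (pullback n a) \<boxplus> pullback n b"
  have f: "?f \<in> cochains ?S"
    by (rule homog_cochains[OF sign_cochain_homog])
  have ac: "a \<in> cochains (projective_space n)"
    by (rule homog_cochains[OF a(1)])
  have zc: "z \<in> cochains ?S"
    unfolding z_def by (intro cochains_add cochains_cup f pull_cochains[OF b(1)] pull_cochains[OF ac])
  have "coboundary ?S z = cup ?S (coboundary ?S ?f) (pullback n a) \<boxplus>
      cup ?S ?f (coboundary ?S (pullback n a)) \<boxplus> coboundary ?S (pullback n b)"
    by (simp add: z_def coboundary_add coboundary_cup)
  also have "\<dots> = pullback n (cup (projective_space n) (char_cocycle n i) a) \<boxplus>
      pullback n (coboundary (projective_space n) b)"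
    by (simp add: pullback_cup pullback_coboundary[symmetric] char_cocycle a(2) cup_zero)
  also have "\<dots> = zero_cochain"
    by (simp add: b(2))
  finally have dz: "coboundary ?S z = zero_cochain" .
  have "flip n z = cup ?S (flip n ?f) (pullback n a) \<boxplus> pullback n b"
    by (simp add: z_def pull_add flip_cup)
  then have "z \<boxplus> flip n z = cup ?S ?f (pullback n a) \<boxplus> cup ?S (flip n ?f) (pullback n a)"
    by (simp only: z_def bit_add_cancel)
  also have "\<dots> = cup ?S (?f \<boxplus> flip n ?f) (pullback n a)"
    by (simp only: cup_add_left)
  finally have tz: "z \<boxplus> flip n z = pullback n a"
    by (simp add: sign_cochain_flip cup_unit_left[OF pull_cochains[OF ac]])
  show thesis
  proof
    \<comment> \<open>The primitive \<open>b\<close> may have parts in other degrees, so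
      \<open>z\<close> is cut down to degree \<open>q\<close>; all equations respect
      degrees.\<close>
    show "component q z \<in> homog ?S q"
      by (rule homog_component[OF zc])
    show "coboundary ?S (component q z) = zero_cochain"
      by (simp add: component_coboundary dz)
    have "component q z \<boxplus> flip n (component q z) = component q (pullback n a)"
      by (simp only: component_pull[symmetric] component_add[symmetric] tz)
    then show "component q z \<boxplus> flip n (component q z) = pullback n a"
      by (simp add: component_homog[OF homog_pull[OF a(1)]])
  qed
qed

text \<open>The transfer commutes with the coboundary and the pullback is injective, so the transfer
  of \<open>y\<close> is a primitive of \<open>a\<close>.\<close>

lemma transfer_of_coboundary:
  assumes a: "a \<in> cochains (projective_space n)"
    and y: "y \<in> cochains (nsphere n)"
    and eq: "coboundary (nsphere n) y \<boxplus> flip n (coboundary (nsphere n) y) = pullback n a"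
  obtains t where "t \<in> cochains (projective_space n)" "a = coboundary (projective_space n) t"
proof -
  obtain t where t: "t \<in> cochains (projective_space n)" "pullback n t = y \<boxplus> flip n y"
    by (rule transfer_descends[OF y])
  have "pullback n (coboundary (projective_space n) t) = pullback n a"
    by (simp add: pullback_coboundary t(2) coboundary_add flip_coboundary[symmetric] eq)
  then have "a = coboundary (projective_space n) t"
    using pullback_inj[OF a cochains_coboundary[OF t(1)]] by simp
  then show thesis using t(1) that by blast
qed

text \<open>Exactness at the cohomology of projective space. The transfer \<open>a\<close> of
  \<open>v\<close> is a cocycle because the coboundary of \<open>v\<close> is invariant; it lowers
  the degree by one.\<close>

lemma pullback_cobounds_imp_char_cup:
  assumes u: "u \<in> homog (projective_space n) (Suc q)"
    and v: "v \<in> homog (nsphere n) q" "pullback n u = coboundary (nsphere n) v"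
  obtains a b where "a \<in> homog (projective_space n) q"
    "coboundary (projective_space n) a = zero_cochain" "b \<in> cochains (projective_space n)"
    "u = cup (projective_space n) (char_cocycle n i) a \<boxplus> coboundary (projective_space n) b"
proof -
  let ?S = "nsphere n" and ?f = "sign_cochain n i" and ?P = "projective_space n"
  have f: "?f \<in> cochains ?S"
    by (rule homog_cochains[OF sign_cochain_homog])
  have vc: "v \<in> cochains ?S"
    by (rule homog_cochains[OF v(1)])
  obtain a where ac: "a \<in> cochains ?P" and a: "pullback n a = v \<boxplus> flip n v" "a \<in> homog ?P q"
    using transfer_descends[OF vc] v(1) by metis
  have "coboundary ?S (pullback n a) = pullback n u \<boxplus> flip n (pullback n u)"
    by (simp add: a(1) coboundary_add flip_coboundary[symmetric] v(2))
  then have "coboundary ?S (pullback n a) = zero_cochain"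
    by (simp only: flip_pullback cochain_add_same)
  then have da: "coboundary ?P a = zero_cochain"
    by (rule cocycle_if_pullback_cocycle[OF ac])
  \<comment> \<open>Under the antipode the product changes by \<open>v \<boxplus> flip n v\<close>,
    and so does \<open>v\<close>; hence the sum is invariant and descends to the correction term
    \<open>b\<close>.\<close>
  define g where "g = cup ?S ?f (pullback n a) \<boxplus> v"
  have gc: "g \<in> cochains ?S"
    unfolding g_def by (intro cochains_add cochains_cup f pull_cochains[OF ac] vc)
  have "g \<boxplus> flip n g = cup ?S (?f \<boxplus> flip n ?f) (pullback n a) \<boxplus> (v \<boxplus> flip n v)"
    by (simp add: g_def pull_add flip_cup cup_add_left ac_simps)
  moreover have "cup ?S (?f \<boxplus> flip n ?f) (pullback n a) = v \<boxplus> flip n v"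
    by (simp only: sign_cochain_flip cup_unit_left[OF pull_cochains[OF ac]]) (rule a(1))
  ultimately have "g \<boxplus> flip n g = zero_cochain"
    by simp
  then have "flip n g = g"
    by (rule cochain_add_eq_0_iff[THEN iffD1, THEN sym])
  from gc this obtain b where b: "b \<in> cochains ?P" "pullback n b = g"
    by (rule invariant_cochain_descends)
  have e1: "pullback n (cup ?P (char_cocycle n i) a \<boxplus> coboundary ?P b) =
      cup ?S (coboundary ?S ?f) (pullback n a) \<boxplus> coboundary ?S g"
    by (simp only: pull_add pullback_cup pullback_coboundary b(2) char_cocycle(2))
  have e2: "coboundary ?S g = cup ?S (coboundary ?S ?f) (pullback n a) \<boxplus>
       cup ?S ?f (pullback n (coboundary ?P a)) \<boxplus> pullback n u"
    by (simp only: g_def coboundary_add coboundary_cup v(2) pullback_coboundary)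
  have e3: "cup ?S ?f (pullback n (coboundary ?P a)) = zero_cochain"
    by (simp only: da pull_zero cup_zero)
  have "pullback n (cup ?P (char_cocycle n i) a \<boxplus> coboundary ?P b) = pullback n u"
    unfolding e1 e2 e3 by (simp flip: add.assoc)
  then have "u = cup ?P (char_cocycle n i) a \<boxplus> coboundary ?P b"
    by (intro pullback_inj[OF homog_cochains[OF u]] cochains_add cochains_cup char_cocycle_cochains
        ac cochains_coboundary b(1)) (rule sym)
  with a(2) da b(1) show thesis
    by (rule that)
qed

section \<open>Nilpotency of the characteristic class\<close>

definition cobounds :: "nat \<Rightarrow> (nat \<Rightarrow> real) set cochain \<Rightarrow> bool" where
  "cobounds n a \<longleftrightarrow> a \<in> coboundary (projective_space n) ` cochains (projective_space n)"

lemma cobounds_add: "cobounds n a \<Longrightarrow> cobounds n b \<Longrightarrow> cobounds n (a \<boxplus> b)"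
  unfolding cobounds_def
proof (elim imageE)
  fix x y assume *: "a = coboundary (projective_space n) x" "b = coboundary (projective_space n) y"
    "x \<in> cochains (projective_space n)" "y \<in> cochains (projective_space n)"
  show "a \<boxplus> b \<in> coboundary (projective_space n) ` cochains (projective_space n)"
    by (rule image_eqI[of _ _ "x \<boxplus> y"]) (simp_all only: * coboundary_add cochains_add)
qed

lemma cobounds_cup_left:
  assumes "cobounds n a" "b \<in> cochains (projective_space n)" "coboundary (projective_space n) b = zero_cochain"
  shows "cobounds n (cup (projective_space n) a b)"
proof -
  obtain x where x: "a = coboundary (projective_space n) x" "x \<in> cochains (projective_space n)"
    using assms(1) by (auto simp: cobounds_def)
  have "coboundary (projective_space n) (cup (projective_space n) x b) = cup (projective_space n) a b"
    by (simp add: coboundary_cup assms(3) cup_zero x(1))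
  then show ?thesis
    unfolding cobounds_def using cochains_cup[OF x(2) assms(2)] by (metis imageI)
qed

lemma cobounds_cup_right:
  assumes "cobounds n a" "b \<in> cochains (projective_space n)" "coboundary (projective_space n) b = zero_cochain"
  shows "cobounds n (cup (projective_space n) b a)"
proof -
  obtain x where x: "a = coboundary (projective_space n) x" "x \<in> cochains (projective_space n)"
    using assms(1) by (auto simp: cobounds_def)
  have "coboundary (projective_space n) (cup (projective_space n) b x) = cup (projective_space n) b a"
    by (simp add: coboundary_cup assms(3) cup_zero x(1))
  then show ?thesis
    unfolding cobounds_def using cochains_cup[OF assms(2) x(2)] by (metis imageI)
qed

section \<open>Powers of the class and products of its representatives\<close>

primrec char_power :: "nat \<Rightarrow> nat \<Rightarrow> (nat \<Rightarrow> real) set cochain" where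
  "char_power n 0 = unit_cochain (projective_space n)"
| "char_power n (Suc q) = cup (projective_space n) (char_cocycle n 0) (char_power n q)"

text \<open>Each factor uses the sign of a different coordinate, so that the product vanishes
  wherever one of these coordinates is nonzero.\<close>

primrec char_prod :: "nat \<Rightarrow> nat \<Rightarrow> (nat \<Rightarrow> real) set cochain" where
  "char_prod n 0 = unit_cochain (projective_space n)"
| "char_prod n (Suc q) = cup (projective_space n) (char_cocycle n q) (char_prod n q)"

lemma char_power_homog: "char_power n q \<in> homog (projective_space n) q"
proof (induction q)
  case (Suc q)
  show ?case
    using homog_cup[OF char_cocycle(1) Suc] by simp
qed (simp add: homog_unit)

lemma char_power_cochains: "char_power n q \<in> cochains (projective_space n)"
  by (rule homog_cochains[OF char_power_homog])

lemma coboundary_char_power: "coboundary (projective_space n) (char_power n q) = zero_cochain"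
  by (induction q) (simp_all add: coboundary_unit coboundary_cup coboundary_char_cocycle cup_zero)

lemma char_prod_homog: "char_prod n q \<in> homog (projective_space n) q"
proof (induction q)
  case (Suc q)
  show ?case
    using homog_cup[OF char_cocycle(1) Suc] by simp
qed (simp add: homog_unit)

lemma coboundary_char_prod: "coboundary (projective_space n) (char_prod n q) = zero_cochain"
  by (induction q) (simp_all add: coboundary_unit coboundary_cup coboundary_char_cocycle cup_zero)

lemma char_power_add:
  "cup (projective_space n) (char_power n i) (char_power n j) = char_power n (i + j)"
  by (induction i) (simp_all add: cup_unit_left[OF char_power_cochains] cup_assoc)

lemma cup_homog_eval:
  assumes "a \<in> homog X i" "b \<in> homog X j" "singular_simplex (i + j) X \<sigma>"
  shows "cup X a b (i + j) \<sigma> = a i (simplex_op i (\<lambda>l. l) \<sigma>) * b j (simplex_op j (\<lambda>l. l + i) \<sigma>)"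
proof -
  have "cup X a b (i + j) \<sigma> = (\<Sum>p\<in>{i}. a p (simplex_op p (\<lambda>l. l) \<sigma>) *
      b (i + j - p) (simplex_op (i + j - p) (\<lambda>l. l + p) \<sigma>))"
    unfolding cup_eq[OF assms(3)]
    by (rule sum.mono_neutral_right) (auto simp: homog_eq_0[OF assms(1)])
  then show ?thesis by simp
qed

lemma sign_cochain_flip_eq: "flip n (sign_cochain n i) p \<sigma> =
    sign_cochain n i p \<sigma> + unit_cochain (nsphere n) p \<sigma>"
  using fun_cong[OF fun_cong[OF sign_cochain_flip[of n i], of p], of \<sigma>] by (rule add_eq_unit_imp)

text \<open>The antipode adds the unit to each sign cochain, so the sum of two of them is invariant
  and descends to a primitive.\<close>

lemma char_cocycles_cohomologous: "cobounds n (char_cocycle n i \<boxplus> char_cocycle n j)"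
proof -
  let ?g = "sign_cochain n i \<boxplus> sign_cochain n j"
  have g: "?g \<in> cochains (nsphere n)"
    by (intro cochains_add homog_cochains[OF sign_cochain_homog])
  have "flip n ?g = ?g"
    by (intro ext) (simp add: pull_add sign_cochain_flip_eq bit_add_cancel)
  with g obtain b where b: "b \<in> cochains (projective_space n)" "pullback n b = ?g"
    by (rule invariant_cochain_descends)
  have "pullback n (char_cocycle n i \<boxplus> char_cocycle n j) = pullback n (coboundary (projective_space n) b)"
    by (simp only: pull_add char_cocycle(2) pullback_coboundary b(2) coboundary_add)
  then have "char_cocycle n i \<boxplus> char_cocycle n j = coboundary (projective_space n) b"
    by (rule pullback_inj[OF cochains_add[OF char_cocycle_cochains char_cocycle_cochains]
          cochains_coboundary[OF b(1)]])
  then show ?thesis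
    unfolding cobounds_def using b(1) by (rule image_eqI)
qed

lemma char_power_cohomologous_char_prod: "cobounds n (char_power n q \<boxplus> char_prod n q)"
proof (induction q)
  case 0
  have "coboundary (projective_space n) zero_cochain \<in> coboundary (projective_space n) ` cochains (projective_space n)"
    by (rule imageI) simp
  then show ?case
    by (simp add: cobounds_def coboundary_zero)
next
  case (Suc q)
  let ?P = "projective_space n"
  let ?w = "char_cocycle n 0" and ?v = "char_cocycle n q"
  \<comment> \<open>One factor is exchanged at a time: the mixed product of \<open>?w\<close> and
    \<open>char_prod n q\<close> appears twice and cancels.\<close>
  have "cobounds n (cup ?P ?w (char_power n q \<boxplus> char_prod n q) \<boxplus> cup ?P (?w \<boxplus> ?v) (char_prod n q))"
    by (intro cobounds_add cobounds_cup_right[OF Suc] cobounds_cup_left[OF char_cocycles_cohomologous]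
        char_cocycle_cochains coboundary_char_cocycle homog_cochains[OF char_prod_homog] coboundary_char_prod)
  also have "cup ?P ?w (char_power n q \<boxplus> char_prod n q) \<boxplus> cup ?P (?w \<boxplus> ?v) (char_prod n q) =
      char_power n (Suc q) \<boxplus> char_prod n (Suc q)"
    by (simp add: cup_add_left cup_add_right add.assoc)
  finally show ?case .
qed

definition coord_open :: "nat \<Rightarrow> nat \<Rightarrow> (nat \<Rightarrow> real) set set" where
  "coord_open n i = {C \<in> topspace (projective_space n). coord_prod i i C \<noteq> 0}"

definition vanishes_on :: "'a set \<Rightarrow> 'a cochain \<Rightarrow> bool" where
  "vanishes_on U c \<longleftrightarrow> (\<forall>p \<sigma>. \<sigma> \<in> standard_simplex p \<rightarrow> U \<longrightarrow> c p \<sigma> = 0)"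

lemma simplex_op_in_subset:
  assumes "\<theta> \<in> {..p} \<rightarrow> {..q}" "\<sigma> \<in> standard_simplex q \<rightarrow> U"
  shows "simplex_op p \<theta> \<sigma> \<in> standard_simplex p \<rightarrow> U"
  using affine_push_in_standard_simplex[OF assms(1)] assms(2) by (auto simp: simplex_op_def Pi_iff)

lemma vanishes_on_cup:
  assumes "vanishes_on U a \<or> vanishes_on U b"
  shows "vanishes_on U (cup X a b)"
  unfolding vanishes_on_def
proof (intro allI impI)
  fix n \<sigma> assume \<sigma>: "\<sigma> \<in> standard_simplex n \<rightarrow> U"
  show "cup X a b n \<sigma> = 0"
  proof (cases "singular_simplex n X \<sigma>")
    case True
    have "a p (simplex_op p (\<lambda>i. i) \<sigma>) * b (n - p) (simplex_op (n - p) (\<lambda>i. i + p) \<sigma>) = 0" if "p \<le> n" for p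
    proof -
      have "simplex_op p (\<lambda>i. i) \<sigma> \<in> standard_simplex p \<rightarrow> U"
        "simplex_op (n - p) (\<lambda>i. i + p) \<sigma> \<in> standard_simplex (n - p) \<rightarrow> U"
        using that by (auto intro!: simplex_op_in_subset[OF _ \<sigma>])
      then show ?thesis
        using assms unfolding vanishes_on_def by (metis mult_zero_left mult_zero_right)
    qed
    then show ?thesis
      unfolding cup_eq[OF True] by (intro sum.neutral) auto
  qed (rule cup_not_simplex)
qed

text \<open>A lift of a path avoiding the hyperplane \<open>x\<^sub>i = 0\<close> stays on one side of it.\<close>

lemma vanishes_on_char_cocycle: "vanishes_on (coord_open n i) (char_cocycle n i)"
  unfolding vanishes_on_def
proof (intro allI impI)
  fix p \<sigma> assume \<sigma>: "\<sigma> \<in> standard_simplex p \<rightarrow> coord_open n i"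
  show "char_cocycle n i p \<sigma> = 0"
  proof (cases "p = 1 \<and> singular_simplex 1 (projective_space n) \<sigma>")
    case False
    then show ?thesis
      using homog_eq_0[OF char_cocycle(1)] cochains_eq_0[OF char_cocycle_cochains] by metis
  next
    case True
    then have p: "p = Suc 0" and "singular_simplex p (projective_space n) \<sigma>" by auto
    then obtain \<tau> where \<tau>: "singular_simplex p (nsphere n) \<tau>" "simplex_map p antipodal_class \<tau> = \<sigma>"
      using simplex_lift_exists by metis
    have nz: "\<tau> t i \<noteq> 0" if t: "t \<in> standard_simplex p" for t
    proof -
      have "\<sigma> t = antipodal_class (\<tau> t)"
        using \<tau>(2) t by (auto simp: simplex_map_def)
      moreover have "\<sigma> t \<in> coord_open n i"
        using \<sigma> t by auto
      ultimately show ?thesis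
        by (simp add: coord_open_def coord_prod_antipodal_class)
    qed
    have cont: "continuous_on (standard_simplex p) (\<lambda>t. \<tau> t i)"
      by (rule continuous_on_singular_simplex_real[OF \<tau>(1) continuous_map_nsphere_projection])
    have "connected ((\<lambda>t. \<tau> t i) ` standard_simplex p)"
      by (rule connected_continuous_image[OF cont connected_standard_simplex])
    then have sign: "\<tau> s i < 0 \<longleftrightarrow> \<tau> t i < 0" if st: "s \<in> standard_simplex p" "t \<in> standard_simplex p" for s t
    proof (rule_tac ccontr)
      assume conn: "connected ((\<lambda>t. \<tau> t i) ` standard_simplex p)" and "(\<tau> s i < 0) \<noteq> (\<tau> t i < 0)"
      then have "\<tau> s i \<le> 0 \<and> 0 \<le> \<tau> t i \<or> \<tau> t i \<le> 0 \<and> 0 \<le> \<tau> s i" by auto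
      then have "0 \<in> (\<lambda>t. \<tau> t i) ` standard_simplex p"
        using connectedD_interval[OF conn] imageI[OF st(1), of "\<lambda>t. \<tau> t i"] imageI[OF st(2), of "\<lambda>t. \<tau> t i"]
        by blast
      then show False using nz by auto
    qed
    have face: "simplex_op 0 (skip k) \<tau> (\<lambda>j. if j = 0 then 1 else 0) =
        \<tau> (affine_push 0 (skip k) (\<lambda>j. if j = 0 then 1 else 0))" for k
      by (simp add: simplex_op_def)
    have mem: "affine_push 0 (skip k) (\<lambda>j. if j = 0 then 1 else 0) \<in> standard_simplex p" for k
      unfolding p by (rule affine_push_in_standard_simplex) (auto simp: skip_def)
    have neg: "neg_coord i (simplex_op 0 (skip k) \<tau> (\<lambda>j. if j = 0 then 1 else 0)) \<longleftrightarrow>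
        neg_coord i (simplex_op 0 (skip l) \<tau> (\<lambda>j. if j = 0 then 1 else 0))" for k l
      unfolding face neg_coord_def using nz[OF mem] sign[OF mem mem, of k l] by simp
    have sing: "singular_simplex 0 (nsphere n) (simplex_op 0 (skip k) \<tau>)" if "k \<le> 1" for k
      using simplex_op_skip_singular[of 0 "nsphere n" \<tau> k] \<tau>(1) that p by simp
    have "sign_cochain n i 0 (simplex_op 0 (skip 0) \<tau>) = sign_cochain n i 0 (simplex_op 0 (skip 1) \<tau>)"
      using neg[of 0 1] sing[of 0] sing[of 1] by (simp add: sign_cochain_def)
    then have "coboundary (nsphere n) (sign_cochain n i) p \<tau> = 0"
      using \<tau>(1) unfolding p by (simp add: coboundary_Suc)
    then have "pullback n (char_cocycle n i) p \<tau> = 0"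
      by (simp only: char_cocycle(2))
    then show ?thesis
      using \<tau> by (simp add: pull_def)
  qed
qed

lemma vanishes_on_char_prod: "i < q \<Longrightarrow> vanishes_on (coord_open n i) (char_prod n q)"
proof (induction q)
  case (Suc q)
  then have "vanishes_on (coord_open n i) (char_cocycle n q) \<or> vanishes_on (coord_open n i) (char_prod n q)"
    using vanishes_on_char_cocycle by (cases "i = q") auto
  then show ?case
    by (simp add: vanishes_on_cup)
qed simp

lemma char_prod_top_cobounds: "cobounds n (char_prod n (Suc n))"
proof -
  have "openin (projective_space n) (coord_open n i)" for i
    using openin_continuous_map_preimage[OF continuous_map_coord_prod, of "- {0}"]
    by (simp add: coord_open_def open_Compl)
  then have 1: "openin (projective_space n) U" if "U \<in> coord_open n ` {..n}" for U
    using that by auto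
  have 2: "topspace (projective_space n) \<subseteq> \<Union>(coord_open n ` {..n})"
  proof
    fix C assume C: "C \<in> topspace (projective_space n)"
    then obtain x where x: "x \<in> topspace (nsphere n)" "C = antipodal_class x"
      by (auto simp: topspace_projective_space)
    have "\<exists>i\<le>n. x i \<noteq> 0"
    proof (rule ccontr)
      assume "\<not> (\<exists>i\<le>n. x i \<noteq> 0)"
      then have "(\<Sum>i\<le>n. (x i)\<^sup>2) = 0" by simp
      then show False using x(1) by (simp add: topspace_nsphere)
    qed
    then show "C \<in> \<Union>(coord_open n ` {..n})"
      using C x(2) by (auto simp: coord_open_def coord_prod_antipodal_class)
  qed
  have 3: "char_prod n (Suc n) (Suc n) \<sigma> = 0"
    if U: "U \<in> coord_open n ` {..n}" "\<sigma> \<in> standard_simplex (Suc n) \<rightarrow> U" for U \<sigma>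
  proof -
    obtain i where "i \<le> n" "U = coord_open n i" using U(1) by auto
    then show ?thesis
      using vanishes_on_char_prod[of i "Suc n" n] U(2) unfolding vanishes_on_def by simp
  qed
  obtain b where "b \<in> homog (projective_space n) n" "char_prod n (Suc n) = coboundary (projective_space n) b"
    by (rule small_cocycle_cobounds[OF char_prod_homog coboundary_char_prod 1 2 3])
  then show ?thesis
    unfolding cobounds_def using homog_cochains by blast
qed

lemma char_power_top_cobounds: "cobounds n (char_power n (Suc n))"
proof -
  have "cobounds n (char_power n (Suc n) \<boxplus> char_prod n (Suc n) \<boxplus> char_prod n (Suc n))"
    by (rule cobounds_add[OF char_power_cohomologous_char_prod char_prod_top_cobounds])
  then show ?thesis
    by (simp only: add.assoc bit_add_same add_0_right)
qed

section \<open>The cohomology ring of projective space\<close>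

text \<open>The difference of two points is killed by the map to a point, so it lies in reduced
  homology, which is trivial in degree 0 for \<open>n > 0\<close>. It therefore bounds, and the
  cocycle vanishes on it.\<close>

lemma nsphere_zero_cocycle_const:
  assumes n: "0 < n" and dz: "coboundary (nsphere n) z = zero_cochain"
    and \<tau>: "singular_simplex 0 (nsphere n) \<tau>" and \<tau>': "singular_simplex 0 (nsphere n) \<tau>'"
  shows "z 0 \<tau> = z 0 \<tau>'"
proof -
  let ?S = "nsphere n" and ?pt = "discrete_topology {()}"
  define c where "c = frag_of \<tau> - frag_of \<tau>'"
  have c: "singular_relcycle 0 ?S {} c"
    unfolding singular_cycle using \<tau> \<tau>'
    by (simp add: c_def singular_chain_diff singular_chain_of chain_boundary_def)
  have "simplex_map 0 (\<lambda>x. ()) \<tau> = simplex_map 0 (\<lambda>x. ()) \<tau>'"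
    by (auto simp: simplex_map_def)
  then have "chain_map 0 (\<lambda>x. ()) c = 0"
    unfolding c_def chain_map_diff chain_map_of by simp
  moreover have "continuous_map ?S ?pt (\<lambda>x. ())"
    by simp
  ultimately have "hom_induced (int 0) ?S {} ?pt {} (\<lambda>x. ()) (homologous_rel_set 0 ?S {} c) =
      homologous_rel_set 0 ?pt {} 0"
    using hom_induced_chain_map[of ?S ?pt "\<lambda>x. ()" "{}" "{}" 0 c] c by simp
  also have "\<dots> = singular_relboundary_set 0 ?pt {}"
    unfolding homologous_rel_set_eq_relboundary by simp
  finally have "homologous_rel_set 0 ?S {} c \<in> carrier (reduced_homology_group (int 0) ?S)"
    unfolding carrier_reduced_homology_group kernel_def
    using homologous_rel_set_in_homology_group[OF c] by (simp only: one_relative_homology_group mem_Collect_eq)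
  moreover have "trivial_group (reduced_homology_group (int 0) ?S)"
    by (rule reduced_homology_group_nsphere(2)) (use n in simp)
  ultimately have "homologous_rel_set 0 ?S {} c = \<one>\<^bsub>homology_group (int 0) ?S\<^esub>"
    by (simp only: trivial_group_def one_reduced_homology_group singleton_iff)
  then have "singular_relboundary 0 ?S {} c"
    by (simp only: one_relative_homology_group homologous_rel_set_eq_relboundary)
  then have "ceval (z 0) c = 0"
    by (rule ceval_relboundary[OF dz])
  then show ?thesis
    by (simp add: c_def ceval_diff bit_add_eq_0_iff)
qed

text \<open>For \<open>n = 0\<close> the sphere is not connected, but its two points are antipodal
  and have the same image, so a pulled back cochain still cannot separate them.\<close>

lemma pullback_zero_cocycle_const:
  assumes u: "coboundary (projective_space n) u = zero_cochain"
    and \<tau>: "singular_simplex 0 (nsphere n) \<tau>" and \<tau>': "singular_simplex 0 (nsphere n) \<tau>'"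
  shows "pullback n u 0 \<tau> = pullback n u 0 \<tau>'"
proof (cases "n = 0")
  case False
  have "coboundary (nsphere n) (pullback n u) = zero_cochain"
    by (simp only: pullback_coboundary[symmetric] u pull_zero)
  then show ?thesis
    using nsphere_zero_cocycle_const[OF _ _ \<tau> \<tau>'] False by blast
next
  case True
  let ?v = "\<lambda>j::nat. if j = 0 then 1 else 0 :: real"
  have v: "?v \<in> standard_simplex 0" by simp
  have "\<tau> ?v \<in> topspace (nsphere 0)" "\<tau>' ?v \<in> topspace (nsphere 0)"
    using singular_simplex_in_topspace[OF \<tau> v] singular_simplex_in_topspace[OF \<tau>' v] True by simp_all
  then have x: "(\<tau> ?v 0)\<^sup>2 = 1" "(\<tau>' ?v 0)\<^sup>2 = 1" "\<forall>i>0. \<tau> ?v i = 0" "\<forall>i>0. \<tau>' ?v i = 0"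
    unfolding topspace_nsphere by simp_all
  have "\<tau> ?v = \<tau>' ?v \<or> \<tau> ?v = antipode (\<tau>' ?v)"
  proof (cases "\<tau> ?v 0 = \<tau>' ?v 0")
    case True
    have "\<tau> ?v = \<tau>' ?v"
    proof
      show "\<tau> ?v i = \<tau>' ?v i" for i using True x(3,4) by (cases "i = 0") auto
    qed
    then show ?thesis ..
  next
    case False
    then have "\<tau> ?v 0 = - \<tau>' ?v 0"
      using x(1,2) unfolding power2_eq_1_iff by argo
    then have "\<tau> ?v i = antipode (\<tau>' ?v) i" for i
      using x(3,4) by (cases "i = 0") (simp_all add: antipode_def)
    then show ?thesis by blast
  qed
  then have "antipodal_class (\<tau> ?v) = antipodal_class (\<tau>' ?v)"
    by (simp only: antipodal_class_eq_iff)
  then have "simplex_map 0 antipodal_class \<tau> = simplex_map 0 antipodal_class \<tau>'"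
    by (intro ext) (simp add: simplex_map_def standard_simplex_0)
  then show ?thesis
    using \<tau> \<tau>' by (simp add: pull_def)
qed

lemma ex_singular_0_simplex: "\<exists>\<tau>. singular_simplex 0 (nsphere n) \<tau>"
proof -
  let ?x = "\<lambda>j::nat. if j = 0 then 1 else 0 :: real"
  have "continuous_map (subtopology (powertop_real UNIV) (standard_simplex 0)) (nsphere n) (\<lambda>_. ?x)"
    using in_topspace_nsphere[of n] by simp
  then have "continuous_map (subtopology (powertop_real UNIV) (standard_simplex 0)) (nsphere n)
      (restrict (\<lambda>_. ?x) (standard_simplex 0))"
    by (rule continuous_map_eq) simp
  then have "singular_simplex 0 (nsphere n) (restrict (\<lambda>_. ?x) (standard_simplex 0))"
    by (simp add: singular_simplex_def)
  then show ?thesis by blast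
qed

lemma projective_zero_cocycle:
  assumes u: "u \<in> homog (projective_space n) 0" "coboundary (projective_space n) u = zero_cochain"
  shows "u = zero_cochain \<or> u = unit_cochain (projective_space n)"
proof -
  obtain \<tau>0 where \<tau>0: "singular_simplex 0 (nsphere n) \<tau>0"
    using ex_singular_0_simplex by blast
  have const: "pullback n u 0 \<tau> = pullback n u 0 \<tau>0" if "singular_simplex 0 (nsphere n) \<tau>" for \<tau>
    by (rule pullback_zero_cocycle_const[OF u(2) that \<tau>0])
  have h: "pullback n u \<in> homog (nsphere n) 0"
    by (rule homog_pull[OF u(1)])
  have uc: "u \<in> cochains (projective_space n)"
    by (rule homog_cochains[OF u(1)])
  show ?thesis
  proof (cases "pullback n u 0 \<tau>0")
    case zero
    have "pullback n u p \<tau> = 0" for p \<tau>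
      using const[of \<tau>] zero homog_eq_0[OF h, of p] cochains_eq_0[OF homog_cochains[OF h], of 0 \<tau>]
      by (cases "p = 0"; cases "singular_simplex 0 (nsphere n) \<tau>") auto
    then have "u = zero_cochain"
      by (intro pullback_zero_imp[OF uc] ext)
    then show ?thesis ..
  next
    case one
    have "pullback n u p \<tau> = unit_cochain (nsphere n) p \<tau>" for p \<tau>
      using const[of \<tau>] one homog_eq_0[OF h, of p] cochains_eq_0[OF homog_cochains[OF h], of 0 \<tau>]
      by (cases "p = 0"; cases "singular_simplex 0 (nsphere n) \<tau>") (auto simp: unit_cochain_def)
    then have "pullback n u = pullback n (unit_cochain (projective_space n))"
      unfolding pull_unit[OF continuous_map_antipodal_class] by (intro ext)
    then have "u = unit_cochain (projective_space n)"
      by (rule pullback_inj[OF uc cochains_unit])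
    then show ?thesis ..
  qed
qed

text \<open>A class killed by \<open>w\<close> is the transfer of a sphere class of the same degree
  \<open>q\<close>. For \<open>q \<noteq> n\<close> this sphere class is trivial or, in degree 0,
  constant with transfer zero. Degrees above \<open>n\<close> are included, which the vanishing
  there requires.\<close>

lemma cobounds_if_char_cup_cobounds:
  assumes a: "a \<in> homog (projective_space n) q" "coboundary (projective_space n) a = zero_cochain"
    and q: "q \<noteq> n" and cob: "cobounds n (cup (projective_space n) (char_cocycle n 0) a)"
  shows "cobounds n a"
proof -
  obtain b where "b \<in> cochains (projective_space n)"
    "cup (projective_space n) (char_cocycle n 0) a = coboundary (projective_space n) b"
    using cob unfolding cobounds_def by blast
  with a obtain z where z: "z \<in> homog (nsphere n) q" "coboundary (nsphere n) z = zero_cochain"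
    "z \<boxplus> flip n z = pullback n a"
    by (rule char_cup_cobounds_imp_transfer)
  have ac: "a \<in> cochains (projective_space n)"
    by (rule homog_cochains[OF a(1)])
  obtain y where y: "y \<in> cochains (nsphere n)"
    "coboundary (nsphere n) y \<boxplus> flip n (coboundary (nsphere n) y) = pullback n a"
  proof (cases q)
    case (Suc p)
    then obtain y where "y \<in> homog (nsphere n) p" "z = coboundary (nsphere n) y"
      using nsphere_cocycle_cobounds_off_top[of z n p] z q by metis
    then show thesis
      using that z(3) homog_cochains by blast
  next
    case 0
    have "flip n z p \<tau> = z p \<tau>" for p \<tau>
    proof (cases "p = 0 \<and> singular_simplex p (nsphere n) \<tau>")
      case True
      then show ?thesis
        using nsphere_zero_cocycle_const[OF _ z(2) singular_simplex_antipode[of 0 n \<tau>], of \<tau>] 0 q True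
        by (simp add: pull_def)
    next
      case False
      then show ?thesis
        using homog_eq_0[OF z(1), of p] 0 cochains_eq_0[OF homog_cochains[OF z(1)], of p]
          homog_eq_0[OF homog_pull[OF z(1)], of p "nsphere n" antipode]
        by (auto simp: pull_def)
    qed
    then have "pullback n a = zero_cochain"
      unfolding z(3)[symmetric] by simp
    then show thesis
      using that[of zero_cochain] by (simp add: coboundary_zero)
  qed
  obtain t where "t \<in> cochains (projective_space n)" "a = coboundary (projective_space n) t"
    by (rule transfer_of_coboundary[OF ac y])
  then show ?thesis
    unfolding cobounds_def by blast
qed

lemma homog_char_power_cup:
  assumes "u \<in> homog (projective_space n) q" "coboundary (projective_space n) u = zero_cochain"
  shows "cup (projective_space n) (char_power n m) u \<in> homog (projective_space n) (m + q)"
    "coboundary (projective_space n) (cup (projective_space n) (char_power n m) u) = zero_cochain"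
  using homog_cup[OF char_power_homog assms(1)]
  by (simp_all add: coboundary_cup coboundary_char_power assms(2) cup_zero)

text \<open>The product of \<open>u\<close> with \<open>w^(n+1)\<close> bounds because that power
  does. All intermediate degrees exceed \<open>n\<close>, so the factors \<open>w\<close> can be
  cancelled one by one.\<close>

lemma cocycle_above_top_cobounds:
  assumes u: "u \<in> homog (projective_space n) q" "coboundary (projective_space n) u = zero_cochain"
    and q: "n < q"
  shows "cobounds n u"
proof -
  have uc: "u \<in> cochains (projective_space n)"
    by (rule homog_cochains[OF u(1)])
  have "cobounds n (cup (projective_space n) (char_power n m) u) \<Longrightarrow> cobounds n u" for m
  proof (induction m)
    case 0
    then show ?case by (simp add: cup_unit_left[OF uc])
  next
    case (Suc m)
    have "cobounds n (cup (projective_space n) (char_power n m) u)"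
      by (rule cobounds_if_char_cup_cobounds[OF homog_char_power_cup[OF u]])
         (use q Suc.prems in \<open>simp_all add: cup_assoc\<close>)
    then show ?case by (rule Suc.IH)
  qed
  then show ?thesis
    using cobounds_cup_left[OF char_power_top_cobounds uc u(2)] by blast
qed

lemma unit_not_cobounds: "\<not> cobounds n (unit_cochain (projective_space n))"
proof
  assume "cobounds n (unit_cochain (projective_space n))"
  then obtain b where b: "unit_cochain (projective_space n) = coboundary (projective_space n) b"
    by (auto simp: cobounds_def)
  obtain \<tau> where "singular_simplex 0 (nsphere n) \<tau>"
    using ex_singular_0_simplex by blast
  then have "singular_simplex 0 (projective_space n) (simplex_map 0 antipodal_class \<tau>)"
    by (rule singular_simplex_simplex_map[OF _ continuous_map_antipodal_class])
  then have "unit_cochain (projective_space n) 0 (simplex_map 0 antipodal_class \<tau>) = 1"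
    by (simp add: unit_cochain_def)
  then show False
    unfolding b by simp
qed

text \<open>Cancelling \<open>w\<close> below degree \<open>n\<close> leads down to the unit, and
  coboundaries vanish in degree 0.\<close>

lemma char_power_not_cobounds: "q \<le> n \<Longrightarrow> \<not> cobounds n (char_power n q)"
proof (induction q)
  case 0
  then show ?case by (simp add: unit_not_cobounds)
next
  case (Suc q)
  then show ?case
    using cobounds_if_char_cup_cobounds[OF char_power_homog coboundary_char_power, of q n] by auto
qed

text \<open>In degree \<open>n\<close> every class is a transfer, since its product with
  \<open>w\<close> lies above the top. A transfer bounds if the sphere cocycle evaluates to 0 on the
  fundamental cycle, so at most one nonzero class is possible.\<close>

lemma top_cocycle_cases:
  assumes n: "n = Suc p"
    and u: "u \<in> homog (projective_space n) n" "coboundary (projective_space n) u = zero_cochain"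
  shows "cobounds n u \<or> cobounds n (u \<boxplus> char_power n n)"
proof -
  obtain g where g: "\<And>c. \<lbrakk>c \<in> homog (nsphere n) n; coboundary (nsphere n) c = zero_cochain; ceval (c n) g = 0\<rbrakk>
                  \<Longrightarrow> \<exists>b. b \<in> homog (nsphere n) p \<and> c = coboundary (nsphere n) b"
    using nsphere_fundamental_cycle[OF n] by metis
  have transfer: "\<exists>z. z \<in> homog (nsphere n) n \<and> coboundary (nsphere n) z = zero_cochain \<and>
      z \<boxplus> flip n z = pullback n a"
    if a: "a \<in> homog (projective_space n) n" "coboundary (projective_space n) a = zero_cochain" for a
  proof -
    have h: "cup (projective_space n) (char_cocycle n 0) a \<in> homog (projective_space n) (1 + n)"
      by (rule homog_cup[OF char_cocycle(1) a(1)])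
    have "coboundary (projective_space n) (cup (projective_space n) (char_cocycle n 0) a) = zero_cochain"
      by (simp add: coboundary_cup coboundary_char_cocycle a(2) cup_zero)
    with h have "cobounds n (cup (projective_space n) (char_cocycle n 0) a)"
      by (rule cocycle_above_top_cobounds) simp
    then obtain b where "b \<in> cochains (projective_space n)"
      "cup (projective_space n) (char_cocycle n 0) a = coboundary (projective_space n) b"
      unfolding cobounds_def by blast
    with a obtain z where "z \<in> homog (nsphere n) n" "coboundary (nsphere n) z = zero_cochain"
      "z \<boxplus> flip n z = pullback n a"
      by (rule char_cup_cobounds_imp_transfer)
    then show ?thesis by blast
  qed
  have cob: "cobounds n a"
    if a: "a \<in> cochains (projective_space n)" and z: "z \<in> homog (nsphere n) n"
      "coboundary (nsphere n) z = zero_cochain" "z \<boxplus> flip n z = pullback n a" "ceval (z n) g = 0" for a z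
  proof -
    obtain y where y: "y \<in> homog (nsphere n) p" "z = coboundary (nsphere n) y"
      using g[OF z(1,2,4)] by blast
    obtain t where "t \<in> cochains (projective_space n)" "a = coboundary (projective_space n) t"
      by (rule transfer_of_coboundary[OF a homog_cochains[OF y(1)] z(3)[unfolded y(2)]])
    then show ?thesis
      unfolding cobounds_def by blast
  qed
  obtain z where z: "z \<in> homog (nsphere n) n" "coboundary (nsphere n) z = zero_cochain"
      "z \<boxplus> flip n z = pullback n u"
    using transfer[OF u] by blast
  obtain z' where z': "z' \<in> homog (nsphere n) n" "coboundary (nsphere n) z' = zero_cochain"
      "z' \<boxplus> flip n z' = pullback n (char_power n n)"
    using transfer[OF char_power_homog coboundary_char_power] by blast
  \<comment> \<open>Otherwise \<open>char_power n n\<close> would bound. When \<open>u\<close> also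
    has bit 1, adding the two sphere cocycles gives bit 0.\<close>
  have "ceval (z' n) g = 1"
    using cob[OF char_power_cochains z'] char_power_not_cobounds[of n n] by (cases "ceval (z' n) g") auto
  show ?thesis
  proof (cases "ceval (z n) g")
    case zero
    then show ?thesis
      using cob[OF homog_cochains[OF u(1)] z] by blast
  next
    case one
    have "cobounds n (u \<boxplus> char_power n n)"
    proof (rule cob)
      show "u \<boxplus> char_power n n \<in> cochains (projective_space n)"
        by (rule cochains_add[OF homog_cochains[OF u(1)] char_power_cochains])
      show "z \<boxplus> z' \<in> homog (nsphere n) n"
        by (rule homog_add[OF z(1) z'(1)])
      show "coboundary (nsphere n) (z \<boxplus> z') = zero_cochain"
        by (simp add: coboundary_add z(2) z'(2))
      show "(z \<boxplus> z') \<boxplus> flip n (z \<boxplus> z') = pullback n (u \<boxplus> char_power n n)"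
        unfolding pull_add z(3)[symmetric] z'(3)[symmetric] by (simp add: ac_simps)
      show "ceval ((z \<boxplus> z') n) g = 0"
        by (simp add: ceval_fun_add one \<open>ceval (z' n) g = 1\<close>)
    qed
    then show ?thesis ..
  qed
qed

text \<open>Between 0 and \<open>n\<close> the pullback of \<open>u\<close> bounds, so exactness
  writes \<open>u\<close> as \<open>w\<close> times a class of one degree less, to which the
  induction applies; degrees 0 and \<open>n\<close> are the separate cases.\<close>

lemma cocycle_cases:
  assumes "u \<in> homog (projective_space n) q" "coboundary (projective_space n) u = zero_cochain" "q \<le> n"
  shows "cobounds n u \<or> cobounds n (u \<boxplus> char_power n q)"
  using assms
proof (induction q arbitrary: u)
  case 0
  have zero: "cobounds n zero_cochain"
    unfolding cobounds_def
    using imageI[OF cochains_zero, of "coboundary (projective_space n)" "projective_space n"]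
    by (simp add: coboundary_zero)
  show ?case
    using projective_zero_cocycle[OF 0(1,2)]
  proof
    assume u: "u = unit_cochain (projective_space n)"
    have "cobounds n (u \<boxplus> char_power n 0)"
      unfolding u char_power.simps bit_add_same by (rule zero)
    then show ?thesis ..
  next
    assume u: "u = zero_cochain"
    have "cobounds n u"
      unfolding u by (rule zero)
    then show ?thesis ..
  qed
next
  case (Suc q)
  show ?case
  proof (cases "Suc q = n")
    case True
    then show ?thesis
      using top_cocycle_cases[of n q u] Suc.prems by simp
  next
    case False
    let ?P = "projective_space n" and ?w = "char_cocycle n 0"
    have "pullback n u \<in> homog (nsphere n) (Suc q)"
      by (rule homog_pull[OF Suc.prems(1)])
    moreover have "coboundary (nsphere n) (pullback n u) = zero_cochain"
      by (simp only: pullback_coboundary[symmetric] Suc.prems(2) pull_zero)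
    ultimately obtain v where "v \<in> homog (nsphere n) q" "pullback n u = coboundary (nsphere n) v"
      by (rule nsphere_cocycle_cobounds_off_top[OF _ _ False])
    with Suc.prems(1) obtain a b where a: "a \<in> homog ?P q" "coboundary ?P a = zero_cochain"
      and b: "b \<in> cochains ?P" and ueq: "u = cup ?P ?w a \<boxplus> coboundary ?P b"
      by (rule pullback_cobounds_imp_char_cup)
    have db: "cobounds n (coboundary ?P b)"
      unfolding cobounds_def by (rule imageI[OF b])
    have "cobounds n a \<or> cobounds n (a \<boxplus> char_power n q)"
      using Suc.IH[OF a] Suc.prems(3) by simp
    then show ?thesis
    proof
      assume "cobounds n a"
      then have "cobounds n (cup ?P ?w a \<boxplus> coboundary ?P b)"
        by (intro cobounds_add[OF cobounds_cup_right db] char_cocycle_cochains coboundary_char_cocycle)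
      then show ?thesis unfolding ueq[symmetric] ..
    next
      assume "cobounds n (a \<boxplus> char_power n q)"
      then have "cobounds n (cup ?P ?w (a \<boxplus> char_power n q) \<boxplus> coboundary ?P b)"
        by (intro cobounds_add[OF cobounds_cup_right db] char_cocycle_cochains coboundary_char_cocycle)
      also have "cup ?P ?w (a \<boxplus> char_power n q) \<boxplus> coboundary ?P b = u \<boxplus> char_power n (Suc q)"
        unfolding ueq by (simp add: cup_add_right ac_simps)
      finally show ?thesis ..
    qed
  qed
qed

text \<open>Presents \<open>R\<close> as the polynomial ring over bits modulo \<open>x^(n+1)\<close>
  by a surjection with that kernel. Elements can be handled through representing polynomials, and
  commutativity of \<open>R\<close> is a consequence.\<close>

locale truncated_poly_ring = ring R for R (structure) +
  fixes n :: nat and \<rho> :: "bit poly \<Rightarrow> 'a"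
  assumes rho_range: "range \<rho> = carrier R"
    and rho_add: "\<rho> (p + q) = \<rho> p \<oplus> \<rho> q"
    and rho_mult: "\<rho> (p * q) = \<rho> p \<otimes> \<rho> q"
    and rho_one: "\<rho> 1 = \<one>"
    and rho_eq_zero_iff: "\<rho> p = \<zero> \<longleftrightarrow> monom 1 (Suc n) dvd p"

definition poly_cochain :: "nat \<Rightarrow> bit poly \<Rightarrow> (nat \<Rightarrow> real) set cochain" where
  "poly_cochain n p = (\<lambda>q \<sigma>. coeff p q * char_power n q q \<sigma>)"

lemma poly_cochain_add: "poly_cochain n (p + r) = poly_cochain n p \<boxplus> poly_cochain n r"
  by (simp add: poly_cochain_def distrib_right)

lemma poly_cochain_cochains: "poly_cochain n p \<in> cochains (projective_space n)"
proof (rule cochainsI[where N = "degree p"])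
  show "singular_simplex q (projective_space n) \<sigma>" if "poly_cochain n p q \<sigma> \<noteq> 0" for q \<sigma>
    using that cochains_eq_0[OF char_power_cochains[of n q]] unfolding poly_cochain_def
    by (metis mult_zero_right)
qed (simp add: poly_cochain_def coeff_eq_0)

lemma coboundary_poly_cochain: "coboundary (projective_space n) (poly_cochain n p) = zero_cochain"
proof (rule cochain_eqI)
  fix q \<sigma> assume \<sigma>: "singular_simplex q (projective_space n) \<sigma>"
  show "coboundary (projective_space n) (poly_cochain n p) q \<sigma> = 0"
  proof (cases q)
    case (Suc m)
    have "coboundary (projective_space n) (poly_cochain n p) (Suc m) \<sigma> =
        coeff p m * coboundary (projective_space n) (char_power n m) (Suc m) \<sigma>"
      using \<sigma> unfolding Suc by (simp only: coboundary_Suc poly_cochain_def sum_distrib_left)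
    then show ?thesis
      by (simp add: Suc coboundary_char_power)
  qed simp
qed (rule coboundary_not_simplex)

lemma poly_cochain_mult:
  "poly_cochain n (p * r) = cup (projective_space n) (poly_cochain n p) (poly_cochain n r)"
proof (rule cochain_eqI)
  fix q \<sigma> assume \<sigma>: "singular_simplex q (projective_space n) \<sigma>"
  have split: "char_power n i i (simplex_op i (\<lambda>l. l) \<sigma>) *
      char_power n (q - i) (q - i) (simplex_op (q - i) (\<lambda>l. l + i) \<sigma>) = char_power n q q \<sigma>"
    if "i \<le> q" for i
    using cup_homog_eval[OF char_power_homog[of n i] char_power_homog[of n "q - i"], of \<sigma>] that \<sigma>
    by (simp add: char_power_add)
  have "poly_cochain n p i (simplex_op i (\<lambda>l. l) \<sigma>) *
      poly_cochain n r (q - i) (simplex_op (q - i) (\<lambda>l. l + i) \<sigma>) =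
      coeff p i * coeff r (q - i) * char_power n q q \<sigma>" if "i \<le> q" for i
    unfolding poly_cochain_def split[OF that, symmetric]
    by (simp only: mult.assoc mult.left_commute)
  then show "poly_cochain n (p * r) q \<sigma> =
      cup (projective_space n) (poly_cochain n p) (poly_cochain n r) q \<sigma>"
    by (simp add: cup_eq[OF \<sigma>]) (simp add: poly_cochain_def coeff_mult sum_distrib_right)
next
  fix q \<sigma> assume \<sigma>: "\<not> singular_simplex q (projective_space n) \<sigma>"
  then show "poly_cochain n (p * r) q \<sigma> =
      cup (projective_space n) (poly_cochain n p) (poly_cochain n r) q \<sigma>"
    by (simp add: cochains_eq_0[OF poly_cochain_cochains] cup_not_simplex)
qed

lemma poly_cochain_monom: "poly_cochain n (monom 1 q) = char_power n q"
  by (intro ext) (auto simp: poly_cochain_def homog_eq_0[OF char_power_homog])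

lemma poly_cochain_0: "poly_cochain n 0 = zero_cochain"
  by (simp add: poly_cochain_def)

lemma poly_cochain_1: "poly_cochain n 1 = unit_cochain (projective_space n)"
  using poly_cochain_monom[of n 0] by (simp add: monom_0 one_pCons)

lemma cobounds_zero: "cobounds n zero_cochain"
  unfolding cobounds_def
  using imageI[OF cochains_zero, of "coboundary (projective_space n)" "projective_space n"]
  by (simp add: coboundary_zero)

text \<open>Homogeneous parts of a cocycle are cocycles, and each is cohomologous to zero or to a
  power of \<open>w\<close>. The induction on a bound \<open>N\<close> for the degrees splits off
  the part of highest degree.\<close>

lemma cocycle_cohomologous_poly_cochain:
  assumes "c \<in> cochains (projective_space n)" "coboundary (projective_space n) c = zero_cochain"
  shows "\<exists>p. cobounds n (c \<boxplus> poly_cochain n p)"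
proof -
  have "\<exists>p. cobounds n (c \<boxplus> poly_cochain n p)"
    if "c \<in> cochains (projective_space n)" "coboundary (projective_space n) c = zero_cochain"
      "\<And>q \<sigma>. N \<le> q \<Longrightarrow> c q \<sigma> = 0" for N c
    using that
  proof (induction N arbitrary: c)
    case 0
    then have "c \<boxplus> poly_cochain n 0 = zero_cochain"
      by (intro ext) (simp add: poly_cochain_0)
    then show ?case
      using cobounds_zero[of n] by (intro exI[of _ 0]) (simp only:)
  next
    case (Suc N)
    let ?d = "component N c"
    have d: "?d \<in> homog (projective_space n) N" "coboundary (projective_space n) ?d = zero_cochain"
      by (simp_all add: homog_component Suc.prems component_coboundary)
    have "\<exists>p. cobounds n ((c \<boxplus> ?d) \<boxplus> poly_cochain n p)"
    proof (rule Suc.IH)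
      show "c \<boxplus> ?d \<in> cochains (projective_space n)"
        by (intro cochains_add Suc.prems(1) homog_cochains[OF d(1)])
      show "coboundary (projective_space n) (c \<boxplus> ?d) = zero_cochain"
        by (simp add: coboundary_add Suc.prems(2) d(2))
      show "(c \<boxplus> ?d) q \<sigma> = 0" if "N \<le> q" for q \<sigma>
        using that Suc.prems(3)[of q \<sigma>] by (cases "q = N") (auto simp: component_def)
    qed
    then obtain p where p: "cobounds n ((c \<boxplus> ?d) \<boxplus> poly_cochain n p)" ..
    have "\<exists>r. cobounds n (?d \<boxplus> poly_cochain n r)"
    proof (cases "N \<le> n \<and> cobounds n (?d \<boxplus> char_power n N)")
      case True
      then show ?thesis
        by (intro exI[of _ "monom 1 N"]) (simp only: poly_cochain_monom)
    next
      case False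
      then have "cobounds n ?d"
        using cocycle_above_top_cobounds[OF d] cocycle_cases[OF d] by (meson not_le_imp_less)
      then show ?thesis
        by (intro exI[of _ 0]) (simp add: poly_cochain_0)
    qed
    then obtain r where r: "cobounds n (?d \<boxplus> poly_cochain n r)" ..
    have eq: "((c \<boxplus> ?d) \<boxplus> poly_cochain n p) \<boxplus> (?d \<boxplus> poly_cochain n r) =
        c \<boxplus> poly_cochain n (p + r)"
      by (intro ext) (simp add: poly_cochain_add bit_add_cancel add.assoc add.left_commute)
    show ?case
      using cobounds_add[OF p r] unfolding eq by (rule exI)
  qed
  moreover obtain N where "\<And>q \<sigma>. N < q \<Longrightarrow> c q \<sigma> = 0"
    using assms(1) cochains_bounded by metis
  then have "c q \<sigma> = 0" if "Suc N \<le> q" for q \<sigma>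
    using that by simp
  ultimately show ?thesis
    using assms by blast
qed

lemma cobounds_component:
  assumes "cobounds n a"
  shows "cobounds n (component q a)"
proof -
  obtain b where b: "a = coboundary (projective_space n) b" "b \<in> cochains (projective_space n)"
    using assms unfolding cobounds_def by blast
  show ?thesis
  proof (cases q)
    case 0
    have "component 0 a = zero_cochain"
      unfolding b(1) component_def by (intro ext) simp
    then show ?thesis
      using cobounds_zero[of n] unfolding 0 by (simp only:)
  next
    case (Suc m)
    have "component (Suc m) a = coboundary (projective_space n) (component m b)"
      unfolding b(1) by (rule component_coboundary[symmetric])
    then show ?thesis
      unfolding Suc cobounds_def
      using homog_cochains[OF homog_component[OF b(2), of m]] by (rule image_eqI)
  qed
qed

text \<open>A coboundary has coboundaries as homogeneous parts, so a coefficient 1 in a degree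
  \<open>q \<le> n\<close> would make the \<open>q\<close>-th power of \<open>w\<close>
  bound.\<close>

lemma cobounds_poly_cochain_iff: "cobounds n (poly_cochain n p) \<longleftrightarrow> monom 1 (Suc n) dvd p"
proof
  assume "monom 1 (Suc n) dvd p"
  then obtain r where "p = monom 1 (Suc n) * r" by (rule dvdE)
  then have "poly_cochain n p = cup (projective_space n) (char_power n (Suc n)) (poly_cochain n r)"
    by (simp only: poly_cochain_mult poly_cochain_monom)
  then show "cobounds n (poly_cochain n p)"
    using cobounds_cup_left[OF char_power_top_cobounds poly_cochain_cochains coboundary_poly_cochain]
    by (simp only:)
next
  assume cob: "cobounds n (poly_cochain n p)"
  have "coeff p q = 0" if "q \<le> n" for q
  proof (cases "coeff p q")
    case one
    have "component q (poly_cochain n p) = char_power n q"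
      by (intro ext) (auto simp: component_def poly_cochain_def one homog_eq_0[OF char_power_homog])
    then have False
      using cobounds_component[OF cob, of q] char_power_not_cobounds[OF that] by (simp only:)
    then show ?thesis ..
  qed
  then show "monom 1 (Suc n) dvd p"
    by (simp add: monom_1_dvd_iff' less_Suc_eq_le)
qed

lemma (in ideal) rcos_eq_zero_iff:
  assumes "x \<in> carrier R"
  shows "I +> x = \<zero>\<^bsub>R Quot I\<^esub> \<longleftrightarrow> x \<in> I"
  using a_rcos_const a_rcos_self[OF assms] by (auto simp: FactRing_def)

theorem cohomology_ring_projective_space:
  "\<exists>\<rho>. truncated_poly_ring (cohomology_ring (projective_space n)) n \<rho>"
proof -
  let ?P = "projective_space n"
  let ?B = "coboundary ?P ` cochains ?P"
  let ?Z = "cocycle_ring ?P"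
  interpret ideal ?B ?Z
    by (rule ideal_coboundaries)
  define \<rho> where "\<rho> p = ?B +>\<^bsub>?Z\<^esub> poly_cochain n p" for p
  have hom: "(+>\<^bsub>?Z\<^esub>) ?B \<in> ring_hom ?Z (?Z Quot ?B)"
    by (rule rcos_ring_hom)
  have Z: "poly_cochain n p \<in> carrier ?Z" for p
    by (simp add: cocycle_ring_def poly_cochain_cochains coboundary_poly_cochain)
  have "truncated_poly_ring (?Z Quot ?B) n \<rho>"
  proof (intro truncated_poly_ring.intro truncated_poly_ring_axioms.intro quotient_is_ring)
    show "\<rho> (p + q) = \<rho> p \<oplus>\<^bsub>?Z Quot ?B\<^esub> \<rho> q" for p q
      unfolding \<rho>_def ring_hom_add[OF hom Z Z, symmetric] by (simp add: cocycle_ring_def poly_cochain_add)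
    show "\<rho> (p * q) = \<rho> p \<otimes>\<^bsub>?Z Quot ?B\<^esub> \<rho> q" for p q
      unfolding \<rho>_def ring_hom_mult[OF hom Z Z, symmetric] by (simp add: cocycle_ring_def poly_cochain_mult)
    show "\<rho> 1 = \<one>\<^bsub>?Z Quot ?B\<^esub>"
      unfolding \<rho>_def ring_hom_one[OF hom, symmetric] by (simp add: cocycle_ring_def poly_cochain_1)
    show "\<rho> p = \<zero>\<^bsub>?Z Quot ?B\<^esub> \<longleftrightarrow> monom 1 (Suc n) dvd p" for p
      unfolding \<rho>_def rcos_eq_zero_iff[OF Z] cobounds_def[symmetric] by (rule cobounds_poly_cochain_iff)
    show "range \<rho> = carrier (?Z Quot ?B)"
    proof
      show "range \<rho> \<subseteq> carrier (?Z Quot ?B)"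
        unfolding \<rho>_def using ring_hom_closed[OF hom Z] by blast
      show "carrier (?Z Quot ?B) \<subseteq> range \<rho>"
      proof
        fix u assume "u \<in> carrier (?Z Quot ?B)"
        then obtain c where c: "c \<in> carrier ?Z" "u = ?B +>\<^bsub>?Z\<^esub> c"
          unfolding FactRing_def A_RCOSETS_def' by auto
        then obtain p where p: "cobounds n (c \<boxplus> poly_cochain n p)"
          using cocycle_cohomologous_poly_cochain[of c n] by (auto simp: cocycle_ring_def)
        have eq: "c = (c \<boxplus> poly_cochain n p) \<boxplus> poly_cochain n p"
          by (intro ext) (simp add: add.assoc)
        have "c \<boxplus> poly_cochain n p \<in> ?B"
          using p by (simp only: cobounds_def)
        then have "(c \<boxplus> poly_cochain n p) \<oplus>\<^bsub>?Z\<^esub> poly_cochain n p \<in> ?B +>\<^bsub>?Z\<^esub> poly_cochain n p"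
          unfolding a_r_coset_def' by blast
        then have "c \<in> ?B +>\<^bsub>?Z\<^esub> poly_cochain n p"
          using eq by (simp add: cocycle_ring_def)
        then have "?B +>\<^bsub>?Z\<^esub> poly_cochain n p = u"
          unfolding c(2) by (intro a_repr_independence Z a_subgroup)
        then show "u \<in> range \<rho>"
          unfolding \<rho>_def by blast
      qed
    qed
  qed
  then show ?thesis
    unfolding cohomology_ring_def by blast
qed

section \<open>Sums of numbers with disjoint binary digits\<close>

lemma set_encode_union_disjoint:
  "finite A \<Longrightarrow> finite B \<Longrightarrow> A \<inter> B = {} \<Longrightarrow> set_encode (A \<union> B) = set_encode A + set_encode B"
  by (simp add: set_encode_def sum.union_disjoint)

lemma set_encode_mono: "finite B \<Longrightarrow> A \<subseteq> B \<Longrightarrow> set_encode A \<le> set_encode B"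
  by (simp add: set_encode_def sum_mono2)

lemma set_encode_lessThan: "set_encode {..<e} = 2 ^ e - 1"
  by (induction e) (simp_all add: set_encode_def lessThan_Suc)

lemma set_encode_less_iff:
  assumes "finite A"
  shows "set_encode A < 2 ^ e \<longleftrightarrow> A \<subseteq> {..<e}"
proof
  assume "A \<subseteq> {..<e}"
  then have "set_encode A \<le> 2 ^ e - 1"
    unfolding set_encode_lessThan[symmetric] by (intro set_encode_mono) auto
  then show "set_encode A < 2 ^ e"
    by (simp add: le_less_trans)
next
  assume less: "set_encode A < 2 ^ e"
  show "A \<subseteq> {..<e}"
  proof
    fix j assume "j \<in> A"
    then have "set_encode {j} \<le> set_encode A"
      using assms by (intro set_encode_mono) auto
    then have "(2::nat) ^ j \<le> set_encode A"
      by (simp add: set_encode_def)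
    also note less
    finally show "j \<in> {..<e}" by simp
  qed
qed

lemma set_encode_diff:
  assumes "finite A" "R \<subseteq> A"
  shows "set_encode A = set_encode (A - R) + set_encode R"
proof -
  have "A = (A - R) \<union> R" using assms(2) by blast
  moreover have "set_encode ((A - R) \<union> R) = set_encode (A - R) + set_encode R"
    using assms finite_subset[OF assms(2)] by (intro set_encode_union_disjoint) auto
  ultimately show ?thesis by metis
qed

text \<open>If no term equals \<open>2 ^ Suc e\<close>, all are at most \<open>2 ^ e\<close>; then
  half of the target is extracted twice, since the remainder after the first extraction still sums
  to at least \<open>2 ^ e\<close>. Terms carry an index \<open>p\<close> because powers may
  repeat.\<close>

lemma subset_sum_power_2:
  fixes f :: "'p \<Rightarrow> nat"
  assumes "finite P" "\<And>p. p \<in> P \<Longrightarrow> f p \<le> e" "2 ^ e \<le> (\<Sum>p\<in>P. (2::nat) ^ f p)"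
  shows "\<exists>Q\<subseteq>P. (\<Sum>p\<in>Q. (2::nat) ^ f p) = 2 ^ e"
  using assms
proof (induction e arbitrary: P)
  case 0
  then have "P \<noteq> {}" by auto
  then obtain p where "p \<in> P" by blast
  then show ?case
    using 0(2) by (intro exI[of _ "{p}"]) auto
next
  case (Suc e)
  show ?case
  proof (cases "\<exists>p\<in>P. f p = Suc e")
    case True
    then obtain p where "p \<in> P" "f p = Suc e" by blast
    then show ?thesis
      by (intro exI[of _ "{p}"]) auto
  next
    case False
    then have small: "\<And>p. p \<in> P \<Longrightarrow> f p \<le> e"
      using Suc.prems(2) by (metis le_SucE)
    have "2 ^ e \<le> (\<Sum>p\<in>P. (2::nat) ^ f p)"
      using Suc.prems(3) by simp
    then obtain Q1 where Q1: "Q1 \<subseteq> P" "(\<Sum>p\<in>Q1. (2::nat) ^ f p) = 2 ^ e"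
      using Suc.IH[OF Suc.prems(1) small] by blast
    have "(\<Sum>p\<in>P. (2::nat) ^ f p) = (\<Sum>p\<in>P - Q1. 2 ^ f p) + (\<Sum>p\<in>Q1. 2 ^ f p)"
      by (rule sum.subset_diff[OF Q1(1) Suc.prems(1)])
    then have "2 ^ e \<le> (\<Sum>p\<in>P - Q1. (2::nat) ^ f p)"
      using Suc.prems(3) Q1(2) by simp
    then obtain Q2 where Q2: "Q2 \<subseteq> P - Q1" "(\<Sum>p\<in>Q2. (2::nat) ^ f p) = 2 ^ e"
      using Suc.IH[of "P - Q1"] Suc.prems(1) small by (metis DiffD1 finite_Diff)
    have "finite Q1" "finite Q2"
      using Q1(1) Q2(1) Suc.prems(1) by (meson finite_Diff finite_subset)+
    then have "(\<Sum>p\<in>Q1 \<union> Q2. (2::nat) ^ f p) = 2 ^ Suc e"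
      using Q2(1) by (subst sum.union_disjoint) (auto simp: Q1(2) Q2(2))
    then show ?thesis
      using Q1(1) Q2(1) by (intro exI[of _ "Q1 \<union> Q2"]) auto
  qed
qed

text \<open>The indexed terms are the pairs of a number \<open>i\<close> and one of its digits, so a
  selection of terms is a choice of digits in each number.\<close>

lemma subset_bits_sum_power_2:
  fixes D :: "nat \<Rightarrow> nat set"
  assumes "\<And>i. i < r \<Longrightarrow> D i \<subseteq> {..e}" "2 ^ e \<le> (\<Sum>i<r. set_encode (D i))"
  obtains R where "\<And>i. i < r \<Longrightarrow> R i \<subseteq> D i" "(\<Sum>i<r. set_encode (R i)) = 2 ^ e"
proof -
  have fin: "finite (D i)" if "i < r" for i
    using assms(1)[OF that] finite_subset by blast
  have Sig: "(\<Sum>i<r. set_encode (E i)) = (\<Sum>p\<in>(SIGMA i:{..<r}. E i). 2 ^ snd p)"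
    if "\<And>i. i < r \<Longrightarrow> finite (E i)" for E
    using that by (simp add: set_encode_def sum.Sigma case_prod_unfold)
  let ?P = "SIGMA i:{..<r}. D i"
  have "\<exists>Q\<subseteq>?P. (\<Sum>p\<in>Q. (2::nat) ^ snd p) = 2 ^ e"
  proof (rule subset_sum_power_2)
    show "finite ?P" using fin by auto
    show "snd p \<le> e" if "p \<in> ?P" for p using that assms(1) by fastforce
    show "2 ^ e \<le> (\<Sum>p\<in>?P. (2::nat) ^ snd p)" using assms(2) Sig[of D] fin by simp
  qed
  then obtain Q where Q: "Q \<subseteq> ?P" "(\<Sum>p\<in>Q. (2::nat) ^ snd p) = 2 ^ e" by blast
  define R where "R i = {j. (i, j) \<in> Q}" for i
  have sub: "R i \<subseteq> D i" if "i < r" for i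
    using Q(1) by (auto simp: R_def)
  have "Q = (SIGMA i:{..<r}. R i)"
    using Q(1) by (auto simp: R_def)
  then have "(\<Sum>i<r. set_encode (R i)) = 2 ^ e"
    using Sig[of R] sub fin Q(2) by (metis finite_subset)
  with sub show thesis by (rule that)
qed

text \<open>
  The sets \<open>B i\<close> and \<open>C i\<close> are the binary digits of \<open>b\<^sub>i\<close> and \<open>c\<^sub>i\<close> in a monomial
  \<open>x\<^sub>1\<^bsup>b\<^sub>1\<^esup> \<cdots> x\<^sub>r\<^bsup>b\<^sub>r\<^esup> x\<^bsub>r+1\<^esub>\<^bsup>c\<^sub>1+\<cdots>+c\<^sub>r\<^esup>\<close> of the expansion of \<open>\<Prod>(x\<^sub>i + x\<^bsub>r+1\<^esub>)\<^bsup>b\<^sub>i+c\<^sub>i\<^esup>\<close>; they are disjoint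
  when the coefficient is odd.
\<close>

definition digit_length :: "nat \<Rightarrow> nat \<Rightarrow> nat \<Rightarrow> bool" where
  "digit_length r n m \<longleftrightarrow> (\<exists>B C. (\<forall>i<r. finite (B i) \<and> finite (C i) \<and> B i \<inter> C i = {} \<and> set_encode (B i) \<le> n) \<and>
     (\<Sum>i<r. set_encode (C i)) \<le> n \<and> m = (\<Sum>i<r. set_encode (B i) + set_encode (C i)))"

text \<open>Every single \<open>C i\<close> encodes at most the whole sum, so \<open>B i\<close> and
  \<open>C i\<close> are disjoint subsets of \<open>{..<e}\<close> and together encode at most
  \<open>2 ^ e - 1\<close>.\<close>

lemma digit_length_le:
  assumes "digit_length r n m" "n < 2 ^ e"
  shows "m \<le> r * (2 ^ e - 1)"
proof -
  obtain B C where BC: "\<And>i. i < r \<Longrightarrow> finite (B i) \<and> finite (C i) \<and> B i \<inter> C i = {} \<and> set_encode (B i) \<le> n"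
    and C: "(\<Sum>i<r. set_encode (C i)) \<le> n" and m: "m = (\<Sum>i<r. set_encode (B i) + set_encode (C i))"
    using assms(1) unfolding digit_length_def by blast
  have each: "set_encode (B i) + set_encode (C i) \<le> 2 ^ e - 1" if i: "i < r" for i
  proof -
    have "set_encode (C i) \<le> (\<Sum>i<r. set_encode (C i))"
      using i by (intro member_le_sum) auto
    then have "set_encode (C i) < 2 ^ e" "set_encode (B i) < 2 ^ e"
      using BC[OF i] C assms(2) by linarith+
    then have "B i \<union> C i \<subseteq> {..<e}"
      using BC[OF i] by (simp add: set_encode_less_iff)
    then have "set_encode (B i \<union> C i) < 2 ^ e"
      using BC[OF i] by (simp add: set_encode_less_iff)
    then show ?thesis
      using BC[OF i] by (simp add: set_encode_union_disjoint)
  qed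
  have "m \<le> (\<Sum>i<r. 2 ^ e - 1)"
    unfolding m by (rule sum_mono, rule each) simp
  then show ?thesis by simp
qed

text \<open>Passing from \<open>2 ^ e + d\<close> to \<open>d\<close> costs at most
  \<open>2 ^ e\<close> for each of the \<open>r\<close> indices and another \<open>2 ^ e\<close> for
  the common budget of the \<open>C i\<close>, which explains the factor
  \<open>r + 1\<close>.\<close>

lemma digit_length_drop_top:
  assumes "digit_length r (2 ^ e + d) m" "d < 2 ^ e"
  shows "\<exists>m'. digit_length r d m' \<and> m \<le> m' + (r + 1) * 2 ^ e"
proof -
  let ?n = "2 ^ e + d"
  obtain B C where BC: "\<And>i. i < r \<Longrightarrow> finite (B i) \<and> finite (C i) \<and> B i \<inter> C i = {} \<and> set_encode (B i) \<le> ?n"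
    and C: "(\<Sum>i<r. set_encode (C i)) \<le> ?n" and m: "m = (\<Sum>i<r. set_encode (B i) + set_encode (C i))"
    using assms(1) unfolding digit_length_def by blast
  have Ci: "C i \<subseteq> {..e}" if i: "i < r" for i
  proof -
    have "set_encode (C i) \<le> (\<Sum>i<r. set_encode (C i))"
      using i by (intro member_le_sum) auto
    then have "set_encode (C i) < 2 ^ Suc e"
      using C assms(2) by simp
    then show ?thesis
      using BC[OF i] by (simp only: set_encode_less_iff lessThan_Suc_atMost)
  qed
  \<comment> \<open>The digits removed from the \<open>C i\<close>: exactly \<open>2 ^ e\<close> in
    total if there is that much, otherwise everything. In both cases the remainder fits into the
    budget \<open>d\<close>.\<close>
  obtain R where R: "\<And>i. i < r \<Longrightarrow> R i \<subseteq> C i" "(\<Sum>i<r. set_encode (R i)) \<le> 2 ^ e"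
    "(\<Sum>i<r. set_encode (C i - R i)) \<le> d"
  proof (cases "2 ^ e \<le> (\<Sum>i<r. set_encode (C i))")
    case True
    then obtain R where R: "\<And>i. i < r \<Longrightarrow> R i \<subseteq> C i" "(\<Sum>i<r. set_encode (R i)) = 2 ^ e"
      using subset_bits_sum_power_2[of r C e] Ci by blast
    have "(\<Sum>i<r. set_encode (C i)) = (\<Sum>i<r. set_encode (C i - R i) + set_encode (R i))"
      using BC R(1) by (intro sum.cong set_encode_diff) auto
    then have "(\<Sum>i<r. set_encode (C i - R i)) \<le> d"
      using C R(2) by (simp add: sum.distrib)
    then show thesis using that R by (metis order_refl)
  next
    case False
    then show thesis using that[of C] by (simp add: set_encode_def)
  qed
  define T where "T i = C i - R i" for i
  have T: "T i \<subseteq> {..<e}" if i: "i < r" for i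
  proof -
    have "set_encode (T i) \<le> (\<Sum>i<r. set_encode (T i))"
      using i by (intro member_le_sum) auto
    then have "set_encode (T i) < 2 ^ e"
      using R(3) assms(2) by (simp add: T_def)
    then show ?thesis
      using BC[OF i] by (simp add: set_encode_less_iff T_def)
  qed
  \<comment> \<open>Without the digit \<open>e\<close>, \<open>B i\<close> might still exceed
    \<open>d\<close>, so such an index is emptied entirely. This loses less than
    \<open>2 ^ e\<close>, because \<open>B i\<close> and \<open>T i\<close> are then disjoint
    subsets of \<open>{..<e}\<close>.\<close>
  define B' where "B' i = (if e \<in> B i then B i - {e} else {})" for i
  define C' where "C' i = (if e \<in> B i then T i else {})" for i
  have Bi: "B i \<subseteq> {..e}" if i: "i < r" for i
  proof -
    have "set_encode (B i) < 2 ^ Suc e"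
      using BC[OF i] assms(2) by simp
    then show ?thesis
      using BC[OF i] by (simp only: set_encode_less_iff lessThan_Suc_atMost)
  qed
  have enc_e: "set_encode {e} = 2 ^ e"
    by (simp add: set_encode_def)
  have "digit_length r d (\<Sum>i<r. set_encode (B' i) + set_encode (C' i))"
    unfolding digit_length_def
  proof (intro exI conjI allI impI)
    fix i assume i: "i < r"
    show "finite (B' i)" "finite (C' i)" "B' i \<inter> C' i = {}"
      using BC[OF i] by (auto simp: B'_def C'_def T_def)
    show "set_encode (B' i) \<le> d"
    proof (cases "e \<in> B i")
      case True
      then have "set_encode (B i) = set_encode (B' i) + 2 ^ e"
        using set_encode_diff[of "B i" "{e}"] BC[OF i] by (simp add: B'_def enc_e)
      then show ?thesis using BC[OF i] by simp
    qed (simp add: B'_def set_encode_def)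
  next
    have "(\<Sum>i<r. set_encode (C' i)) \<le> (\<Sum>i<r. set_encode (T i))"
      by (intro sum_mono) (simp add: C'_def set_encode_def)
    then show "(\<Sum>i<r. set_encode (C' i)) \<le> d"
      using R(3) by (simp add: T_def)
  qed simp
  moreover have "m \<le> (\<Sum>i<r. set_encode (B' i) + set_encode (C' i)) + (r + 1) * 2 ^ e"
  proof -
    have each: "set_encode (B i) + set_encode (C i) \<le>
        (set_encode (B' i) + set_encode (C' i)) + (2 ^ e + set_encode (R i))" if i: "i < r" for i
    proof -
      have c: "set_encode (C i) = set_encode (T i) + set_encode (R i)"
        unfolding T_def using BC[OF i] R(1)[OF i] by (intro set_encode_diff) auto
      show ?thesis
      proof (cases "e \<in> B i")
        case True
        then have "set_encode (B i) = set_encode (B' i) + 2 ^ e"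
          using set_encode_diff[of "B i" "{e}"] BC[OF i] by (simp add: B'_def enc_e)
        then show ?thesis using True c by (simp add: C'_def)
      next
        case False
        then have "B i \<union> T i \<subseteq> {..<e}"
          using Bi[OF i] T[OF i] by (auto simp: le_less)
        moreover have "finite (B i \<union> T i)" "B i \<inter> T i = {}" "finite (T i)"
          using BC[OF i] by (auto simp: T_def)
        ultimately have "set_encode (B i) + set_encode (T i) < 2 ^ e"
          using BC[OF i] by (metis set_encode_less_iff set_encode_union_disjoint)
        then show ?thesis using c by simp
      qed
    qed
    have "m \<le> (\<Sum>i<r. (set_encode (B' i) + set_encode (C' i)) + (2 ^ e + set_encode (R i)))"
      unfolding m by (rule sum_mono, rule each) simp
    also have "\<dots> = (\<Sum>i<r. set_encode (B' i) + set_encode (C' i)) + (r * 2 ^ e + (\<Sum>i<r. set_encode (R i)))"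
      by (simp add: sum.distrib)
    finally show ?thesis using R(2) by simp
  qed
  ultimately show ?thesis by blast
qed

text \<open>Every \<open>B i\<close> receives the digit \<open>e\<close>, which raises its bound
  from \<open>d\<close> to \<open>2 ^ e + d\<close>. The sum of the \<open>C i\<close> may also grow
  by \<open>2 ^ e\<close>, and this is spent on digits below \<open>e\<close> that are still
  free.\<close>

lemma digit_length_add_top:
  assumes "digit_length r d m'" "d < 2 ^ e"
  shows "\<exists>m. digit_length r (2 ^ e + d) m \<and> min (m' + (r + 1) * 2 ^ e) (r * (2 ^ Suc e - 1)) \<le> m"
proof -
  obtain B C where BC: "\<And>i. i < r \<Longrightarrow> finite (B i) \<and> finite (C i) \<and> B i \<inter> C i = {} \<and> set_encode (B i) \<le> d"
    and C: "(\<Sum>i<r. set_encode (C i)) \<le> d" and m': "m' = (\<Sum>i<r. set_encode (B i) + set_encode (C i))"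
    using assms(1) unfolding digit_length_def by blast
  have sub: "B i \<union> C i \<subseteq> {..<e}" if i: "i < r" for i
  proof -
    have "set_encode (C i) \<le> (\<Sum>i<r. set_encode (C i))"
      using i by (intro member_le_sum) auto
    then have "set_encode (C i) < 2 ^ e" "set_encode (B i) < 2 ^ e"
      using BC[OF i] C assms(2) by linarith+
    then show ?thesis
      using BC[OF i] by (simp add: set_encode_less_iff)
  qed
  define D where "D i = {..<e} - (B i \<union> C i)" for i
  have enc_e: "set_encode {e} = 2 ^ e"
    by (simp add: set_encode_def)
  have encB: "set_encode (insert e (B i)) = 2 ^ e + set_encode (B i)" if i: "i < r" for i
  proof -
    have "set_encode ({e} \<union> B i) = set_encode {e} + set_encode (B i)"
      using BC[OF i] sub[OF i] by (intro set_encode_union_disjoint) auto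
    then show ?thesis by (simp only: enc_e insert_is_Un[symmetric])
  qed
  have encC: "set_encode (C i \<union> R) = set_encode (C i) + set_encode R" if i: "i < r" "R \<subseteq> D i" for i R
    using that BC[OF i(1)] finite_subset[OF that(2)]
    by (intro set_encode_union_disjoint) (auto simp: D_def)
  have extend: "digit_length r (2 ^ e + d) (m' + r * 2 ^ e + (\<Sum>i<r. set_encode (R i)))"
    if R: "\<And>i. i < r \<Longrightarrow> R i \<subseteq> D i" "(\<Sum>i<r. set_encode (R i)) \<le> 2 ^ e" for R
    unfolding digit_length_def
  proof (intro exI conjI allI impI)
    fix i assume i: "i < r"
    show "finite (insert e (B i))" "finite (C i \<union> R i)"
      using BC[OF i] finite_subset[OF R(1)[OF i]] by (auto simp: D_def)
    show "insert e (B i) \<inter> (C i \<union> R i) = {}"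
      using BC[OF i] sub[OF i] R(1)[OF i] by (auto simp: D_def)
    show "set_encode (insert e (B i)) \<le> 2 ^ e + d"
      using encB[OF i] BC[OF i] by simp
  next
    have "(\<Sum>i<r. set_encode (C i \<union> R i)) = (\<Sum>i<r. set_encode (C i) + set_encode (R i))"
      by (intro sum.cong encC R(1)) auto
    then show "(\<Sum>i<r. set_encode (C i \<union> R i)) \<le> 2 ^ e + d"
      using C R(2) by (simp add: sum.distrib)
    have "(\<Sum>i<r. set_encode (insert e (B i)) + set_encode (C i \<union> R i)) =
        (\<Sum>i<r. (2 ^ e + set_encode (B i)) + (set_encode (C i) + set_encode (R i)))"
      by (intro sum.cong arg_cong2[where f = "(+)"] encC encB R(1)) auto
    then show "m' + r * 2 ^ e + (\<Sum>i<r. set_encode (R i)) =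
        (\<Sum>i<r. set_encode (insert e (B i)) + set_encode (C i \<union> R i))"
      by (simp add: m' sum.distrib)
  qed
  \<comment> \<open>If the free digits sum to at least \<open>2 ^ e\<close>, the first entry of the
    minimum is reached. Otherwise all of them are used, every index has all digits up to
    \<open>e\<close>, and the second entry is reached.\<close>
  show ?thesis
  proof (cases "2 ^ e \<le> (\<Sum>i<r. set_encode (D i))")
    case True
    have "D i \<subseteq> {..e}" for i by (auto simp: D_def)
    then obtain R where R: "\<And>i. i < r \<Longrightarrow> R i \<subseteq> D i" "(\<Sum>i<r. set_encode (R i)) = 2 ^ e"
      using subset_bits_sum_power_2[of r D e] True by blast
    have "digit_length r (2 ^ e + d) (m' + r * 2 ^ e + 2 ^ e)"
      using extend[of R] R by simp
    then show ?thesis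
      by (intro exI[of _ "m' + r * 2 ^ e + 2 ^ e"]) simp
  next
    case False
    then have ext: "digit_length r (2 ^ e + d) (m' + r * 2 ^ e + (\<Sum>i<r. set_encode (D i)))"
      by (intro extend) auto
    have "set_encode (B i) + set_encode (C i) + set_encode (D i) = 2 ^ e - 1" if i: "i < r" for i
    proof -
      have "set_encode {..<e} = set_encode ((B i \<union> C i) \<union> D i)"
        using sub[OF i] by (intro arg_cong[where f = set_encode]) (auto simp: D_def)
      also have "\<dots> = set_encode (B i \<union> C i) + set_encode (D i)"
        using BC[OF i] by (intro set_encode_union_disjoint) (auto simp: D_def)
      also have "set_encode (B i \<union> C i) = set_encode (B i) + set_encode (C i)"
        using BC[OF i] by (intro set_encode_union_disjoint) auto
      finally show ?thesis by (simp add: set_encode_lessThan)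
    qed
    then have "(\<Sum>i<r. set_encode (B i) + set_encode (C i) + set_encode (D i)) = r * (2 ^ e - 1)"
      by simp
    then have "m' + (\<Sum>i<r. set_encode (D i)) = r * (2 ^ e - 1)"
      by (simp add: m' sum.distrib)
    then have "m' + r * 2 ^ e + (\<Sum>i<r. set_encode (D i)) = r * (2 ^ e - 1) + r * 2 ^ e"
      by simp
    also have "\<dots> = r * ((2 ^ e - 1) + 2 ^ e)"
      by (rule distrib_left[symmetric])
    also have "(2 ^ e - 1) + 2 ^ e = (2 ^ Suc e - 1 :: nat)"
      by simp
    finally show ?thesis
      using ext by (metis min.cobounded2)
  qed
qed

section \<open>The largest digit length and its recursion\<close>

definition max_digit_length :: "nat \<Rightarrow> nat \<Rightarrow> nat" where
  "max_digit_length r n = Max {m. digit_length r n m}"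

lemma finite_digit_length: "finite {m. digit_length r n m}"
proof (rule finite_subset)
  \<comment> \<open>A crude bound suffices for finiteness: \<open>n < 2 ^ n\<close>, so the exponent
    can be \<open>n\<close>.\<close>
  show "{m. digit_length r n m} \<subseteq> {..r * (2 ^ n - 1)}"
    using digit_length_le[of r n _ n] by auto
qed simp

lemma digit_length_0: "digit_length r n 0"
  unfolding digit_length_def by (intro exI[of _ "\<lambda>_. {}"]) (simp add: set_encode_def)

lemma digit_length_max: "digit_length r n (max_digit_length r n)"
  using Max_in[OF finite_digit_length, of r n] digit_length_0[of r n]
  unfolding max_digit_length_def by blast

lemma digit_length_imp_le_max: "digit_length r n m \<Longrightarrow> m \<le> max_digit_length r n"
  unfolding max_digit_length_def by (rule Max_ge[OF finite_digit_length]) simp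

lemma max_digit_length_0: "max_digit_length r 0 = 0"
  using digit_length_le[OF digit_length_max[of r 0], of 0] by simp

theorem max_digit_length_rec:
  assumes "d < 2 ^ e"
  shows "max_digit_length r (2 ^ e + d) =
    min (max_digit_length r d + (r + 1) * 2 ^ e) (r * (2 ^ Suc e - 1))"
proof (rule antisym)
  obtain m' where "digit_length r d m'" "max_digit_length r (2 ^ e + d) \<le> m' + (r + 1) * 2 ^ e"
    using digit_length_drop_top[OF digit_length_max assms] by blast
  moreover have "max_digit_length r (2 ^ e + d) \<le> r * (2 ^ Suc e - 1)"
    by (rule digit_length_le[OF digit_length_max]) (use assms in simp)
  ultimately show "max_digit_length r (2 ^ e + d) \<le>
      min (max_digit_length r d + (r + 1) * 2 ^ e) (r * (2 ^ Suc e - 1))"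
    using digit_length_imp_le_max[of r d m'] by simp
  obtain m where "digit_length r (2 ^ e + d) m"
    "min (max_digit_length r d + (r + 1) * 2 ^ e) (r * (2 ^ Suc e - 1)) \<le> m"
    using digit_length_add_top[OF digit_length_max assms] by blast
  then show "min (max_digit_length r d + (r + 1) * 2 ^ e) (r * (2 ^ Suc e - 1)) \<le>
      max_digit_length r (2 ^ e + d)"
    using digit_length_imp_le_max le_trans by blast
qed

section \<open>Tensor powers\<close>

locale tensor_truncated_poly_ring = truncated_poly_ring +
  fixes k :: nat
begin

abbreviation "G \<equiv> free_tensor_ring k R"
abbreviation "tuples \<equiv> {..<k} \<rightarrow>\<^sub>E carrier R"
abbreviation tmult (infixl "\<odot>" 70) where "tmult s t \<equiv> (\<lambda>i\<in>{..<k}. s i \<otimes> t i)"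

section \<open>Ring axioms for the free algebra on tuples\<close>

lemma G_simps:
  "carrier G = {f. Poly_Mapping.keys f \<subseteq> tuples}"
  "\<one>\<^bsub>G\<^esub> = Poly_Mapping.single (\<lambda>i\<in>{..<k}. \<one>) 1" "\<zero>\<^bsub>G\<^esub> = 0" "f \<oplus>\<^bsub>G\<^esub> g = f + g"
  "f \<otimes>\<^bsub>G\<^esub> g = lin_ext (\<lambda>s. lin_ext (\<lambda>t. Poly_Mapping.single (s \<odot> t) 1) g) f"
proof -
  show "f \<otimes>\<^bsub>G\<^esub> g = lin_ext (\<lambda>s. lin_ext (\<lambda>t. Poly_Mapping.single (s \<odot> t) 1) g) f"
    unfolding free_tensor_ring_def lin_ext_def monoid.simps
    by (intro sum.cong) (auto simp: in_keys_iff)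
qed (simp_all add: free_tensor_ring_def)

lemma tmult_closed: "s \<in> tuples \<Longrightarrow> t \<in> tuples \<Longrightarrow> s \<odot> t \<in> tuples"
  by (auto simp: PiE_iff)

lemma tmult_assoc: "s \<in> tuples \<Longrightarrow> t \<in> tuples \<Longrightarrow> u \<in> tuples \<Longrightarrow> (s \<odot> t) \<odot> u = s \<odot> (t \<odot> u)"
  by (intro restrict_ext) (auto simp: PiE_iff m_assoc)

lemma single_in_G: "t \<in> tuples \<Longrightarrow> Poly_Mapping.single t 1 \<in> carrier G"
  by (simp add: G_simps)

lemma add_in_G: "f \<in> carrier G \<Longrightarrow> g \<in> carrier G \<Longrightarrow> f + g \<in> carrier G"
  using keys_add[of f g] by (auto simp: G_simps)

lemma zero_in_G: "0 \<in> carrier G"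
  by (simp add: G_simps)

lemma G_induct [consumes 1, case_names zero single add]:
  assumes "f \<in> carrier G" "P 0" "\<And>t. t \<in> tuples \<Longrightarrow> P (Poly_Mapping.single t 1)"
    "\<And>f g. P f \<Longrightarrow> P g \<Longrightarrow> P (f + g)"
  shows "P f"
  using assms(1) unfolding G_simps(1) mem_Collect_eq by (rule bit_poly_mapping_induct) (fact assms(2-))+

lemma G_mult_add_left: "(f + g) \<otimes>\<^bsub>G\<^esub> h = f \<otimes>\<^bsub>G\<^esub> h + g \<otimes>\<^bsub>G\<^esub> h"
  unfolding G_simps by (rule lin_ext_add) simp

lemma G_mult_add_right: "h \<otimes>\<^bsub>G\<^esub> (f + g) = h \<otimes>\<^bsub>G\<^esub> f + h \<otimes>\<^bsub>G\<^esub> g"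
proof -
  have "lin_ext (\<lambda>t. Poly_Mapping.single (s \<odot> t) (1::bit)) (f + g) =
    lin_ext (\<lambda>t. Poly_Mapping.single (s \<odot> t) 1) f + lin_ext (\<lambda>t. Poly_Mapping.single (s \<odot> t) 1) g" for s
    by (rule lin_ext_add) simp
  then show ?thesis
    unfolding G_simps by (simp only:) (simp add: lin_ext_def sum.distrib)
qed

lemma G_mult_zero: "0 \<otimes>\<^bsub>G\<^esub> f = 0" "f \<otimes>\<^bsub>G\<^esub> 0 = 0"
  by (simp_all add: G_simps) (simp add: lin_ext_def)

lemma G_mult_single: "Poly_Mapping.single s 1 \<otimes>\<^bsub>G\<^esub> Poly_Mapping.single t 1 = Poly_Mapping.single (s \<odot> t) 1"
  by (simp add: G_simps)

lemma G_mult_closed: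
  assumes "f \<in> carrier G" "g \<in> carrier G"
  shows "f \<otimes>\<^bsub>G\<^esub> g \<in> carrier G"
  using assms(1)
proof (induction f rule: G_induct)
  case (single s)
  show ?case using assms(2)
  proof (induction g rule: G_induct)
    case (single t)
    then show ?case
      unfolding G_mult_single by (intro single_in_G tmult_closed \<open>s \<in> tuples\<close>)
  qed (simp_all only: G_mult_zero zero_in_G G_mult_add_right add_in_G)
qed (simp_all only: G_mult_zero zero_in_G G_mult_add_left add_in_G)

lemma G_mult_assoc:
  assumes "f \<in> carrier G" "g \<in> carrier G" "h \<in> carrier G"
  shows "f \<otimes>\<^bsub>G\<^esub> g \<otimes>\<^bsub>G\<^esub> h = f \<otimes>\<^bsub>G\<^esub> (g \<otimes>\<^bsub>G\<^esub> h)"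
  using assms(1)
proof (induction f rule: G_induct)
  case (single s)
  show ?case using assms(2)
  proof (induction g rule: G_induct)
    case (single t)
    show ?case using assms(3)
    proof (induction h rule: G_induct)
      case (single u)
      then show ?case
        using \<open>s \<in> tuples\<close> \<open>t \<in> tuples\<close> by (simp only: G_mult_single tmult_assoc)
    qed (simp_all only: G_mult_zero G_mult_add_right)
  qed (simp_all only: G_mult_zero G_mult_add_right G_mult_add_left)
qed (simp_all only: G_mult_zero G_mult_add_left)

lemma G_one_mult:
  assumes "f \<in> carrier G"
  shows "\<one>\<^bsub>G\<^esub> \<otimes>\<^bsub>G\<^esub> f = f" "f \<otimes>\<^bsub>G\<^esub> \<one>\<^bsub>G\<^esub> = f"
proof -
  have "(\<lambda>i\<in>{..<k}. \<one>) \<odot> t = t" "t \<odot> (\<lambda>i\<in>{..<k}. \<one>) = t" if "t \<in> tuples" for t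
    using that by (auto intro!: extensionalityI[of _ "{..<k}"] simp: PiE_iff)
  then have "Poly_Mapping.single (\<lambda>i\<in>{..<k}. \<one>) 1 \<otimes>\<^bsub>G\<^esub> Poly_Mapping.single t 1 = Poly_Mapping.single t 1"
    "Poly_Mapping.single t 1 \<otimes>\<^bsub>G\<^esub> Poly_Mapping.single (\<lambda>i\<in>{..<k}. \<one>) 1 = Poly_Mapping.single t 1"
    if "t \<in> tuples" for t
    using that by (simp_all only: G_mult_single)
  note one = this
  show "\<one>\<^bsub>G\<^esub> \<otimes>\<^bsub>G\<^esub> f = f"
    using assms unfolding G_simps(2)
    by (induction f rule: G_induct) (simp_all only: one G_mult_zero G_mult_add_right)
  show "f \<otimes>\<^bsub>G\<^esub> \<one>\<^bsub>G\<^esub> = f"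
    using assms unfolding G_simps(2)
    by (induction f rule: G_induct) (simp_all only: one G_mult_zero G_mult_add_left)
qed

lemma ring_G: "ring G"
proof (intro ringI abelian_groupI monoidI)
  show "\<exists>y\<in>carrier G. y \<oplus>\<^bsub>G\<^esub> x = \<zero>\<^bsub>G\<^esub>" if "x \<in> carrier G" for x
    by (rule bexI[OF _ that]) (simp add: G_simps(3,4))
  show "\<one>\<^bsub>G\<^esub> \<in> carrier G"
    unfolding G_simps(2) by (rule single_in_G) auto
qed (simp_all only: G_simps(3,4) add_in_G zero_in_G G_mult_closed G_mult_assoc G_one_mult
      G_mult_add_left G_mult_add_right ac_simps add_0 add_0_right)

text \<open>These are the functionals that factor through the tensor power; they are the tests for
  an element not to lie in the tensor ideal.\<close>

definition multiadditive :: "((nat \<Rightarrow> 'a) \<Rightarrow> bit) \<Rightarrow> bool" where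
  "multiadditive \<mu> \<longleftrightarrow> (\<forall>t\<in>tuples. \<forall>i<k. \<forall>a\<in>carrier R. \<forall>b\<in>carrier R.
     \<mu> (t(i := a \<oplus> b)) = \<mu> (t(i := a)) + \<mu> (t(i := b)))"

lemma multiadditiveD:
  "multiadditive \<mu> \<Longrightarrow> t \<in> tuples \<Longrightarrow> i < k \<Longrightarrow> a \<in> carrier R \<Longrightarrow> b \<in> carrier R \<Longrightarrow>
    \<mu> (t(i := a \<oplus> b)) = \<mu> (t(i := a)) + \<mu> (t(i := b))"
  unfolding multiadditive_def by blast

lemma update_in_tuples: "t \<in> tuples \<Longrightarrow> i < k \<Longrightarrow> a \<in> carrier R \<Longrightarrow> t(i := a) \<in> tuples"
  by (auto simp: PiE_iff extensional_def)

text \<open>An ideal containing the relations, hence containing the ideal they generate. This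
  controls the generated ideal from above without any description of its elements.\<close>

definition annihilated :: "((nat \<Rightarrow> 'a) \<Rightarrow>\<^sub>0 bit) set" where
  "annihilated = {f \<in> carrier G. \<forall>\<mu>. multiadditive \<mu> \<longrightarrow> lin_ext \<mu> f = 0}"

lemma relation_eq: "Poly_Mapping.single (t(i := a \<oplus> b)) (1::bit) - Poly_Mapping.single (t(i := a)) 1
        - Poly_Mapping.single (t(i := b)) 1 =
    Poly_Mapping.single (t(i := a \<oplus> b)) 1 + Poly_Mapping.single (t(i := a)) 1 + Poly_Mapping.single (t(i := b)) 1"
  by (simp only: bit_poly_mapping_diff)

lemma relations_subset: "multilinear_relations k R \<subseteq> carrier G"
proof
  fix f assume "f \<in> multilinear_relations k R"
  then obtain t i a b where *: "t \<in> tuples" "i < k" "a \<in> carrier R" "b \<in> carrier R"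
    "f = Poly_Mapping.single (t(i := a \<oplus> b)) 1 + Poly_Mapping.single (t(i := a)) 1 + Poly_Mapping.single (t(i := b)) 1"
    unfolding multilinear_relations_def relation_eq by blast
  show "f \<in> carrier G"
    unfolding *(5) by (intro add_in_G single_in_G update_in_tuples a_closed *(1-4))
qed

lemma relations_annihilated: "multilinear_relations k R \<subseteq> annihilated"
proof
  fix f assume f: "f \<in> multilinear_relations k R"
  then obtain t i a b where *: "t \<in> tuples" "i < k" "a \<in> carrier R" "b \<in> carrier R"
    "f = Poly_Mapping.single (t(i := a \<oplus> b)) 1 + Poly_Mapping.single (t(i := a)) 1 + Poly_Mapping.single (t(i := b)) 1"
    unfolding multilinear_relations_def relation_eq by blast
  have "lin_ext \<mu> f = 0" if "multiadditive \<mu>" for \<mu>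
  proof -
    have "\<mu> (t(i := a \<oplus> b)) = \<mu> (t(i := a)) + \<mu> (t(i := b))"
      by (rule multiadditiveD[OF that *(1-4)])
    then show ?thesis
      unfolding *(5) lin_ext_add_bit lin_ext_single by (simp add: bit_add_same)
  qed
  then show "f \<in> annihilated"
    using f relations_subset unfolding annihilated_def by blast
qed

lemma multiadditive_tmult:
  assumes "multiadditive \<mu>" "s \<in> tuples"
  shows "multiadditive (\<lambda>t. \<mu> (s \<odot> t))" "multiadditive (\<lambda>t. \<mu> (t \<odot> s))"
proof -
  have s: "s i \<in> carrier R" if "i < k" for i
    using assms(2) that by auto
  have upd: "s \<odot> (t(i := c)) = (s \<odot> t)(i := s i \<otimes> c)" "(t(i := c)) \<odot> s = (t \<odot> s)(i := c \<otimes> s i)"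
    if "i < k" for t i c
    using that by (auto simp: restrict_def)
  show "multiadditive (\<lambda>t. \<mu> (s \<odot> t))" "multiadditive (\<lambda>t. \<mu> (t \<odot> s))"
    unfolding multiadditive_def
  proof (safe, goal_cases)
    case (1 t i a b)
    then show ?case
      using multiadditiveD[OF assms(1) tmult_closed[OF assms(2) 1(1)] 1(2), of "s i \<otimes> a" "s i \<otimes> b"]
      unfolding upd[OF 1(2)] by (simp only: r_distr s m_closed)
  next
    case (2 t i a b)
    then show ?case
      using multiadditiveD[OF assms(1) tmult_closed[OF 2(1) assms(2)] 2(2), of "a \<otimes> s i" "b \<otimes> s i"]
      unfolding upd[OF 2(2)] by (simp only: l_distr s m_closed)
  qed
qed

lemma lin_ext_G_mult_single:
  assumes "f \<in> carrier G"
  shows "lin_ext \<mu> (Poly_Mapping.single s 1 \<otimes>\<^bsub>G\<^esub> f) = lin_ext (\<lambda>t. \<mu> (s \<odot> t) :: bit) f"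
    "lin_ext \<mu> (f \<otimes>\<^bsub>G\<^esub> Poly_Mapping.single s 1) = lin_ext (\<lambda>t. \<mu> (t \<odot> s) :: bit) f"
  using assms
  by (induction f rule: G_induct)
     (simp_all only: G_mult_zero lin_ext_zero G_mult_single lin_ext_single G_mult_add_right
        G_mult_add_left lin_ext_add_bit)

text \<open>Multiplying by a pure tensor turns a multiadditive map into another one.\<close>

lemma ideal_annihilated: "ideal annihilated G"
proof -
  interpret G: ring G by (rule ring_G)
  have minus: "\<ominus>\<^bsub>G\<^esub> x = x" if "x \<in> carrier G" for x
    using that by (intro G.minus_equality) (simp_all add: G_simps(3,4))
  show ?thesis
  proof (rule idealI[OF ring_G])
    show "subgroup annihilated (add_monoid G)"
    proof (rule G.add.subgroupI)
      show "annihilated \<noteq> {}"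
        using zero_in_G unfolding annihilated_def by force
      show "\<ominus>\<^bsub>G\<^esub> a \<in> annihilated" if "a \<in> annihilated" for a
        using that minus[of a] by (simp add: annihilated_def)
      show "a \<oplus>\<^bsub>G\<^esub> b \<in> annihilated" if "a \<in> annihilated" "b \<in> annihilated" for a b
        using that by (simp add: annihilated_def G_simps(4) lin_ext_add_bit add_in_G)
    qed (simp add: annihilated_def)
    fix a x assume a: "a \<in> annihilated" and x: "x \<in> carrier G"
    have ac: "a \<in> carrier G" using a by (simp add: annihilated_def)
    have "lin_ext \<mu> (x \<otimes>\<^bsub>G\<^esub> a) = 0 \<and> lin_ext \<mu> (a \<otimes>\<^bsub>G\<^esub> x) = 0" if \<mu>: "multiadditive \<mu>" for \<mu>
      using x
    proof (induction x rule: G_induct)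
      case (single s)
      then show ?case
        using a multiadditive_tmult[OF \<mu> single] by (simp add: lin_ext_G_mult_single[OF ac] annihilated_def)
    qed (simp_all add: G_mult_zero G_mult_add_left G_mult_add_right lin_ext_add_bit)
    then show "x \<otimes>\<^bsub>G\<^esub> a \<in> annihilated" "a \<otimes>\<^bsub>G\<^esub> x \<in> annihilated"
      using G_mult_closed ac x by (auto simp: annihilated_def)
  qed
qed

abbreviation "I \<equiv> tensor_ideal k R"

lemma ideal_I: "ideal I G"
  unfolding tensor_ideal_def by (rule ring.genideal_ideal[OF ring_G relations_subset])

lemma relations_in_I: "multilinear_relations k R \<subseteq> I"
  unfolding tensor_ideal_def by (rule ring.genideal_self[OF ring_G relations_subset])

lemma I_annihilated: "f \<in> I \<Longrightarrow> multiadditive \<mu> \<Longrightarrow> lin_ext \<mu> f = 0"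
  using ring.genideal_minimal[OF ring_G ideal_annihilated relations_annihilated]
  unfolding tensor_ideal_def annihilated_def by blast

lemma I_subset: "I \<subseteq> carrier G"
  using ideal.Icarr[OF ideal_I] by blast

lemma I_add: "f \<in> I \<Longrightarrow> g \<in> I \<Longrightarrow> f + g \<in> I"
  using additive_subgroup.a_closed[OF ideal.axioms(1)[OF ideal_I], of f g] by (simp only: G_simps(4))

lemma I_zero: "0 \<in> I"
  using additive_subgroup.zero_closed[OF ideal.axioms(1)[OF ideal_I]] by (simp only: G_simps(3))

lemma I_relation:
  assumes "t \<in> tuples" "i < k" "a \<in> carrier R" "b \<in> carrier R"
  shows "Poly_Mapping.single (t(i := a \<oplus> b)) 1 + Poly_Mapping.single (t(i := a)) 1 +
    Poly_Mapping.single (t(i := b)) 1 \<in> I"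
proof -
  have "Poly_Mapping.single (t(i := a \<oplus> b)) 1 + Poly_Mapping.single (t(i := a)) 1 +
    Poly_Mapping.single (t(i := b)) 1 \<in> multilinear_relations k R"
    unfolding multilinear_relations_def relation_eq using assms by blast
  then show ?thesis using relations_in_I by blast
qed

text \<open>Additivity at \<open>\<zero> \<oplus> \<zero>\<close> yields three copies of the same
  pure tensor, which modulo 2 is one copy.\<close>

lemma I_single_zero:
  assumes "t \<in> tuples" "i < k" "t i = \<zero>"
  shows "Poly_Mapping.single t 1 \<in> I"
proof -
  have "t(i := \<zero>) = t" using assms(3) by auto
  then show ?thesis
    using I_relation[OF assms(1,2) zero_closed zero_closed] by (simp add: add.assoc)
qed

section \<open>Polynomials as representatives of tensors\<close>

definition expo :: "(nat \<Rightarrow>\<^sub>0 nat) \<Rightarrow> nat \<Rightarrow> 'a" where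
  "expo v = (\<lambda>i\<in>{..<k}. \<rho> (monom 1 (Poly_Mapping.lookup v i)))"

text \<open>The ring homomorphism that sends the variable \<open>i < k\<close> to the pure tensor
  with the generator \<open>\<rho> (monom 1 1)\<close> in slot \<open>i\<close> and
  \<open>\<one>\<close> elsewhere. Variables of index at least \<open>k\<close> are sent to the
  unit.\<close>

definition Theta :: "((nat \<Rightarrow>\<^sub>0 nat) \<Rightarrow>\<^sub>0 bit) \<Rightarrow> (nat \<Rightarrow> 'a) \<Rightarrow>\<^sub>0 bit" where
  "Theta = lin_ext (\<lambda>v. Poly_Mapping.single (expo v) 1)"

lemma rho_closed: "\<rho> p \<in> carrier R"
  using rho_range by blast

lemma rho_zero: "\<rho> 0 = \<zero>"
  by (simp add: rho_eq_zero_iff)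

lemma expo_in_tuples: "expo v \<in> tuples"
  by (auto simp: expo_def rho_closed)

lemma expo_add: "expo (u + v) = expo u \<odot> expo v"
  by (auto simp: expo_def lookup_add mult_monom simp flip: rho_mult)

lemma Theta_zero: "Theta 0 = 0"
  by (simp add: Theta_def)

lemma Theta_single: "Theta (Poly_Mapping.single v 1) = Poly_Mapping.single (expo v) 1"
  by (simp add: Theta_def)

lemma Theta_add: "Theta (p + q) = Theta p + Theta q"
  unfolding Theta_def by (rule lin_ext_add) simp

lemma Theta_in_G: "Theta p \<in> carrier G"
  using subset_UNIV by (induction p rule: bit_poly_mapping_induct)
    (simp_all only: Theta_zero Theta_single Theta_add zero_in_G add_in_G single_in_G expo_in_tuples)

lemma Theta_mult: "Theta (p * q) = Theta p \<otimes>\<^bsub>G\<^esub> Theta q"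
  using subset_UNIV
proof (induction p rule: bit_poly_mapping_induct)
  case (single u)
  show ?case using subset_UNIV
  proof (induction q rule: bit_poly_mapping_induct)
    case (single v)
    show ?case
      by (simp only: mult_single mult_1 Theta_single G_mult_single expo_add)
  qed (simp_all only: mult_zero_right Theta_zero G_mult_zero distrib_left Theta_add G_mult_add_right)
qed (simp_all only: mult_zero_left Theta_zero G_mult_zero distrib_right Theta_add G_mult_add_left)

lemma Theta_one: "Theta 1 = \<one>\<^bsub>G\<^esub>"
proof -
  have "expo 0 = (\<lambda>i\<in>{..<k}. \<one>)"
    by (auto simp: expo_def monom_0 rho_one simp flip: one_pCons)
  then show ?thesis
    using Theta_single[of 0] by (simp add: G_simps(2))
qed

text \<open>Meaningful only for \<open>j \<le> n\<close>: two polynomials with the same image under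
  \<open>\<rho>\<close> agree up to degree \<open>n\<close>, so there the choice does not
  matter.\<close>

definition coef :: "nat \<Rightarrow> 'a \<Rightarrow> bit" where
  "coef j x = coeff (SOME p. \<rho> p = x) j"

lemma coef_rho:
  assumes "j \<le> n"
  shows "coef j (\<rho> p) = coeff p j"
proof -
  let ?q = "SOME q. \<rho> q = \<rho> p"
  have q: "\<rho> ?q = \<rho> p"
    by (rule someI[of "\<lambda>q. \<rho> q = \<rho> p" p]) simp
  have "\<rho> p \<oplus> \<rho> p = \<zero>"
  proof -
    have "p + p = 0" by (rule poly_eqI) (simp only: coeff_add coeff_0 bit_add_same)
    then show ?thesis by (simp only: rho_add[symmetric] rho_zero)
  qed
  then have "\<rho> (?q + p) = \<zero>"
    by (simp only: rho_add q)
  then have "coeff (?q + p) j = 0"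
    using assms by (simp add: rho_eq_zero_iff monom_1_dvd_iff')
  then show ?thesis
    by (simp add: coef_def bit_add_eq_0_iff)
qed

lemma coef_add:
  assumes "j \<le> n" "x \<in> carrier R" "y \<in> carrier R"
  shows "coef j (x \<oplus> y) = coef j x + coef j y"
proof -
  obtain p q where "x = \<rho> p" "y = \<rho> q"
    using assms(2,3) rho_range by blast
  then show ?thesis
    using assms(1) by (simp add: coef_rho flip: rho_add)
qed

lemma coef_zero: "j \<le> n \<Longrightarrow> coef j \<zero> = 0"
  using coef_rho[of j 0] by (simp add: rho_zero)

lemma eq_zero_if_coef_zero:
  assumes "x \<in> carrier R" "\<And>j. j \<le> n \<Longrightarrow> coef j x = 0"
  shows "x = \<zero>"
proof -
  obtain p where p: "x = \<rho> p"
    using assms(1) rho_range by blast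
  then have "coeff p j = 0" if "j < Suc n" for j
    using assms(2)[of j] that by (simp add: coef_rho)
  then show ?thesis
    unfolding p by (simp only: rho_eq_zero_iff monom_1_dvd_iff') simp
qed

lemma Theta_surj_single:
  assumes "t \<in> tuples"
  shows "\<exists>p. Poly_Mapping.single t 1 + Theta p \<in> I"
proof -
  \<comment> \<open>The slots from \<open>j\<close> on are already monomials; the induction expands
    the others one at a time. Over bits a polynomial is a sum of distinct monomials, so the inner
    induction runs over a finite set of exponents.\<close>
  have "\<exists>p. Poly_Mapping.single t 1 + Theta p \<in> I"
    if "t \<in> tuples" "\<And>i. j \<le> i \<Longrightarrow> i < k \<Longrightarrow> \<exists>m. t i = \<rho> (monom 1 m)" "j \<le> k" for j t
    using that
  proof (induction j arbitrary: t)
    case 0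
    then obtain m where m: "\<And>i. i < k \<Longrightarrow> t i = \<rho> (monom 1 (m i))"
      by (metis le0)
    define v where "v = (\<Sum>i<k. Poly_Mapping.single i (m i))"
    have "Poly_Mapping.lookup v i = m i" if "i < k" for i
      using that by (simp add: v_def lookup_sum lookup_single when_def)
    then have "expo v = t"
      using 0(1) m by (intro extensionalityI[of _ "{..<k}"]) (auto simp: expo_def PiE_iff)
    then show ?case
      using I_zero by (intro exI[of _ "Poly_Mapping.single v 1"]) (simp add: Theta_single)
  next
    case (Suc j)
    then have j: "j < k" by simp
    have mono: "\<exists>p. Poly_Mapping.single (t(j := \<rho> (monom 1 m))) 1 + Theta p \<in> I" for m
    proof (rule Suc.IH)
      show "t(j := \<rho> (monom 1 m)) \<in> tuples"
        by (rule update_in_tuples[OF Suc.prems(1) j rho_closed])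
      show "\<exists>m'. (t(j := \<rho> (monom 1 m))) i = \<rho> (monom 1 m')" if "j \<le> i" "i < k" for i
        using that Suc.prems(2)[of i] by (cases "i = j") auto
    qed (use j in simp)
    have sums: "\<exists>p. Poly_Mapping.single (t(j := \<rho> (\<Sum>m\<in>A. monom 1 m))) 1 + Theta p \<in> I" if "finite A" for A
      using that
    proof (induction A rule: finite_induct)
      case empty
      have "Poly_Mapping.single (t(j := \<zero>)) 1 \<in> I"
        by (rule I_single_zero[OF update_in_tuples[OF Suc.prems(1) j zero_closed] j]) simp
      then show ?case
        by (intro exI[of _ 0]) (simp only: sum.empty rho_zero Theta_zero add_0_right)
    next
      case (insert m A)
      let ?s = "\<lambda>x. Poly_Mapping.single (t(j := x)) (1::bit)"
      let ?a = "\<rho> (monom 1 m)" and ?b = "\<rho> (\<Sum>m\<in>A. monom 1 m)"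
      obtain p q where pq: "?s ?a + Theta p \<in> I" "?s ?b + Theta q \<in> I"
        using mono[of m] insert.IH by blast
      have "?s (?a \<oplus> ?b) + ?s ?a + ?s ?b \<in> I"
        by (rule I_relation[OF Suc.prems(1) j rho_closed rho_closed])
      from I_add[OF I_add[OF this pq(1)] pq(2)]
      have "?s (?a \<oplus> ?b) + Theta (p + q) + ((?s ?a + ?s ?a) + (?s ?b + ?s ?b)) \<in> I"
        by (simp only: Theta_add ac_simps)
      then show ?case
        by (intro exI[of _ "p + q"])
           (simp only: sum.insert[OF insert.hyps] rho_add bit_poly_mapping_add_same add_0_right)
    qed
    obtain q where q: "t j = \<rho> q"
      using Suc.prems(1) j rho_range by (metis PiE_E imageE lessThan_iff)
    have "q = (\<Sum>m\<in>{m. m \<le> degree q \<and> coeff q m = 1}. monom 1 m)"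
    proof -
      have "q = (\<Sum>m\<le>degree q. monom (coeff q m) m)"
        by (rule poly_as_sum_of_monoms[symmetric])
      also have "\<dots> = (\<Sum>m\<in>{m. m \<le> degree q \<and> coeff q m = 1}. monom (coeff q m) m)"
        by (rule sum.mono_neutral_right) auto
      finally show ?thesis by simp
    qed
    moreover have "finite {m. m \<le> degree q \<and> coeff q m = 1}"
      by simp
    ultimately have "\<exists>p. Poly_Mapping.single (t(j := \<rho> q)) 1 + Theta p \<in> I"
      using sums by metis
    then show ?case
      by (simp only: q[symmetric] fun_upd_triv)
  qed
  from this[of t k] show ?thesis
    using assms by auto
qed

lemma Theta_surj:
  assumes "f \<in> carrier G"
  shows "\<exists>p. f + Theta p \<in> I"
  using assms
proof (induction f rule: G_induct)
  case zero
  show ?case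
    using I_zero by (intro exI[of _ 0]) (simp add: Theta_zero)
next
  case (single t)
  then show ?case by (rule Theta_surj_single)
next
  case (add f g)
  then obtain p q where "f + Theta p \<in> I" "g + Theta q \<in> I" by blast
  from I_add[OF this] show ?case
    by (intro exI[of _ "p + q"]) (simp only: Theta_add ac_simps)
qed

end

section \<open>Polynomials modulo 2\<close>

type_synonym mpoly2 = "(nat \<Rightarrow>\<^sub>0 nat) \<Rightarrow>\<^sub>0 bit"

definition var :: "nat \<Rightarrow> mpoly2" where
  "var i = Poly_Mapping.single (Poly_Mapping.single i 1) 1"

lemma var_power: "var i ^ m = Poly_Mapping.single (Poly_Mapping.single i m) 1"
  by (induction m) (simp_all add: var_def mult_single single_one single_zero flip: single_add)

lemma prod_single_1:
  "(\<Prod>i\<in>A. Poly_Mapping.single (e i) (1::bit)) = Poly_Mapping.single (\<Sum>i\<in>A. e i :: nat \<Rightarrow>\<^sub>0 nat) 1"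
  by (induction A rule: infinite_finite_induct) (simp_all add: mult_single)

lemma of_nat_mpoly2: "(of_nat c :: mpoly2) = (if even c then 0 else 1)"
  by (induction c) auto

text \<open>The ideal generated by the powers \<open>x_i^(n+1)\<close> with \<open>i < k\<close>. As
  a monomial ideal it is determined by its monomials, so membership is read off the keys.\<close>

definition trunc_ideal :: "nat \<Rightarrow> nat \<Rightarrow> mpoly2 set" where
  "trunc_ideal k n = {p. \<forall>v\<in>Poly_Mapping.keys p. \<exists>i<k. n < Poly_Mapping.lookup v i}"

lemma trunc_ideal_zero: "0 \<in> trunc_ideal k n"
  by (simp add: trunc_ideal_def)

lemma trunc_ideal_add: "p \<in> trunc_ideal k n \<Longrightarrow> q \<in> trunc_ideal k n \<Longrightarrow> p + q \<in> trunc_ideal k n"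
  using keys_add[of p q] by (auto simp: trunc_ideal_def)

lemma trunc_ideal_sum: "(\<And>x. x \<in> A \<Longrightarrow> f x \<in> trunc_ideal k n) \<Longrightarrow> sum f A \<in> trunc_ideal k n"
  by (induction A rule: infinite_finite_induct) (auto simp: trunc_ideal_zero trunc_ideal_add)

lemma trunc_ideal_mult: "p \<in> trunc_ideal k n \<Longrightarrow> q * p \<in> trunc_ideal k n"
  unfolding trunc_ideal_def
proof (intro CollectI ballI)
  fix w assume p: "p \<in> {p. \<forall>v\<in>Poly_Mapping.keys p. \<exists>i<k. n < Poly_Mapping.lookup v i}"
    and "w \<in> Poly_Mapping.keys (q * p)"
  then obtain u v where "w = u + v" "v \<in> Poly_Mapping.keys p"
    using keys_mult[of q p] by blast
  moreover obtain i where "i < k" "n < Poly_Mapping.lookup v i"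
    using p \<open>v \<in> Poly_Mapping.keys p\<close> by blast
  ultimately show "\<exists>i<k. n < Poly_Mapping.lookup w i"
    by (auto simp: lookup_add intro: trans_less_add2)
qed

text \<open>Here \<open>r = k - 1\<close> and indices start at 0, so \<open>var r\<close> is the
  last of the \<open>k\<close> variables.\<close>

definition diag_prod :: "nat \<Rightarrow> (nat \<Rightarrow> nat) \<Rightarrow> mpoly2" where
  "diag_prod r a = (\<Prod>i<r. (var i + var r) ^ a i)"

text \<open>The powers of the ideal generated by \<open>x\<^sub>i + x\<^sub>r\<close> for \<open>i < r\<close>.\<close>

inductive diag_power :: "nat \<Rightarrow> nat \<Rightarrow> mpoly2 \<Rightarrow> bool" for r m where
  zero: "diag_power r m 0"
| add: "(\<Sum>i<r. a i) = m \<Longrightarrow> diag_power r m p \<Longrightarrow> diag_power r m (q * diag_prod r a + p)"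

lemma diag_power_add: "diag_power r m p \<Longrightarrow> diag_power r m q \<Longrightarrow> diag_power r m (p + q)"
  by (induction rule: diag_power.induct) (simp_all add: add.assoc diag_power.add)

lemma diag_power_mult: "diag_power r m p \<Longrightarrow> diag_power r m (q * p)"
  by (induction rule: diag_power.induct)
     (simp_all add: diag_power.zero distrib_left diag_power.add flip: mult.assoc)

lemma diag_power_diag_prod:
  assumes "(\<Sum>i<r. a i) = m"
  shows "diag_power r m (q * diag_prod r a)"
  using diag_power.add[OF assms diag_power.zero, of q] by simp

lemma diag_prod_add: "diag_prod r (\<lambda>i. a i + b i) = diag_prod r a * diag_prod r b"
  by (simp add: diag_prod_def power_add prod.distrib)

lemma diag_power_mult_diag_power:
  assumes "diag_power r m p" "diag_power r m' q"
  shows "diag_power r (m + m') (p * q)"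
  using assms(1)
proof (induction rule: diag_power.induct)
  case zero
  then show ?case by (simp add: diag_power.zero)
next
  case (add a p s)
  have "diag_power r (m + m') (diag_prod r a * q)"
    using assms(2)
  proof (induction rule: diag_power.induct)
    case zero
    then show ?case by (simp add: diag_power.zero)
  next
    case (add b q t)
    have "(\<Sum>i<r. a i + b i) = m + m'"
      using add(1) \<open>(\<Sum>i<r. a i) = m\<close> by (simp add: sum.distrib)
    from diag_power.add[OF this add.IH, of t] show ?case
      by (simp add: diag_prod_add algebra_simps)
  qed
  from diag_power_add[OF diag_power_mult[OF this, of s] add.IH] show ?case
    by (simp add: algebra_simps)
qed

lemma diag_power_in_trunc_ideal:
  assumes "diag_power r m p" "\<And>a. (\<Sum>i<r. a i) = m \<Longrightarrow> diag_prod r a \<in> trunc_ideal k n"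
  shows "p \<in> trunc_ideal k n"
  using assms(1)
  by (induction rule: diag_power.induct)
     (simp_all add: trunc_ideal_zero trunc_ideal_add trunc_ideal_mult assms(2))

lemma diag_power_var_sum:
  assumes "i \<le> r"
  shows "diag_power r 1 (var i + var r)"
proof (cases "i = r")
  case True
  then show ?thesis by (simp add: diag_power.zero)
next
  case False
  then have i: "i < r" using assms by simp
  have "diag_prod r (\<lambda>j. if j = i then 1 else 0) = (\<Prod>j<r. if j = i then var i + var r else 1)"
    unfolding diag_prod_def by (rule prod.cong) auto
  also have "\<dots> = var i + var r"
    using i by simp
  finally show ?thesis
    using diag_power_diag_prod[of "\<lambda>j. if j = i then 1 else 0" r 1 1] i by (simp add: sum.delta)
qed

lemma diag_power_var_power_sum:
  assumes "i \<le> r"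
  shows "diag_power r 1 (var i ^ a + var r ^ a)"
proof (induction a)
  case 0
  then show ?case by (simp add: diag_power.zero)
next
  case (Suc a)
  have "diag_power r 1 (var i * (var i ^ a + var r ^ a) + var r ^ a * (var i + var r))"
    by (intro diag_power_add diag_power_mult Suc diag_power_var_sum assms)
  also have "var i * (var i ^ a + var r ^ a) + var r ^ a * (var i + var r) =
      var i ^ Suc a + var r ^ Suc a + (var i * var r ^ a + var i * var r ^ a)"
    by (simp only: power_Suc distrib_left distrib_right ac_simps)
  finally show ?case by (simp only: bit_poly_mapping_add_same add_0_right)
qed

text \<open>Modulo the elements \<open>var i + var r\<close> every monomial equals a power of
  \<open>var r\<close> with the same total degree; the variables are replaced one by one.\<close>

lemma diag_power_monomial:
  assumes "j \<le> Suc r"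
  shows "diag_power r 1 ((\<Prod>i<j. var i ^ v i) + var r ^ (\<Sum>i<j. v i))"
  using assms
proof (induction j)
  case 0
  then show ?case by (simp add: diag_power.zero)
next
  case (Suc j)
  let ?A = "\<Prod>i<j. var i ^ v i" and ?B = "var r ^ (\<Sum>i<j. v i)"
  have "diag_power r 1 (var j ^ v j * (?A + ?B) + ?B * (var j ^ v j + var r ^ v j))"
    by (rule diag_power_add[OF diag_power_mult[OF Suc.IH] diag_power_mult[OF diag_power_var_power_sum]])
       (use Suc.prems in simp_all)
  also have "var j ^ v j * (?A + ?B) + ?B * (var j ^ v j + var r ^ v j) =
      (\<Prod>i<Suc j. var i ^ v i) + var r ^ (\<Sum>i<Suc j. v i) + (?B * var j ^ v j + ?B * var j ^ v j)"
    by (simp only: lessThan_Suc prod.insert sum.insert finite_lessThan lessThan_iff less_irrefl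
        not_False_eq_True power_add distrib_left distrib_right ac_simps)
  finally show ?case by (simp only: bit_poly_mapping_add_same add_0_right)
qed

text \<open>The exponent obtained by choosing \<open>var i\<close> in \<open>g i\<close> of the
  \<open>a i\<close> copies of the factor \<open>var i + var r\<close>, and \<open>var r\<close> in
  the others.\<close>

definition diag_exponent :: "nat \<Rightarrow> (nat \<Rightarrow> nat) \<Rightarrow> (nat \<Rightarrow> nat) \<Rightarrow> nat \<Rightarrow>\<^sub>0 nat" where
  "diag_exponent r a g = (\<Sum>i<r. Poly_Mapping.single i (g i) + Poly_Mapping.single r (a i - g i))"

lemma lookup_diag_exponent:
  "i < r \<Longrightarrow> Poly_Mapping.lookup (diag_exponent r a g) i = g i"
  "Poly_Mapping.lookup (diag_exponent r a g) r = (\<Sum>i<r. a i - g i)"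
  by (simp_all add: diag_exponent_def lookup_sum lookup_add lookup_single when_def)

lemma diag_prod_expand:
  "diag_prod r a = (\<Sum>g\<in>(\<Pi>\<^sub>E i\<in>{..<r}. {..a i}).
     of_nat (\<Prod>i<r. a i choose g i) * Poly_Mapping.single (diag_exponent r a g) 1)"
proof -
  have "(var i + var r) ^ m = (\<Sum>b\<le>m. of_nat (m choose b) *
      Poly_Mapping.single (Poly_Mapping.single i b + Poly_Mapping.single r (m - b)) 1)" for i m
    by (simp add: binomial_ring var_power mult_single mult.assoc)
  then have "diag_prod r a = (\<Prod>i<r. \<Sum>b\<le>a i. of_nat (a i choose b) *
      Poly_Mapping.single (Poly_Mapping.single i b + Poly_Mapping.single r (a i - b)) 1)"
    by (simp only: diag_prod_def)
  also have "\<dots> = (\<Sum>g\<in>(\<Pi>\<^sub>E i\<in>{..<r}. {..a i}). \<Prod>i<r. of_nat (a i choose g i) *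
      Poly_Mapping.single (Poly_Mapping.single i (g i) + Poly_Mapping.single r (a i - g i)) 1)"
    by (rule prod_sum_PiE) auto
  also have "\<dots> = (\<Sum>g\<in>(\<Pi>\<^sub>E i\<in>{..<r}. {..a i}).
      of_nat (\<Prod>i<r. a i choose g i) * Poly_Mapping.single (diag_exponent r a g) 1)"
    by (simp only: prod.distrib prod_single_1 of_nat_prod diag_exponent_def)
  finally show ?thesis .
qed

text \<open>The coefficient form of \<open>(1 + x)^(2m) = (1 + x^2)^m\<close> modulo 2. The
  induction applies the rule of Pascal twice, whereby the middle coefficient is counted
  twice.\<close>

lemma even_choose_double:
  "even ((2 * m) choose (2 * l)) = even (m choose l) \<and> even ((2 * m) choose Suc (2 * l))"
proof (induction m arbitrary: l)
  case 0
  then show ?case by (cases l) auto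
next
  case (Suc m)
  have step: "Suc (Suc a) choose Suc (Suc b) = (a choose b) + 2 * (a choose Suc b) + (a choose Suc (Suc b))" for a b
    by simp
  show ?case
  proof (cases l)
    case 0
    then show ?thesis by simp
  next
    case (Suc l')
    have "even ((2 * Suc m) choose (2 * Suc l')) = even (Suc m choose Suc l')"
      using Suc.IH[of l'] Suc.IH[of "Suc l'"] step[of "2 * m" "2 * l'"] by simp
    moreover have "even ((2 * Suc m) choose Suc (2 * Suc l'))"
      using Suc.IH[of l'] Suc.IH[of "Suc l'"] step[of "2 * m" "Suc (2 * l')"] by simp
    ultimately show ?thesis by (simp only: Suc)
  qed
qed

text \<open>One digit of Lucas's theorem: the lowest digits are compared and then dropped from both
  numbers.\<close>

lemma odd_choose_div_2:
  "odd (a choose b) \<longleftrightarrow> (odd b \<longrightarrow> odd a) \<and> odd ((a div 2) choose (b div 2))"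
proof -
  obtain m i where a: "a = 2 * m + i" "i < 2"
    using mod_mult_div_eq[of a 2] by (metis add.commute mod_less_divisor pos2)
  obtain l j where b: "b = 2 * l + j" "j < 2"
    using mod_mult_div_eq[of b 2] by (metis add.commute mod_less_divisor pos2)
  have even_odd: "odd (Suc (2 * m) choose Suc (2 * l)) = odd (m choose l)"
    using even_choose_double[of m l] by simp
  have odd_even: "odd (Suc (2 * m) choose (2 * l)) = odd (m choose l)"
  proof (cases l)
    case (Suc l')
    have "Suc (2 * m) choose (2 * l) = (2 * m choose Suc (2 * l')) + (2 * m choose (2 * l))"
      unfolding Suc by simp
    then show ?thesis
      using even_choose_double[of m l'] even_choose_double[of m l] by simp
  qed simp
  consider "i = 0" "j = 0" | "i = 0" "j = 1" | "i = 1" "j = 0" | "i = 1" "j = 1"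
    using a(2) b(2) by linarith
  then show ?thesis
    by cases (use even_choose_double[of m l] even_odd odd_even in \<open>simp_all add: a(1) b(1)\<close>)
qed

theorem odd_choose_iff: "odd (a choose b) \<longleftrightarrow> set_decode b \<subseteq> set_decode a"
proof (induction a arbitrary: b rule: less_induct)
  case (less a)
  show ?case
  proof (cases "a = 0")
    case True
    have "set_decode b = {} \<longleftrightarrow> b = 0"
      by (metis set_decode_inverse set_decode_zero)
    then show ?thesis using True by (cases b) auto
  next
    case False
    have "set_decode b \<subseteq> set_decode a \<longleftrightarrow> (\<forall>x. x \<in> set_decode b \<longrightarrow> x \<in> set_decode a)"
      by blast
    also have "\<dots> \<longleftrightarrow> (odd b \<longrightarrow> odd a) \<and> set_decode (b div 2) \<subseteq> set_decode (a div 2)"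
      unfolding set_decode_0[symmetric] subset_iff set_decode_Suc[symmetric]
      by (metis not0_implies_Suc)
    finally show ?thesis
      using False less[of "a div 2" "b div 2"] odd_choose_div_2[of a b] by simp
  qed
qed

text \<open>Some term of the expansion lies outside the ideal. Its coefficient is odd and all its
  exponents are at most \<open>n\<close>; the exponent of \<open>var r\<close> gives the bound for
  the sum over all \<open>C i\<close>.\<close>

lemma digit_length_if_not_trunc:
  assumes "diag_prod r a \<notin> trunc_ideal (Suc r) n"
  shows "digit_length r n (\<Sum>i<r. a i)"
proof -
  let ?term = "\<lambda>g. of_nat (\<Prod>i<r. a i choose g i) * Poly_Mapping.single (diag_exponent r a g) 1"
  have "\<exists>g. ?term g \<notin> trunc_ideal (Suc r) n"
  proof (rule ccontr)
    assume "\<not> ?thesis"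
    then have "diag_prod r a \<in> trunc_ideal (Suc r) n"
      unfolding diag_prod_expand by (intro trunc_ideal_sum) blast
    then show False using assms by (rule notE[rotated])
  qed
  then obtain g where g: "?term g \<notin> trunc_ideal (Suc r) n" ..
  have "odd (\<Prod>i<r. a i choose g i)"
  proof (rule ccontr)
    assume "\<not> odd (\<Prod>i<r. a i choose g i)"
    then show False
      using g trunc_ideal_zero by (simp add: of_nat_mpoly2 del: of_nat_prod)
  qed
  then have odd: "odd (a i choose g i)" if "i < r" for i
    using that by (auto simp: even_prod_iff)
  have "Poly_Mapping.single (diag_exponent r a g) 1 \<notin> trunc_ideal (Suc r) n"
    using g trunc_ideal_mult by blast
  then have le: "Poly_Mapping.lookup (diag_exponent r a g) i \<le> n" if "i < Suc r" for i
    using that by (simp add: trunc_ideal_def not_less) (metis not_less)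
  \<comment> \<open>By Lucas's theorem the digits of \<open>g i\<close> are among those of
    \<open>a i\<close>, so the remaining digits encode \<open>a i - g i\<close>.\<close>
  have dec: "set_encode (set_decode (g i)) + set_encode (set_decode (a i) - set_decode (g i)) = a i"
    if "i < r" for i
    using set_encode_diff[of "set_decode (a i)" "set_decode (g i)"] odd[OF that]
    by (simp add: odd_choose_iff)
  have diff: "set_encode (set_decode (a i) - set_decode (g i)) = a i - g i" if "i < r" for i
    using dec[OF that] by simp
  show ?thesis
    unfolding digit_length_def
  proof (intro exI conjI allI impI)
    fix i assume i: "i < r"
    show "finite (set_decode (g i))" "finite (set_decode (a i) - set_decode (g i))"
      "set_decode (g i) \<inter> (set_decode (a i) - set_decode (g i)) = {}"
      by auto
    show "set_encode (set_decode (g i)) \<le> n"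
      using le[of i] i by (simp add: lookup_diag_exponent)
  next
    have "(\<Sum>i<r. set_encode (set_decode (a i) - set_decode (g i))) = (\<Sum>i<r. a i - g i)"
      by (rule sum.cong[OF refl]) (simp only: lessThan_iff diff)
    then show "(\<Sum>i<r. set_encode (set_decode (a i) - set_decode (g i))) \<le> n"
      using le[of r] by (simp add: lookup_diag_exponent)
    show "(\<Sum>i<r. a i) = (\<Sum>i<r. set_encode (set_decode (g i)) + set_encode (set_decode (a i) - set_decode (g i)))"
      by (rule sum.cong[OF refl]) (simp only: dec lessThan_iff)
  qed
qed

section \<open>Zero-divisor cup length\<close>

context tensor_truncated_poly_ring
begin

abbreviation "T \<equiv> tensor_power k R"

definition tensor_class :: "((nat \<Rightarrow> 'a) \<Rightarrow>\<^sub>0 bit) \<Rightarrow> ((nat \<Rightarrow> 'a) \<Rightarrow>\<^sub>0 bit) set" where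
  "tensor_class f = I +>\<^bsub>G\<^esub> f"

lemma tensor_class_hom: "tensor_class \<in> ring_hom G T"
  unfolding tensor_power_def tensor_class_def by (rule ideal.rcos_ring_hom[OF ideal_I])

lemma tensor_class_eq_zero_iff: "f \<in> carrier G \<Longrightarrow> tensor_class f = \<zero>\<^bsub>T\<^esub> \<longleftrightarrow> f \<in> I"
  unfolding tensor_power_def tensor_class_def by (rule ideal.rcos_eq_zero_iff[OF ideal_I])

lemma G_add_cancel: "(f :: (nat \<Rightarrow> 'a) \<Rightarrow>\<^sub>0 bit) + g + g = f"
  by (simp only: add.assoc bit_poly_mapping_add_same add_0_right)

lemma mem_tensor_class_iff:
  assumes "f \<in> carrier G"
  shows "g \<in> tensor_class f \<longleftrightarrow> g + f \<in> I"
proof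
  assume "g \<in> tensor_class f"
  then obtain h where "h \<in> I" "g = h + f"
    unfolding tensor_class_def a_r_coset_def' G_simps(4) by blast
  then show "g + f \<in> I" by (simp only: G_add_cancel)
next
  assume "g + f \<in> I"
  then show "g \<in> tensor_class f"
    unfolding tensor_class_def a_r_coset_def' G_simps(4) using G_add_cancel[of g f] by force
qed

lemma tensor_class_eqI:
  assumes "f \<in> carrier G" "g \<in> carrier G" "g + f \<in> I"
  shows "tensor_class f = tensor_class g"
  unfolding tensor_class_def
proof (rule abelian_subgroup.a_repr_independence'[OF _ _ assms(1)])
  show "abelian_subgroup I G"
    using ideal_I ring_G by (simp add: abelian_subgroupI3 ideal.axioms(1) ring.is_abelian_group)
  show "g \<in> I +>\<^bsub>G\<^esub> f"
    using assms(3) mem_tensor_class_iff[OF assms(1)] by (simp add: tensor_class_def)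
qed

lemma T_carrier: "u \<in> carrier T \<Longrightarrow> \<exists>p. u = tensor_class (Theta p)"
proof -
  assume "u \<in> carrier T"
  then obtain f where f: "f \<in> carrier G" "u = tensor_class f"
    unfolding tensor_power_def FactRing_def A_RCOSETS_def' tensor_class_def by auto
  obtain p where "f + Theta p \<in> I"
    using Theta_surj[OF f(1)] by blast
  then have "tensor_class (Theta p) = tensor_class f"
    by (rule tensor_class_eqI[OF Theta_in_G f(1)])
  then show ?thesis using f(2) by metis
qed

lemma tensor_class_Theta_list_prod:
  "ring_list_prod T (map (\<lambda>p. tensor_class (Theta p)) ps) = tensor_class (Theta (prod_list ps))"
proof (induction ps)
  case Nil
  then show ?case
    using ring_hom_one[OF tensor_class_hom] by (simp add: ring_list_prod_def Theta_one)
next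
  case (Cons p ps)
  then show ?case
    using ring_hom_mult[OF tensor_class_hom Theta_in_G Theta_in_G, of p "prod_list ps"]
    by (simp add: ring_list_prod_def Theta_mult)
qed

lemma Theta_trunc_ideal: "p \<in> trunc_ideal k n \<Longrightarrow> Theta p \<in> I"
proof -
  have "Theta p \<in> I" if "Poly_Mapping.keys p \<subseteq> {v. \<exists>i<k. n < Poly_Mapping.lookup v i}" for p
    using that
  proof (induction p rule: bit_poly_mapping_induct)
    case (single v)
    then obtain i where i: "i < k" "n < Poly_Mapping.lookup v i" by blast
    have "\<rho> (monom 1 (Poly_Mapping.lookup v i)) = \<zero>"
      unfolding rho_eq_zero_iff using i(2) by (simp add: monom_1_dvd_iff')
    then have "expo v i = \<zero>"
      using i(1) by (simp add: expo_def)
    then show ?case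
      unfolding Theta_single by (rule I_single_zero[OF expo_in_tuples i(1)])
  qed (simp_all only: Theta_zero I_zero Theta_add I_add)
  then show "p \<in> trunc_ideal k n \<Longrightarrow> Theta p \<in> I"
    unfolding trunc_ideal_def by blast
qed

lemma lin_ext_Theta:
  fixes \<mu> :: "(nat \<Rightarrow> 'a) \<Rightarrow> bit"
  shows "lin_ext \<mu> (Theta p) = lin_ext (\<lambda>v. \<mu> (expo v)) p"
  using subset_UNIV by (induction p rule: bit_poly_mapping_induct)
    (simp_all only: Theta_zero lin_ext_zero Theta_single lin_ext_single Theta_add lin_ext_add_bit
      lin_ext_add bit_add_same)

definition tuple_prod :: "(nat \<Rightarrow> 'a) \<Rightarrow> 'a" where
  "tuple_prod t = ring_list_prod R (map t [0..<k])"

lemma ring_list_prod_closed: "set xs \<subseteq> carrier R \<Longrightarrow> ring_list_prod R xs \<in> carrier R"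
  by (induction xs) (auto simp: ring_list_prod_def)

lemma ring_list_prod_append:
  "set xs \<subseteq> carrier R \<Longrightarrow> set ys \<subseteq> carrier R \<Longrightarrow>
    ring_list_prod R (xs @ ys) = ring_list_prod R xs \<otimes> ring_list_prod R ys"
proof (induction xs)
  case Nil
  then show ?case
    using ring_list_prod_closed[of ys] by (simp add: ring_list_prod_def)
next
  case (Cons x xs)
  then show ?case
    using ring_list_prod_closed[of ys] ring_list_prod_closed[of xs]
    by (simp add: ring_list_prod_def m_assoc)
qed

lemma tuples_app: "t \<in> tuples \<Longrightarrow> i < k \<Longrightarrow> t i \<in> carrier R"
  by (erule PiE_mem) simp

lemma tuple_prod_closed:
  assumes "t \<in> tuples"
  shows "tuple_prod t \<in> carrier R"
  unfolding tuple_prod_def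
  by (rule ring_list_prod_closed) (simp add: image_subset_iff tuples_app[OF assms])

lemma tuple_prod_update:
  assumes t: "t \<in> tuples" and i: "i < k"
  obtains x y where "x \<in> carrier R" "y \<in> carrier R"
    "\<And>c. c \<in> carrier R \<Longrightarrow> tuple_prod (t(i := c)) = x \<otimes> (c \<otimes> y)"
proof
  let ?xs = "map t [0..<i]" and ?ys = "map t [Suc i..<k]"
  have sub: "set ?xs \<subseteq> carrier R" "set ?ys \<subseteq> carrier R"
    using i by (simp_all add: image_subset_iff tuples_app[OF t])
  show "ring_list_prod R ?xs \<in> carrier R" "ring_list_prod R ?ys \<in> carrier R"
    using sub by (simp_all only: ring_list_prod_closed)
  fix c assume c: "c \<in> carrier R"
  have "[0..<k] = [0..<i] @ i # [Suc i..<k]"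
    using upt_add_eq_append[of 0 i "k - i"] upt_conv_Cons[OF i] i by simp
  then have "map (t(i := c)) [0..<k] = ?xs @ c # ?ys"
    by simp
  then show "tuple_prod (t(i := c)) = ring_list_prod R ?xs \<otimes> (c \<otimes> ring_list_prod R ?ys)"
    unfolding tuple_prod_def using ring_list_prod_append[OF sub(1), of "c # ?ys"] sub(2) c
    by (simp add: ring_list_prod_def)
qed

lemma multiadditive_coef_tuple_prod:
  assumes "j \<le> n"
  shows "multiadditive (\<lambda>t. coef j (tuple_prod t))"
  unfolding multiadditive_def
proof (intro ballI allI impI)
  fix t i a b assume t: "t \<in> tuples" "i < k" and ab: "a \<in> carrier R" "b \<in> carrier R"
  obtain x y where xy: "x \<in> carrier R" "y \<in> carrier R"
    "\<And>c. c \<in> carrier R \<Longrightarrow> tuple_prod (t(i := c)) = x \<otimes> (c \<otimes> y)"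
    using tuple_prod_update[OF t] by metis
  show "coef j (tuple_prod (t(i := a \<oplus> b))) = coef j (tuple_prod (t(i := a))) + coef j (tuple_prod (t(i := b)))"
    unfolding xy(3)[OF ab(1)] xy(3)[OF ab(2)] xy(3)[OF a_closed[OF ab]]
    using assms xy(1,2) ab by (simp add: l_distr r_distr coef_add)
qed

text \<open>The functional that reads off the coefficient of the monomial with exponents
  \<open>v\<close>; the bound \<open>n\<close> keeps each \<open>coef\<close> additive.\<close>

lemma multiadditive_coef_prod:
  assumes "\<And>i. i < k \<Longrightarrow> v i \<le> n"
  shows "multiadditive (\<lambda>t. \<Prod>i<k. coef (v i) (t i))"
  unfolding multiadditive_def
proof (intro ballI allI impI)
  fix t i a b assume i: "i < k" and ab: "a \<in> carrier R" "b \<in> carrier R"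
  have "(\<Prod>j<k. coef (v j) ((t(i := c)) j)) = coef (v i) c * (\<Prod>j\<in>{..<k} - {i}. coef (v j) (t j))" for c
    using i by (subst prod.remove[of _ i]) (auto intro!: prod.cong)
  then show "(\<Prod>j<k. coef (v j) ((t(i := a \<oplus> b)) j)) =
      (\<Prod>j<k. coef (v j) ((t(i := a)) j)) + (\<Prod>j<k. coef (v j) ((t(i := b)) j))"
    using coef_add[OF assms[OF i] ab] by (simp only: distrib_right)
qed

lemma coef_finsum:
  assumes "finite A" "g \<in> A \<rightarrow> carrier R" "j \<le> n"
  shows "coef j (finsum R g A) = (\<Sum>x\<in>A. coef j (g x))"
  using assms(1,2)
proof (induction A rule: finite_induct)
  case empty
  then show ?case by (simp add: coef_zero assms(3))
next
  case (insert x A)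
  then show ?case
    by (simp add: finsum_insert coef_add assms(3))
qed

lemma eq_if_coef_eq:
  assumes "x \<in> carrier R" "y \<in> carrier R" "\<And>j. j \<le> n \<Longrightarrow> coef j x = coef j y"
  shows "x = y"
proof -
  obtain p q where pq: "x = \<rho> p" "y = \<rho> q"
    using assms(1,2) rho_range by blast
  have "coeff (p + q) j = 0" if "j < Suc n" for j
    using assms(3)[of j] that by (simp add: pq coef_rho)
  then have "\<rho> (p + q) = \<zero>"
    unfolding rho_eq_zero_iff monom_1_dvd_iff' by blast
  moreover have "p = (p + q) + q"
    by (rule poly_eqI) (simp only: coeff_add add.assoc bit_add_same add_0_right)
  ultimately show ?thesis
    unfolding pq by (metis rho_add rho_closed l_zero)
qed

lemma free_iterated_mult_closed: "f \<in> carrier G \<Longrightarrow> free_iterated_mult k R f \<in> carrier R"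
  unfolding free_iterated_mult_def tuple_prod_def[symmetric]
  by (rule finsum_closed) (use tuple_prod_closed in \<open>auto simp: G_simps\<close>)

lemma coef_free_iterated_mult:
  assumes "f \<in> carrier G" "j \<le> n"
  shows "coef j (free_iterated_mult k R f) = lin_ext (\<lambda>t. coef j (tuple_prod t)) f"
  unfolding free_iterated_mult_def tuple_prod_def[symmetric] lin_ext_def
  by (rule coef_finsum) (use assms tuple_prod_closed in \<open>auto simp: G_simps\<close>)

text \<open>Each coefficient of the free multiplication is a multiadditive functional and so
  vanishes on the tensor ideal. The multiplication is therefore constant on cosets, and
  \<open>the_elem\<close> is applied to a singleton.\<close>

lemma iterated_mult_tensor_class:
  assumes f: "f \<in> carrier G"
  shows "iterated_mult k R (tensor_class f) = free_iterated_mult k R f"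
proof -
  have "free_iterated_mult k R g = free_iterated_mult k R f" if g: "g \<in> tensor_class f" for g
  proof -
    have gf: "g + f \<in> I"
      using g mem_tensor_class_iff[OF f] by blast
    have geq: "g = (g + f) + f"
      by (simp only: G_add_cancel)
    then have gG: "g \<in> carrier G"
      using add_in_G[of "g + f" f] gf I_subset f by (metis subsetD)
    show ?thesis
    proof (rule eq_if_coef_eq)
      fix j assume j: "j \<le> n"
      have "lin_ext (\<lambda>t. coef j (tuple_prod t)) (g + f) = 0"
        by (rule I_annihilated[OF gf multiadditive_coef_tuple_prod[OF j]])
      then show "coef j (free_iterated_mult k R g) = coef j (free_iterated_mult k R f)"
        by (simp only: coef_free_iterated_mult[OF gG j] coef_free_iterated_mult[OF f j] lin_ext_add_bit
            bit_add_eq_0_iff)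
    qed (simp_all only: free_iterated_mult_closed f gG)
  qed
  moreover have "f \<in> tensor_class f"
    unfolding mem_tensor_class_iff[OF f] by (simp only: bit_poly_mapping_add_same I_zero)
  ultimately have "free_iterated_mult k R ` tensor_class f = {free_iterated_mult k R f}"
    by blast
  then show ?thesis
    by (simp add: iterated_mult_def)
qed

definition tdeg :: "(nat \<Rightarrow>\<^sub>0 nat) \<Rightarrow> nat" where
  "tdeg v = (\<Sum>i<k. Poly_Mapping.lookup v i)"

lemma tuple_prod_expo: "tuple_prod (expo v) = \<rho> (monom 1 (tdeg v))"
proof -
  have list: "ring_list_prod R (map (\<lambda>i. \<rho> (monom 1 (w i))) xs) = \<rho> (monom 1 (sum_list (map w xs)))"
    for w :: "nat \<Rightarrow> nat" and xs :: "nat list"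
    by (induction xs)
       (simp_all add: ring_list_prod_def rho_one monom_0 mult_monom flip: one_pCons rho_mult)
  have "map (expo v) [0..<k] = map (\<lambda>i. \<rho> (monom 1 (Poly_Mapping.lookup v i))) [0..<k]"
    by (rule map_cong) (auto simp: expo_def)
  then have "tuple_prod (expo v) = \<rho> (monom 1 (sum_list (map (Poly_Mapping.lookup v) [0..<k])))"
    unfolding tuple_prod_def by (simp only: list)
  then show ?thesis
    by (simp add: tdeg_def sum_list_distinct_conv_sum_set atLeast0LessThan)
qed

text \<open>The multiplication identifies all variables, so a monomial becomes the power given by
  its total degree. The class lies in the kernel when each total degree up to \<open>n\<close> is
  attained by an even number of monomials.\<close>

lemma mem_kernel_iff:
  "tensor_class (Theta p) \<in> a_kernel T R (iterated_mult k R) \<longleftrightarrow>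
    (\<forall>j\<le>n. lin_ext (\<lambda>v. if tdeg v = j then 1 else 0 :: bit) p = 0)"
proof -
  have "tensor_class (Theta p) \<in> carrier T"
    by (rule ring_hom_closed[OF tensor_class_hom Theta_in_G])
  then have "tensor_class (Theta p) \<in> a_kernel T R (iterated_mult k R) \<longleftrightarrow> free_iterated_mult k R (Theta p) = \<zero>"
    by (simp add: a_kernel_def kernel_def iterated_mult_tensor_class[OF Theta_in_G])
  also have "\<dots> \<longleftrightarrow> (\<forall>j\<le>n. coef j (free_iterated_mult k R (Theta p)) = 0)"
    using eq_zero_if_coef_zero[OF free_iterated_mult_closed[OF Theta_in_G]] coef_zero by metis
  also have "\<dots> \<longleftrightarrow> (\<forall>j\<le>n. lin_ext (\<lambda>v. if tdeg v = j then 1 else 0 :: bit) p = 0)"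
    by (simp add: coef_free_iterated_mult[OF Theta_in_G] lin_ext_Theta tuple_prod_expo coef_rho)
  finally show ?thesis .
qed

lemma Theta_monomial: "Theta (\<Prod>i<k. var i ^ Poly_Mapping.lookup v i) = Poly_Mapping.single (expo v) 1"
proof -
  have "Poly_Mapping.lookup (\<Sum>i<k. Poly_Mapping.single i (Poly_Mapping.lookup v i)) j = Poly_Mapping.lookup v j"
    if "j < k" for j
    using that by (simp add: lookup_sum lookup_single when_def)
  then have "expo (\<Sum>i<k. Poly_Mapping.single i (Poly_Mapping.lookup v i)) = expo v"
    unfolding expo_def by (intro restrict_ext) simp
  then show ?thesis
    by (simp only: var_power prod_single_1 Theta_single)
qed

text \<open>\<open>Theta\<close> ignores variables of index at least \<open>k\<close>, so every
  monomial can be replaced by its part in the first \<open>k\<close> variables.\<close>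

lemma Theta_lin_ext_monomial:
  "Theta (lin_ext (\<lambda>v. \<Prod>i<k. var i ^ Poly_Mapping.lookup v i) p) = Theta p"
  using subset_UNIV by (induction p rule: bit_poly_mapping_induct)
    (simp_all only: lin_ext_zero lin_ext_single Theta_zero Theta_monomial Theta_single Theta_add
      lin_ext_add bit_poly_mapping_add_same)

lemma lookup_lin_ext:
  "Poly_Mapping.lookup (lin_ext \<phi> p) w = lin_ext (\<lambda>v. Poly_Mapping.lookup (\<phi> v) w) p"
  by (simp add: lin_ext_def lookup_sum)

text \<open>The coefficient of a power of \<open>var r\<close> counts the monomials of that total
  degree modulo 2; on the kernel only powers above \<open>n\<close> survive.\<close>

lemma diagonal_part_in_trunc_ideal:
  assumes "r < k" and zero: "\<And>j. j \<le> n \<Longrightarrow> lin_ext (\<lambda>v. if tdeg v = j then 1 else 0 :: bit) p = 0"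
  shows "lin_ext (\<lambda>v. var r ^ tdeg v) p \<in> trunc_ideal k n"
  unfolding trunc_ideal_def
proof (intro CollectI ballI)
  fix w assume w: "w \<in> Poly_Mapping.keys (lin_ext (\<lambda>v. var r ^ tdeg v) p)"
  have look: "Poly_Mapping.lookup (lin_ext (\<lambda>v. var r ^ tdeg v) p) w =
      lin_ext (\<lambda>v. if Poly_Mapping.single r (tdeg v) = w then 1 else 0) p"
    by (simp add: lookup_lin_ext var_power lookup_single when_def)
  then have nz: "lin_ext (\<lambda>v. if Poly_Mapping.single r (tdeg v) = w then 1 else 0 :: bit) p \<noteq> 0"
    using w by (simp add: in_keys_iff)
  have "\<exists>v. Poly_Mapping.single r (tdeg v) = w"
  proof (rule ccontr)
    assume "\<nexists>v. Poly_Mapping.single r (tdeg v) = w"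
    then have "lin_ext (\<lambda>v. if Poly_Mapping.single r (tdeg v) = w then 1 else 0 :: bit) p = 0"
      by (simp add: lin_ext_def)
    then show False using nz by (rule notE[rotated])
  qed
  then obtain v where v: "Poly_Mapping.single r (tdeg v) = w" ..
  have inj: "Poly_Mapping.single r a = Poly_Mapping.single r b \<longleftrightarrow> a = b" for a b :: nat
    by (metis lookup_single_eq)
  have "\<not> tdeg v \<le> n"
  proof
    assume "tdeg v \<le> n"
    then show False
      using zero nz unfolding v[symmetric] inj by blast
  qed
  then show "\<exists>i<k. n < Poly_Mapping.lookup w i"
    using assms(1) v by (intro exI[of _ r]) auto
qed

text \<open>Replacing each monomial by the power of \<open>var r\<close> of the same total degree
  changes the polynomial by an element of the diagonal ideal, and what results lies in the
  truncation ideal. \<open>W\<close> restricts to the first \<open>k\<close> variables, as the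
  replacement requires.\<close>

lemma kernel_decompose:
  assumes k: "k = Suc r" and u: "u \<in> a_kernel T R (iterated_mult k R)"
  shows "\<exists>a b. diag_power r 1 a \<and> b \<in> trunc_ideal k n \<and> u = tensor_class (Theta (a + b))"
proof -
  have "u \<in> carrier T"
    using u by (simp add: a_kernel_def kernel_def)
  then obtain p where p: "u = tensor_class (Theta p)"
    using T_carrier by blast
  define W where "W = (\<lambda>p. lin_ext (\<lambda>v. \<Prod>i<k. var i ^ Poly_Mapping.lookup v i) p)"
  define D where "D = (\<lambda>p. lin_ext (\<lambda>v. var r ^ tdeg v) p)"
  have "diag_power r 1 (W q + D q)" for q
    using subset_UNIV
  proof (induction q rule: bit_poly_mapping_induct)
    case zero
    then show ?case
      unfolding W_def D_def by (simp only: lin_ext_zero add_0_right diag_power.zero)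
  next
    case (single v)
    show ?case
      using diag_power_monomial[of k r "Poly_Mapping.lookup v"] k
      unfolding W_def D_def lin_ext_single tdeg_def by simp
  next
    case (add f g)
    from diag_power_add[OF this] show ?case
      unfolding W_def D_def lin_ext_add[OF bit_poly_mapping_add_same] by (simp only: ac_simps)
  qed
  moreover have "D p \<in> trunc_ideal k n"
    unfolding D_def by (rule diagonal_part_in_trunc_ideal) (use k u mem_kernel_iff[of p] p in auto)
  moreover have "Theta (W p + D p + D p) = Theta p"
    by (simp only: add.assoc bit_poly_mapping_add_same add_0_right) (simp only: W_def Theta_lin_ext_monomial)
  ultimately show ?thesis
    using p by metis
qed

lemma prod_list_decompose:
  assumes "\<And>p. p \<in> set ps \<Longrightarrow> \<exists>a b. diag_power r 1 a \<and> b \<in> trunc_ideal k n \<and> p = a + b"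
  shows "\<exists>a b. diag_power r (length ps) a \<and> b \<in> trunc_ideal k n \<and> prod_list ps = a + b"
  using assms
proof (induction ps)
  case Nil
  have "diag_power r 0 (1 * diag_prod r (\<lambda>_. 0))"
    by (rule diag_power_diag_prod) simp
  then show ?case
    by (intro exI[of _ 1] exI[of _ 0]) (simp add: diag_prod_def trunc_ideal_zero)
next
  case (Cons p ps)
  obtain a b where ab: "diag_power r (length ps) a" "b \<in> trunc_ideal k n" "prod_list ps = a + b"
    using Cons.IH Cons.prems by (metis list.set_intros(2))
  obtain c d where cd: "diag_power r 1 c" "d \<in> trunc_ideal k n" "p = c + d"
    using Cons.prems by (metis list.set_intros(1))
  have "diag_power r (length (p # ps)) (c * a)"
    using diag_power_mult_diag_power[OF cd(1) ab(1)] by simp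
  \<comment> \<open>All cross terms contain a factor from the truncation ideal, so only the product
    of the diagonal parts matters.\<close>
  moreover have "c * b + (a + b) * d \<in> trunc_ideal k n"
    by (intro trunc_ideal_add trunc_ideal_mult ab(2) cd(2))
  moreover have "prod_list (p # ps) = c * a + (c * b + (a + b) * d)"
    by (simp add: ab(3) cd(3) algebra_simps)
  ultimately show ?case by blast
qed

text \<open>A product of \<open>m\<close> kernel elements lies, up to truncation, in the
  \<open>m\<close>-th power of the diagonal ideal, which is spanned by multiples of
  \<open>diag_prod r a\<close> with exponents summing to \<open>m\<close>. If \<open>m\<close> is no
  digit length, all these lie in the truncation ideal.\<close>

lemma digit_length_if_kernel_product:
  assumes k: "k = Suc r" and us: "set us \<subseteq> a_kernel T R (iterated_mult k R)"
    and nz: "ring_list_prod T us \<noteq> \<zero>\<^bsub>T\<^esub>"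
  shows "digit_length r n (length us)"
proof (rule ccontr)
  assume "\<not> digit_length r n (length us)"
  then have triv: "diag_prod r a \<in> trunc_ideal k n" if "(\<Sum>i<r. a i) = length us" for a
    using digit_length_if_not_trunc[of r a n] that k by metis
  let ?P = "\<lambda>u p. u = tensor_class (Theta p) \<and> (\<exists>a b. diag_power r 1 a \<and> b \<in> trunc_ideal k n \<and> p = a + b)"
  have "\<forall>u\<in>set us. \<exists>p. ?P u p"
  proof
    fix u assume "u \<in> set us"
    then have "u \<in> a_kernel T R (iterated_mult k R)" using us by blast
    from kernel_decompose[OF k this] show "\<exists>p. ?P u p" by blast
  qed
  then obtain f where f: "\<forall>u\<in>set us. ?P u (f u)"
    by (rule bchoice[THEN exE])
  have "map (\<lambda>p. tensor_class (Theta p)) (map f us) = us"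
    unfolding map_map by (rule map_idI) (use f in simp)
  then have prod: "ring_list_prod T us = tensor_class (Theta (prod_list (map f us)))"
    using tensor_class_Theta_list_prod[of "map f us"] by simp
  have "\<exists>a b. diag_power r (length (map f us)) a \<and> b \<in> trunc_ideal k n \<and> prod_list (map f us) = a + b"
    by (rule prod_list_decompose) (use f in auto)
  then obtain a b where ab: "diag_power r (length us) a" "b \<in> trunc_ideal k n" "prod_list (map f us) = a + b"
    by auto
  have "a \<in> trunc_ideal k n"
    by (rule diag_power_in_trunc_ideal[OF ab(1) triv])
  then have "Theta (prod_list (map f us)) \<in> I"
    unfolding ab(3) by (intro Theta_trunc_ideal trunc_ideal_add ab(2))
  then show False
    using nz tensor_class_eq_zero_iff[OF Theta_in_G] unfolding prod by blast
qed

text \<open>The functional \<open>\<mu>\<close> reads off the coefficient of the monomial belonging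
  to \<open>b\<close>. The exponents at \<open>i < r\<close> determine the choice \<open>g\<close>,
  so no other term of the expansion contributes and the odd coefficient remains.\<close>

lemma diag_prod_not_in_I:
  assumes k: "k = Suc r" and b: "b \<in> (\<Pi>\<^sub>E i\<in>{..<r}. {..a i})"
    and odd: "\<And>i. i < r \<Longrightarrow> odd (a i choose b i)"
    and le: "\<And>i. i < r \<Longrightarrow> b i \<le> n" "(\<Sum>i<r. a i - b i) \<le> n"
  shows "Theta (diag_prod r a) \<notin> I"
proof
  assume I: "Theta (diag_prod r a) \<in> I"
  define v where "v = Poly_Mapping.lookup (diag_exponent r a b)"
  define \<mu> where "\<mu> t = (\<Prod>i<k. coef (v i) (t i))" for t
  have v: "v i \<le> n" if "i < k" for i
    using that le k by (cases "i = r") (auto simp: v_def lookup_diag_exponent)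
  have mu: "\<mu> (expo u) = (if \<forall>i<k. Poly_Mapping.lookup u i = v i then 1 else 0)" for u
  proof -
    have "\<mu> (expo u) = (\<Prod>i<k. if Poly_Mapping.lookup u i = v i then 1 else 0)"
      unfolding \<mu>_def expo_def by (rule prod.cong) (simp_all add: coef_rho v)
    also have "\<dots> = (if \<forall>i<k. Poly_Mapping.lookup u i = v i then 1 else 0)"
      by auto
    finally show ?thesis .
  qed
  have summand: "lin_ext (\<lambda>u. \<mu> (expo u)) (of_nat (\<Prod>i<r. a i choose g i) * Poly_Mapping.single (diag_exponent r a g) 1) =
      (if g = b then 1 else 0)" if g: "g \<in> (\<Pi>\<^sub>E i\<in>{..<r}. {..a i})" for g
  proof (cases "g = b")
    case True
    have "odd (\<Prod>i<r. a i choose b i)"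
      using odd by (auto simp: even_prod_iff)
    then have "of_nat (\<Prod>i<r. a i choose g i) * Poly_Mapping.single (diag_exponent r a g) 1 =
        Poly_Mapping.single (diag_exponent r a b) (1 :: bit)"
      by (simp add: of_nat_mpoly2 True del: of_nat_prod)
    then show ?thesis
      using True by (simp only: lin_ext_single mu v_def) simp
  next
    case False
    then obtain i where i: "i < r" "g i \<noteq> b i"
      using g b by (metis PiE_ext lessThan_iff)
    then have "\<not> (\<forall>i<k. Poly_Mapping.lookup (diag_exponent r a g) i = v i)"
      using k by (auto simp: v_def lookup_diag_exponent intro!: exI[of _ i])
    then have "lin_ext (\<lambda>u. \<mu> (expo u)) (Poly_Mapping.single (diag_exponent r a g) 1) = 0"
      by (simp only: lin_ext_single mu if_False)
    then show ?thesis
      using False by (simp add: of_nat_mpoly2 del: of_nat_prod)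
  qed
  have "lin_ext \<mu> (Theta (diag_prod r a)) = (\<Sum>g\<in>(\<Pi>\<^sub>E i\<in>{..<r}. {..a i}). if g = b then 1 else 0)"
    unfolding lin_ext_Theta diag_prod_expand lin_ext_sum_bit by (rule sum.cong[OF refl]) (rule summand)
  also have "\<dots> = 1"
    using b by (subst sum.delta) (auto intro: finite_PiE)
  finally have "lin_ext \<mu> (Theta (diag_prod r a)) = 1" .
  moreover have "multiadditive \<mu>"
    unfolding \<mu>_def by (rule multiadditive_coef_prod) (rule v)
  ultimately show False
    using I_annihilated[OF I] by simp
qed

lemma kernel_product_if_digit_length:
  assumes k: "k = Suc r" and m: "digit_length r n m"
  obtains us where "set us \<subseteq> a_kernel T R (iterated_mult k R)" "length us = m"
    "ring_list_prod T us \<noteq> \<zero>\<^bsub>T\<^esub>"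
proof -
  obtain B C where BC: "\<And>i. i < r \<Longrightarrow> finite (B i) \<and> finite (C i) \<and> B i \<inter> C i = {} \<and> set_encode (B i) \<le> n"
    and C: "(\<Sum>i<r. set_encode (C i)) \<le> n" and m: "m = (\<Sum>i<r. set_encode (B i) + set_encode (C i))"
    using m unfolding digit_length_def by blast
  define a where "a i = set_encode (B i) + set_encode (C i)" for i
  define b where "b = (\<lambda>i\<in>{..<r}. set_encode (B i))"
  \<comment> \<open>The factors of \<open>diag_prod r a\<close> listed singly: the length of the
    list is the sum of all \<open>a i\<close>, and each factor is a zero divisor because its two
    variables have the same total degree 1.\<close>
  define ps where "ps = concat (map (\<lambda>i. replicate (a i) (var i + var r)) [0..<r])"
  have len: "length ps = m"
    by (simp add: ps_def m length_concat o_def sum_list_distinct_conv_sum_set atLeast0LessThan a_def)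
  have "prod_list (concat (map (\<lambda>i. replicate (a i) (var i + var r)) xs)) =
      prod_list (map (\<lambda>i. (var i + var r) ^ a i) xs)" for xs
    by (induction xs) (simp_all add: prod_list_replicate)
  then have prod: "prod_list ps = diag_prod r a"
    by (simp add: ps_def diag_prod_def prod.distinct_set_conv_list[symmetric] atLeast0LessThan)
  have "Theta (diag_prod r a) \<notin> I"
  proof (rule diag_prod_not_in_I[OF k, of b])
    show "b \<in> (\<Pi>\<^sub>E i\<in>{..<r}. {..a i})"
      by (auto simp: b_def a_def)
    show "odd (a i choose b i)" if i: "i < r" for i
    proof -
      have "set_decode (a i) = B i \<union> C i"
        using BC[OF i] by (simp add: a_def set_encode_union_disjoint[symmetric])
      then show ?thesis
        using BC[OF i] i by (simp add: odd_choose_iff b_def)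
    qed
    show "b i \<le> n" if "i < r" for i
      using BC[OF that] that by (simp add: b_def)
    have "(\<Sum>i<r. a i - b i) = (\<Sum>i<r. set_encode (C i))"
      by (rule sum.cong) (simp_all add: a_def b_def)
    then show "(\<Sum>i<r. a i - b i) \<le> n"
      using C by simp
  qed
  then have nz: "ring_list_prod T (map (\<lambda>p. tensor_class (Theta p)) ps) \<noteq> \<zero>\<^bsub>T\<^esub>"
    by (simp only: tensor_class_Theta_list_prod prod tensor_class_eq_zero_iff[OF Theta_in_G] not_False_eq_True)
  have "tensor_class (Theta p) \<in> a_kernel T R (iterated_mult k R)" if p: "p \<in> set ps" for p
  proof -
    obtain i where i: "i < r" "p = var i + var r"
      using p by (auto simp: ps_def)
    have tdeg: "tdeg (Poly_Mapping.single j 1) = 1" if "j < k" for j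
      using that by (simp add: tdeg_def lookup_single when_def)
    have "lin_ext (\<lambda>v. if tdeg v = j then 1 else 0 :: bit) p = 0" for j
    proof -
      have "i < k" "r < k" using i(1) k by simp_all
      then show ?thesis
        unfolding i(2) var_def by (simp only: lin_ext_add_bit lin_ext_single tdeg bit_add_same)
    qed
    then show ?thesis
      unfolding mem_kernel_iff by blast
  qed
  then have "set (map (\<lambda>p. tensor_class (Theta p)) ps) \<subseteq> a_kernel T R (iterated_mult k R)"
    by auto
  then show thesis
    using that len nz by (metis length_map)
qed

end

theorem zcl_eq_max_digit_length:
  assumes "truncated_poly_ring (cohomology_ring X) n \<rho>"
  shows "zcl (Suc r) X = enat (max_digit_length r n)"
proof -
  interpret tensor_truncated_poly_ring "cohomology_ring X" n \<rho> "Suc r"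
    using assms by (simp add: tensor_truncated_poly_ring_def)
  let ?ker = "a_kernel T (cohomology_ring X) (iterated_mult (Suc r) (cohomology_ring X))"
  have zcl: "zcl (Suc r) X =
      Sup {enat (length us) | us. set us \<subseteq> ?ker \<and> ring_list_prod T us \<noteq> \<zero>\<^bsub>T\<^esub>}"
    unfolding zcl_def Let_def ..
  show ?thesis
  proof (rule antisym)
    show "zcl (Suc r) X \<le> enat (max_digit_length r n)"
      unfolding zcl
    proof (rule Sup_least)
      fix x assume "x \<in> {enat (length us) | us. set us \<subseteq> ?ker \<and> ring_list_prod T us \<noteq> \<zero>\<^bsub>T\<^esub>}"
      then obtain us where us: "set us \<subseteq> ?ker" "ring_list_prod T us \<noteq> \<zero>\<^bsub>T\<^esub>" "x = enat (length us)"
        by blast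
      have "length us \<le> max_digit_length r n"
        by (rule digit_length_imp_le_max[OF digit_length_if_kernel_product[OF refl us(1,2)]])
      then show "x \<le> enat (max_digit_length r n)"
        by (simp add: us(3))
    qed
    obtain us where us: "set us \<subseteq> ?ker" "length us = max_digit_length r n" "ring_list_prod T us \<noteq> \<zero>\<^bsub>T\<^esub>"
      by (rule kernel_product_if_digit_length[OF refl digit_length_max])
    show "enat (max_digit_length r n) \<le> zcl (Suc r) X"
      unfolding zcl by (intro Sup_upper CollectI exI[of _ us]) (simp add: us)
  qed
qed

theorem theorem1p6:
  fixes k :: nat
  assumes "k \<ge> 2"
  shows "(zcl k (projective_space 0) = 0 \<and>
          (\<forall>n e d :: nat. n = 2 ^ e + d \<and> d < 2 ^ e \<longrightarrow>
             zcl k (projective_space n) =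
               min (zcl k (projective_space d) + enat (k * 2 ^ e))
                   (enat ((k - 1) * (2 ^ (e + 1) - 1))))) \<and>
         (zcl_gap k 0 = 0 \<and>
          (\<forall>n e d :: nat. n = 2 ^ e + d \<and> d < 2 ^ e \<longrightarrow>
             zcl_gap k n =
               max (zcl_gap k d) (int k * int n - (int k - 1) * (2 ^ (e + 1) - 1))))"
proof -
  obtain r where k: "k = Suc r"
    using assms by (cases k) auto
  have zcl: "zcl k (projective_space n) = enat (max_digit_length r n)" for n
    using cohomology_ring_projective_space[of n] zcl_eq_max_digit_length unfolding k by blast
  have rec: "max_digit_length r n =
      min (max_digit_length r d + k * 2 ^ e) ((k - 1) * (2 ^ (e + 1) - 1))"
    if "n = 2 ^ e + d" "d < 2 ^ e" for n e d
    using max_digit_length_rec[OF that(2), of r] unfolding that(1) k by simp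
  have gap: "zcl_gap k n = int (k * n) - int (max_digit_length r n)" for n
    by (simp add: zcl_gap_def zcl)
  have gap_rec: "zcl_gap k n = max (zcl_gap k d) (int k * int n - (int k - 1) * (2 ^ (e + 1) - 1))"
    if n: "n = 2 ^ e + d" "d < 2 ^ e" for n e d
  proof -
    \<comment> \<open>Neither natural subtraction truncates, since \<open>k = Suc r\<close> and
      \<open>2 ^ (e + 1) \<ge> 1\<close>.\<close>
    have "int ((k - 1) * (2 ^ (e + 1) - 1)) = (int k - 1) * (2 ^ (e + 1) - 1)"
      by (simp add: k of_nat_diff)
    then have "int (max_digit_length r n) =
        min (int (max_digit_length r d) + int (k * 2 ^ e)) ((int k - 1) * (2 ^ (e + 1) - 1))"
      unfolding rec[OF n] by (simp only: of_nat_min of_nat_add)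
    \<comment> \<open>Subtracting the first entry of the minimum from \<open>k * n\<close> cancels
      \<open>k * 2 ^ e\<close> and leaves the gap of \<open>d\<close>; the minimum turns into a
      maximum.\<close>
    moreover have "int (k * n) = int (k * d) + int (k * 2 ^ e)"
      unfolding n(1) by (simp add: algebra_simps)
    moreover have "int k * int n = int (k * n)"
      by simp
    ultimately show ?thesis
      unfolding gap by (simp only: max_def min_def) auto
  qed
  show ?thesis
  proof (intro conjI allI impI)
    show "zcl k (projective_space 0) = 0" "zcl_gap k 0 = 0"
      by (simp_all add: gap zcl max_digit_length_0 zero_enat_def)
    show "zcl k (projective_space n) = min (zcl k (projective_space d) + enat (k * 2 ^ e))
        (enat ((k - 1) * (2 ^ (e + 1) - 1)))" if "n = 2 ^ e + d \<and> d < 2 ^ e" for n e d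
      using rec[of n e d] that by (simp only: zcl plus_enat_simps min_enat_simps)
    show "zcl_gap k n = max (zcl_gap k d) (int k * int n - (int k - 1) * (2 ^ (e + 1) - 1))"
      if "n = 2 ^ e + d \<and> d < 2 ^ e" for n e d
      using gap_rec that by blast
  qed
qed

end
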